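(* There is an absolute constant $c>0$ such that for all nonzero integers $a$ and all $x>1$, $$\sum_{N(\mathfrak{p})\le x}\chi^{6a}(\mathfrak{p})\log N(\mathfrak{p})\log\frac{x}{N(\mathfrak{p})}\ll x\exp\Big(-c\frac{\log x}{\log(1+|a|)+\sqrt{\log x}}\Big)\log^3(1+|a|),$$ the sum being over nonzero prime ideals of $\mathfrak{O}$, with an absolute implied constant.
   Context: $\omega=e^{i\pi/3}$, $\mathfrak{O}=\mathbb{Z}[\omega]$, the ring of integers of $\mathbb{Q}(\sqrt{-3})$; every ideal is principal and the units are $\omega^k$, $0\le k\le 5$. $N$ denotes the ideal norm, $N((\mu))=|\mu|^2$. For $a\in\mathbb{Z}$ the Hecke character $\chi^{6a}$ is defined on nonzero ideals by $\chi^{6a}((\mu))=(\mu/|\mu|)^{6a}$. *)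

theory Defs
  imports "HOL-Analysis.Analysis"
begin

definition eis_omega :: complex where
  "eis_omega = exp (\<i> * of_real pi / 3)"

definition Eis :: "complex set" where
  "Eis = {of_int m + of_int n * eis_omega | m n. True}"

definition eis_ideal :: "complex set \<Rightarrow> bool" where
  "eis_ideal I \<longleftrightarrow> I \<subseteq> Eis \<and> 0 \<in> I \<and> (\<forall>u\<in>I. \<forall>v\<in>I. u + v \<in> I)
     \<and> (\<forall>r\<in>Eis. \<forall>u\<in>I. r * u \<in> I)"

definition eis_prime_ideal :: "complex set \<Rightarrow> bool" where
  "eis_prime_ideal P \<longleftrightarrow> eis_ideal P \<and> P \<noteq> Eis
     \<and> (\<forall>u\<in>Eis. \<forall>v\<in>Eis. u * v \<in> P \<longrightarrow> u \<in> P \<or> v \<in> P)"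

definition eis_nonzero_primes :: "complex set set" where
  "eis_nonzero_primes = {P. eis_prime_ideal P \<and> P \<noteq> {0}}"

definition eis_principal :: "complex \<Rightarrow> complex set" where
  "eis_principal \<mu> = {\<mu> * r | r. r \<in> Eis}"

text \<open>Ideal norm: N((mu)) = |mu|^2 (every ideal is principal).\<close>
definition eis_norm :: "complex set \<Rightarrow> real" where
  "eis_norm I = (THE t. \<exists>\<mu>\<in>Eis. I = eis_principal \<mu> \<and> t = (cmod \<mu>)\<^sup>2)"

definition hecke_chi6 :: "int \<Rightarrow> complex set \<Rightarrow> complex" where
  "hecke_chi6 a I = (THE z. \<exists>\<mu>\<in>Eis. \<mu> \<noteq> 0 \<and> I = eis_principal \<mu> \<and>
       z = (\<mu> / of_real (cmod \<mu>)) powi (6 * a))"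

end

theory Submission
  imports Defs "HOL-Complex_Analysis.Complex_Analysis"
begin

text \<open>
  For \<open>a \<noteq> 0\<close> the sum of \<open>(\<mu> / |\<mu>|)^(6 a)\<close> over the lattice points of a disc of radius \<open>r\<close> differs from
  an integral that vanishes by rotation by at most \<open>O(|a| r^(3/2))\<close>. Hence partial summation alone
  continues \<open>L(s, \<chi>)\<close> to \<open>Re s > 3/4\<close> with the bound \<open>O(|a| |s|)\<close>; no functional equation is needed.
  The identity \<open>- L' = (\<Sum> \<chi> \<Lambda> N^-s) L\<close>, a form of unique factorisation, and \<open>3 + 4 cos \<theta> + cos 2\<theta> \<ge> 0\<close>
  then give the zero-free region \<open>Re s > 1 - c / log (|a| + |t| + 4)\<close>. There is no exceptional zero, because
  \<open>\<chi>^2\<close> is again nontrivial. The Borel-Caratheodory theorem bounds \<open>L'/L\<close> by the square of the logarithm inside it.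
  Finally the Perron integral with kernel \<open>x^s / s^2\<close>, truncated at height \<open>T = exp (c log x / (log (1 + |a|) + sqrt (log x)))\<close>,
  is moved to the left; with this \<open>T\<close> every segment may be estimated by length times supremum.
\<close>

section \<open>Arithmetic of the Eisenstein integers\<close>

text \<open>The exponent 3/2 comes from cutting the disc at radius \<open>sqrt r\<close>. Outside,
  moving a point within its lattice cell changes the angular factor by O(|a| / sqrt r); inside, the
  trivial bound costs only O(r). The error is thus majorised by disc indicators, and r^(3/2) is
  N^(3/4) for the norm N = r^2, which leaves a strip of width 1/4 to the left of 1. The obstacle is
  a lower bound for |L| at the centres of the discs on which zeros are studied. It comes from the
  monotonicity in \<sigma> of |L(\<sigma> + it)| times the zeta function of the lattice, and it
  costs ln (1 / (\<sigma> - 1)). In the 3-4-1 inequality \<sigma> - 1 is \<eta> / l with l the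
  logarithm of the height, so this loss is O(l / sqrt \<eta>) against main terms of size l / \<eta>,
  and a small \<eta> makes it harmless. T balances the truncation error x / T against the shifted
  integral. The outcome still carries a factor A^2 + L with A = log (1 + |a|) and L = log x; giving
  up half of the exponential saving turns it into A^3.\<close>

lemma eis_omega_eq: "eis_omega = Complex (1/2) (sqrt 3 / 2)"
proof -
  have "eis_omega = cis (pi/3)"
    by (simp add: eis_omega_def cis_conv_exp)
  thus ?thesis by (simp add: complex_eq_iff cos_60 sin_60)
qed

lemma eis_omega_square: "eis_omega * eis_omega = eis_omega - 1"
  by (simp add: eis_omega_eq complex_eq_iff)

lemma Eis_I [intro]: "of_int m + of_int n * eis_omega \<in> Eis"
  by (auto simp: Eis_def)

lemma Eis_E: assumes "\<mu> \<in> Eis" obtains m n where "\<mu> = of_int m + of_int n * eis_omega"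
  using assms by (auto simp: Eis_def)

lemma Eis_0 [simp]: "0 \<in> Eis" and Eis_1 [simp]: "1 \<in> Eis"
  using Eis_I[of 0 0] Eis_I[of 1 0] by auto

lemma Eis_add [simp]: assumes "u \<in> Eis" "v \<in> Eis" shows "u + v \<in> Eis"
proof -
  obtain m n m' n' where "u = of_int m + of_int n * eis_omega" "v = of_int m' + of_int n' * eis_omega"
    using assms by (meson Eis_E)
  then have "u + v = of_int (m+m') + of_int (n+n') * eis_omega" by (simp add: algebra_simps)
  then show ?thesis by (metis Eis_I)
qed

lemma Eis_uminus [simp]: assumes "u \<in> Eis" shows "- u \<in> Eis"
proof -
  obtain m n where "u = of_int m + of_int n * eis_omega" using assms by (meson Eis_E)
  then have "-u = of_int (-m) + of_int (-n) * eis_omega" by (simp add: algebra_simps)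
  then show ?thesis by (metis Eis_I)
qed

lemma Eis_diff [simp]: "u \<in> Eis \<Longrightarrow> v \<in> Eis \<Longrightarrow> u - v \<in> Eis"
  using Eis_add[of u "-v"] by simp

lemma Eis_mult [simp]: assumes "u \<in> Eis" "v \<in> Eis" shows "u * v \<in> Eis"
proof -
  obtain m n m' n' where uv: "u = of_int m + of_int n * eis_omega" "v = of_int m' + of_int n' * eis_omega"
    using assms by (meson Eis_E)
  have "u * v = of_int m * of_int m' + (of_int m * of_int n' + of_int n * of_int m') * eis_omega
      + of_int n * of_int n' * (eis_omega * eis_omega)"
    by (simp add: uv algebra_simps)
  also have "\<dots> = of_int (m*m' - n*n') + of_int (m*n' + n*m' + n*n') * eis_omega"
    unfolding eis_omega_square by (simp add: algebra_simps)
  finally show ?thesis by (metis Eis_I)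
qed

lemma Eis_power [simp]: "u \<in> Eis \<Longrightarrow> u ^ k \<in> Eis"
  by (induction k) auto

lemma cmod_lattice_real: "(cmod (of_real x + of_real y * eis_omega))\<^sup>2 = x\<^sup>2 + x*y + y\<^sup>2"
proof -
  have "(cmod (of_real x + of_real y * eis_omega))\<^sup>2 = (x + y/2)\<^sup>2 + (y * sqrt 3/2)\<^sup>2"
    by (simp add: eis_omega_eq cmod_power2)
  also have "\<dots> = x\<^sup>2 + x*y + y\<^sup>2" by (simp add: power2_eq_square algebra_simps)
  finally show ?thesis .
qed

lemma cmod_lattice: "(cmod (of_int m + of_int n * eis_omega))\<^sup>2 = of_int (m\<^sup>2 + m*n + n\<^sup>2)"
  using cmod_lattice_real[of "of_int m" "of_int n"] by simp

lemma Eis_norm_nat: assumes "\<mu> \<in> Eis" obtains n :: nat where "(cmod \<mu>)\<^sup>2 = real n"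
proof -
  obtain m n where *: "\<mu> = of_int m + of_int n * eis_omega" using assms by (meson Eis_E)
  have "(cmod \<mu>)\<^sup>2 = of_int (m\<^sup>2 + m*n + n\<^sup>2)" unfolding * by (rule cmod_lattice)
  moreover from this have "0 \<le> m\<^sup>2 + m*n + n\<^sup>2" by (metis of_int_0_le_iff zero_le_power2)
  ultimately show ?thesis using that[of "nat (m\<^sup>2 + m*n + n\<^sup>2)"] by simp
qed

lemma Eis_norm_ge_1: assumes "\<mu> \<in> Eis" "\<mu> \<noteq> 0" shows "cmod \<mu> \<ge> 1"
proof -
  obtain n :: nat where n: "(cmod \<mu>)\<^sup>2 = real n" using Eis_norm_nat assms by blast
  with assms have "n \<noteq> 0" by (metis norm_eq_zero of_nat_0 power_eq_0_iff)
  with n have "(cmod \<mu>)\<^sup>2 \<ge> 1" by simp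
  then show ?thesis using power2_le_imp_le[of 1 "cmod \<mu>"] by simp
qed

lemma Eis_norm_ge_2: assumes "\<mu> \<in> Eis" "cmod \<mu> > 1" shows "(cmod \<mu>)\<^sup>2 \<ge> 2"
proof -
  obtain n :: nat where n: "(cmod \<mu>)\<^sup>2 = real n" using Eis_norm_nat assms by blast
  have "(cmod \<mu>)\<^sup>2 > 1" using assms by (simp add: one_less_power)
  with n show ?thesis by simp
qed

text \<open>This is why sixth powers of angles depend on the ideal only. Four times the norm form is
  a square plus 3 n^2, so an element of norm one has both coordinates in {-1, 0, 1} and a finite
  check remains.\<close>

lemma Eis_unit_power6:
  assumes "\<mu> \<in> Eis" "cmod \<mu> = 1" shows "\<mu> ^ 6 = 1"
proof -
  obtain m n where *: "\<mu> = of_int m + of_int n * eis_omega" using assms by (meson Eis_E)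
  have 1: "m\<^sup>2 + m*n + n\<^sup>2 = 1" proof -
    have "of_int (m\<^sup>2 + m*n + n\<^sup>2) = (1::real)" using cmod_lattice[of m n] assms(2) * by (simp only: power_one)
    then show ?thesis by (simp only: of_int_eq_1_iff)
  qed
  then have "(2*m+n)\<^sup>2 + 3*n\<^sup>2 = 4" "(2*n+m)\<^sup>2 + 3*m\<^sup>2 = 4" by (simp_all add: power2_eq_square algebra_simps)
  then have "3 * n\<^sup>2 \<le> 4" "3 * m\<^sup>2 \<le> 4" using zero_le_power2[of "2*m+n"] zero_le_power2[of "2*n+m"] by linarith+
  then have "n\<^sup>2 < 2\<^sup>2" "m\<^sup>2 < 2\<^sup>2" by simp_all
  then have "\<bar>n\<bar> < 2" "\<bar>m\<bar> < 2" by (auto intro: power2_less_imp_less[of "\<bar>n\<bar>" 2] power2_less_imp_less[of "\<bar>m\<bar>" 2])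
  then have "m \<in> {-1,0,1}" "n \<in> {-1,0,1}" by auto
  moreover have w3: "eis_omega ^ 3 = -1"
  proof -
    have "eis_omega ^ 3 = (eis_omega * eis_omega) * eis_omega" by (simp add: power3_eq_cube)
    also have "\<dots> = eis_omega * eis_omega - eis_omega" by (subst eis_omega_square) (simp add: left_diff_distrib)
    also have "\<dots> = -1" unfolding eis_omega_square by simp
    finally show ?thesis .
  qed
  moreover have w6: "eis_omega ^ 6 = 1"
    using power_mult[of eis_omega 3 2] w3 by simp
  moreover have w12: "(eis_omega - 1) ^ 6 = 1" "(1 - eis_omega) ^ 6 = 1"
  proof -
    \<comment> \<open>By \<open>eis_omega_square\<close>, \<open>eis_omega - 1\<close> is the square
      of \<open>eis_omega\<close>.\<close>
    have "(eis_omega - 1)^6 = (eis_omega ^ 6) ^ 2"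
      unfolding eis_omega_square[symmetric] by (simp add: power_mult_distrib power2_eq_square)
    then show "(eis_omega - 1)^6 = 1" by (simp add: w6)
    then show "(1 - eis_omega)^6 = 1" using power_minus_even[of 6 "eis_omega - 1"] by simp
  qed
  ultimately show ?thesis using 1 * by auto
qed

text \<open>Rounding both lattice coordinates leaves offsets of at most 1/2, where u^2 + u v + v^2
  is at most 3/4; so the norm is Euclidean.\<close>

lemma Eis_division:
  obtains q where "q \<in> Eis" "cmod (z - q) < 1"
proof -
  define y where "y = Im z * 2 / sqrt 3"
  define x where "x = Re z - y/2"
  have z: "z = of_real x + of_real y * eis_omega"
    by (simp add: complex_eq_iff x_def y_def eis_omega_eq)
  define q where "q = of_int (round x) + of_int (round y) * eis_omega"
  define u where "u = x - of_int (round x)"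
  define v where "v = y - of_int (round y)"
  have uv: "\<bar>u\<bar> \<le> 1/2" "\<bar>v\<bar> \<le> 1/2"
    using of_int_round_abs_le[of x] of_int_round_abs_le[of y] by (auto simp: u_def v_def abs_minus_commute)
  have "z - q = of_real u + of_real v * eis_omega"
    by (simp add: z q_def u_def v_def algebra_simps)
  then have "(cmod (z - q))\<^sup>2 = u\<^sup>2 + u * v + v\<^sup>2" by (simp only: cmod_lattice_real)
  also have "\<dots> \<le> (1/2)\<^sup>2 + (1/2)*(1/2) + (1/2)\<^sup>2"
  proof (intro add_mono)
    show "u\<^sup>2 \<le> (1/2)\<^sup>2" "v\<^sup>2 \<le> (1/2)\<^sup>2" using uv by (meson abs_ge_zero abs_le_square_iff abs_of_nonneg divide_nonneg_nonneg order_trans power2_le_iff_abs_le zero_le_numeral zero_le_one)+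
    have "u * v \<le> \<bar>u\<bar>*\<bar>v\<bar>" by (metis abs_ge_self abs_mult)
    also have "\<dots> \<le> 1/2*(1/2)" using uv by (intro mult_mono) auto
    finally show "u * v \<le> 1/2*(1/2)" .
  qed
  also have "\<dots> < 1\<^sup>2" by (simp add: power2_eq_square)
  finally have "cmod (z - q) < 1" by (rule power2_less_imp_less) simp
  then show ?thesis using that[of q] by (auto simp: q_def)
qed

section \<open>Divisibility, principal ideals and the character on generators\<close>

definition eis_dvd :: "complex \<Rightarrow> complex \<Rightarrow> bool" where
  "eis_dvd u v \<longleftrightarrow> (\<exists>r\<in>Eis. v = u * r)"

lemma eis_ideal_principal: assumes "\<mu> \<in> Eis" shows "eis_ideal (eis_principal \<mu>)"
  unfolding eis_ideal_def
proof (intro conjI ballI)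
  show "eis_principal \<mu> \<subseteq> Eis" using assms by (auto simp: eis_principal_def)
  show "0 \<in> eis_principal \<mu>" unfolding eis_principal_def by (rule CollectI, rule exI[of _ 0]) auto
  fix u v assume "u \<in> eis_principal \<mu>" "v \<in> eis_principal \<mu>"
  then obtain r s where "u = \<mu> * r" "v = \<mu> * s" "r \<in> Eis" "s \<in> Eis" by (auto simp: eis_principal_def)
  then show "u + v \<in> eis_principal \<mu>" unfolding eis_principal_def
    by (intro CollectI exI[of _ "r+s"]) (auto simp: distrib_left)
next
  fix r u assume "r \<in> Eis" "u \<in> eis_principal \<mu>"
  then obtain s where "u = \<mu> * s" "s \<in> Eis" by (auto simp: eis_principal_def)
  with \<open>r \<in> Eis\<close> show "r * u \<in> eis_principal \<mu>" unfolding eis_principal_def by (intro CollectI exI[of _ "r * s"]) auto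
qed

lemma eis_principal_self: "\<mu> \<in> eis_principal \<mu>"
  by (auto simp: eis_principal_def intro!: exI[of _ 1])

lemma mem_eis_principal: "v \<in> eis_principal u \<longleftrightarrow> eis_dvd u v"
  by (auto simp: eis_principal_def eis_dvd_def)

lemma Eis_has_least_norm:
  assumes "A \<subseteq> Eis" "A \<noteq> {}"
  obtains \<mu> where "\<mu> \<in> A" "\<And>\<nu>. \<nu> \<in> A \<Longrightarrow> cmod \<mu> \<le> cmod \<nu>"
proof -
  define h where "h \<mu> = nat \<lfloor>(cmod \<mu>)\<^sup>2\<rfloor>" for \<mu>
  obtain \<mu> where \<mu>: "\<mu> \<in> A" "\<And>\<nu>. \<nu> \<in> A \<Longrightarrow> h \<mu> \<le> h \<nu>"
    using ex_has_least_nat[of "\<lambda>x. x \<in> A" _ h] assms(2) by blast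
  have h: "(cmod \<nu>)\<^sup>2 = real (h \<nu>)" if "\<nu> \<in> A" for \<nu>
  proof -
    from that assms(1) have "\<nu> \<in> Eis" by auto
    then obtain n :: nat where "(cmod \<nu>)\<^sup>2 = real n" using Eis_norm_nat by blast
    then show ?thesis by (simp add: h_def)
  qed
  show ?thesis
  proof (rule that[OF \<mu>(1)])
    fix \<nu> assume "\<nu> \<in> A"
    then have "(cmod \<mu>)\<^sup>2 \<le> (cmod \<nu>)\<^sup>2" using h \<mu> by simp
    then show "cmod \<mu> \<le> cmod \<nu>" by (rule power2_le_imp_le) simp
  qed
qed

text \<open>A nonzero element of least norm generates: the remainder of any other element after
  division by it lies in the ideal and has smaller norm.\<close>

lemma eis_ideal_is_principal:
  assumes I: "eis_ideal I" obtains \<mu> where "\<mu> \<in> Eis" "I = eis_principal \<mu>"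
proof (cases "I = {0}")
  case True
  have "eis_principal 0 = {0}" unfolding eis_principal_def using Eis_0 by auto
  with True that[of 0] show ?thesis by simp
next
  case False
  have IE: "I \<subseteq> Eis" "0 \<in> I" using I by (auto simp: eis_ideal_def)
  have clo: "r * u \<in> I" if "r \<in> Eis" "u \<in> I" for r u using I that by (auto simp: eis_ideal_def)
  have add: "u + v \<in> I" if "u \<in> I" "v \<in> I" for u v using I that by (auto simp: eis_ideal_def)
  have "I - {0} \<noteq> {}" using False IE by auto
  then obtain \<mu> where \<mu>: "\<mu> \<in> I - {0}" "\<And>\<nu>. \<nu> \<in> I - {0} \<Longrightarrow> cmod \<mu> \<le> cmod \<nu>"
    using Eis_has_least_norm[of "I - {0}"] IE(1) by (metis Diff_subset order_trans)
  have "I = eis_principal \<mu>"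
  proof (intro equalityI subsetI)
    fix v assume v: "v \<in> I"
    obtain q where q: "q \<in> Eis" "cmod (v / \<mu> - q) < 1" using Eis_division by blast
    have mem: "v - q * \<mu> \<in> I" using add[OF v clo[of "-q" \<mu>]] q \<mu> by simp
    have "cmod (v - q * \<mu>) = cmod \<mu> * cmod (v / \<mu> - q)"
      using \<mu>(1) by (simp add: norm_mult[symmetric] right_diff_distrib mult.commute)
    also have "\<dots> < cmod \<mu>" using q(2) \<mu>(1) by simp
    finally have "v - q * \<mu> = 0" using \<mu>(2)[of "v - q * \<mu>"] mem by force
    then show "v \<in> eis_principal \<mu>" using q(1) by (auto simp: eis_principal_def intro!: exI[of _ q])
  next
    fix v assume "v \<in> eis_principal \<mu>"
    then obtain r where "v = \<mu> * r" "r \<in> Eis" by (auto simp: eis_principal_def)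
    then show "v \<in> I" using clo[of r \<mu>] \<mu>(1) by (simp add: mult.commute)
  qed
  with that[of \<mu>] \<mu>(1) IE show ?thesis by blast
qed

text \<open>Uniqueness of generators up to units is what makes the descriptions by
  \<open>THE\<close> in \<open>eis_norm\<close> and \<open>hecke_chi6\<close> well defined.\<close>

lemma eis_principal_eq_unit:
  assumes "\<mu> \<in> Eis" "\<nu> \<in> Eis" "eis_principal \<mu> = eis_principal \<nu>"
  obtains u where "u \<in> Eis" "cmod u = 1" "\<nu> = u * \<mu>"
proof (cases "\<mu> = 0")
  case True
  then have "\<nu> \<in> eis_principal 0" using assms by (auto simp: eis_principal_def intro!: exI[of _ 1])
  then show ?thesis using True that[of 1] by (auto simp: eis_principal_def)
next
  case False
  have "\<nu> \<in> eis_principal \<mu>" "\<mu> \<in> eis_principal \<nu>"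
    using assms(3) eis_principal_self by blast+
  then obtain r s where rs: "r \<in> Eis" "s \<in> Eis" "\<nu> = \<mu> * r" "\<mu> = \<nu> * s" unfolding eis_principal_def by blast
  then have "r * s = 1" using False by (metis mult.assoc mult_cancel_left1)
  then have "cmod r * cmod s = 1" "r \<noteq> 0" "s \<noteq> 0" by (auto simp flip: norm_mult)
  moreover have "cmod r \<ge> 1" "cmod s \<ge> 1" using Eis_norm_ge_1 rs calculation by auto
  moreover from this have "cmod r * 1 \<le> cmod r * cmod s" by (intro mult_left_mono) auto
  ultimately have "cmod r = 1" by simp
  then show ?thesis using that[of r] rs(1,3) by (simp add: mult.commute)
qed

text \<open>The character on generators. Because \<open>0 / 0 = 0\<close>, its value at 0 is 0 for
  \<open>a \<noteq> 0\<close> but 1 for \<open>a = 0\<close>, so the origin contributes to a lattice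
  sum exactly in the second case.\<close>

definition hecke_ang :: "int \<Rightarrow> complex \<Rightarrow> complex" where
  "hecke_ang a \<mu> = (\<mu> / of_real (cmod \<mu>)) powi (6 * a)"

lemma hecke_ang_mult: "hecke_ang a (\<mu> * \<nu>) = hecke_ang a \<mu> * hecke_ang a \<nu>"
  by (simp add: hecke_ang_def norm_mult power_int_mult_distrib[symmetric])

lemma hecke_ang_power: "hecke_ang a (\<mu> ^ k) = hecke_ang a \<mu> ^ k"
  by (induction k) (auto simp: hecke_ang_mult, simp add: hecke_ang_def)

lemma cmod_hecke_ang: "\<mu> \<noteq> 0 \<Longrightarrow> cmod (hecke_ang a \<mu>) = 1"
  by (simp add: hecke_ang_def norm_power_int norm_divide)

lemma cmod_hecke_ang_le: "cmod (hecke_ang a \<mu>) \<le> 1"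
proof (cases "\<mu> = 0")
  case True then show ?thesis by (simp add: hecke_ang_def power_int_0_left_if)
qed (simp add: cmod_hecke_ang)

lemma hecke_ang_unit: "u \<in> Eis \<Longrightarrow> cmod u = 1 \<Longrightarrow> hecke_ang a u = 1"
  using Eis_unit_power6[of u] by (simp add: hecke_ang_def power_int_mult)

lemma eis_norm_principal:
  assumes "\<mu> \<in> Eis" shows "eis_norm (eis_principal \<mu>) = (cmod \<mu>)\<^sup>2"
  unfolding eis_norm_def
proof (rule the_equality)
  show "\<exists>\<nu>\<in>Eis. eis_principal \<mu> = eis_principal \<nu> \<and> (cmod \<mu>)\<^sup>2 = (cmod \<nu>)\<^sup>2" using assms by blast
  fix t assume "\<exists>\<nu>\<in>Eis. eis_principal \<mu> = eis_principal \<nu> \<and> t = (cmod \<nu>)\<^sup>2"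
  then obtain \<nu> where "\<nu> \<in> Eis" "eis_principal \<mu> = eis_principal \<nu>" "t = (cmod \<nu>)\<^sup>2" by blast
  then show "t = (cmod \<mu>)\<^sup>2" using eis_principal_eq_unit[OF assms, of \<nu>] by (metis mult_1 norm_mult)
qed

lemma hecke_chi6_principal:
  assumes "\<mu> \<in> Eis" "\<mu> \<noteq> 0" shows "hecke_chi6 a (eis_principal \<mu>) = hecke_ang a \<mu>"
  unfolding hecke_chi6_def
proof (rule the_equality)
  show "\<exists>\<nu>\<in>Eis. \<nu> \<noteq> 0 \<and> eis_principal \<mu> = eis_principal \<nu> \<and>
       hecke_ang a \<mu> = (\<nu> / of_real (cmod \<nu>)) powi (6 * a)" using assms by (auto simp: hecke_ang_def)
  fix t assume "\<exists>\<nu>\<in>Eis. \<nu> \<noteq> 0 \<and> eis_principal \<mu> = eis_principal \<nu> \<and> t = (\<nu> / of_real (cmod \<nu>)) powi (6 * a)"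
  then obtain \<nu> where \<nu>: "\<nu> \<in> Eis" "\<nu> \<noteq> 0" "eis_principal \<mu> = eis_principal \<nu>" "t = hecke_ang a \<nu>" by (auto simp: hecke_ang_def)
  then obtain u where "u \<in> Eis" "cmod u = 1" "\<nu> = u * \<mu>" using eis_principal_eq_unit[OF assms(1)] by blast
  then show "t = hecke_ang a \<mu>" using \<nu> by (simp add: hecke_ang_mult hecke_ang_unit)
qed

text \<open>One generator per prime is fixed; divisibility, norm and \<open>hecke_ang\<close> do not
  depend on the choice.\<close>

definition prime_gen :: "complex set \<Rightarrow> complex" where
  "prime_gen P = (SOME \<mu>. \<mu> \<in> Eis \<and> P = eis_principal \<mu>)"

lemma prime_gen:
  assumes "P \<in> eis_nonzero_primes"
  shows "prime_gen P \<in> Eis" "P = eis_principal (prime_gen P)" "prime_gen P \<noteq> 0" "cmod (prime_gen P) > 1"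
    "\<lbrakk>u \<in> Eis; v \<in> Eis; eis_dvd (prime_gen P) (u * v)\<rbrakk> \<Longrightarrow> eis_dvd (prime_gen P) u \<or> eis_dvd (prime_gen P) v"
proof -
  have P: "eis_ideal P" "P \<noteq> Eis" "P \<noteq> {0}" "\<And>u v. \<lbrakk>u \<in> Eis; v \<in> Eis; u * v \<in> P\<rbrakk> \<Longrightarrow> u \<in> P \<or> v \<in> P"
    using assms by (auto simp: eis_nonzero_primes_def eis_prime_ideal_def)
  have "\<exists>\<mu>. \<mu> \<in> Eis \<and> P = eis_principal \<mu>" using eis_ideal_is_principal[OF P(1)] by blast
  from someI_ex[OF this] show *: "prime_gen P \<in> Eis" "P = eis_principal (prime_gen P)" by (auto simp: prime_gen_def)
  show "prime_gen P \<noteq> 0"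
  proof
    assume "prime_gen P = 0"
    then have "P = {0}" using *(2) Eis_0 by (auto simp: eis_principal_def)
    with P show False by blast
  qed
  then have ge: "cmod (prime_gen P) \<ge> 1" using * Eis_norm_ge_1 by blast
  have "cmod (prime_gen P) \<noteq> 1"
  proof
    assume 1: "cmod (prime_gen P) = 1"
    then have "prime_gen P ^ 6 = 1" using Eis_unit_power6 * by blast
    \<comment> \<open>Since the sixth power is 1, the fifth power is an inverse inside
      \<open>Eis\<close>.\<close>
    then have g: "prime_gen P * prime_gen P ^ 5 = 1" by (simp flip: power_Suc)
    have "v \<in> P" if "v \<in> Eis" for v
      unfolding mem_eis_principal eis_dvd_def
      using g that * by (subst *(2)) (auto simp: eis_principal_def intro!: exI[of _ "prime_gen P ^ 5 * v"] simp flip: mult.assoc)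
    then show False using P(1,2) by (auto simp: eis_ideal_def)
  qed
  with ge show "cmod (prime_gen P) > 1" by simp
  show "\<lbrakk>u \<in> Eis; v \<in> Eis; eis_dvd (prime_gen P) (u * v)\<rbrakk> \<Longrightarrow> eis_dvd (prime_gen P) u \<or> eis_dvd (prime_gen P) v"
    using P(4)[of u v] *(2) mem_eis_principal by metis
qed

lemma eis_norm_prime_gen: "P \<in> eis_nonzero_primes \<Longrightarrow> eis_norm P = (cmod (prime_gen P))\<^sup>2"
  using prime_gen[of P] eis_norm_principal by metis

lemma hecke_prime_gen: "P \<in> eis_nonzero_primes \<Longrightarrow> hecke_chi6 a P = hecke_ang a (prime_gen P)"
  using prime_gen[of P] hecke_chi6_principal by metis

lemma inj_on_prime_gen: "inj_on prime_gen eis_nonzero_primes"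
  by (rule inj_onI) (metis prime_gen(2))

lemma quadratic_form_bound:
  fixes x y r :: real assumes "x\<^sup>2 + x * y + y\<^sup>2 \<le> r\<^sup>2" shows "x\<^sup>2 \<le> (2 * r)\<^sup>2"
proof -
  have "3 * x\<^sup>2 + (2 * y + x)\<^sup>2 = 4 * (x\<^sup>2 + x * y + y\<^sup>2)" by (simp add: power2_eq_square algebra_simps)
  then have "x\<^sup>2 \<le> 4 * (x\<^sup>2 + x * y + y\<^sup>2)" by (smt (verit, best) zero_le_power2)
  also have "\<dots> \<le> 4 * r\<^sup>2" using assms by simp
  also have "\<dots> = (2 * r)\<^sup>2" by (simp add: power_mult_distrib)
  finally show ?thesis .
qed

lemma finite_Eis_bounded: "finite {\<mu>\<in>Eis. cmod \<mu> \<le> r}"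
proof -
  define K where "K = \<lceil>2 * r\<rceil>"
  have "{\<mu>\<in>Eis. cmod \<mu> \<le> r} \<subseteq> (\<lambda>(m,n). of_int m + of_int n * eis_omega) ` ({-K..K} \<times> {-K..K})"
  proof
    fix \<mu> assume "\<mu> \<in> {\<mu>\<in>Eis. cmod \<mu> \<le> r}"
    then obtain m n where *: "\<mu> = of_int m + of_int n * eis_omega" and r: "cmod \<mu> \<le> r" by (auto elim: Eis_E)
    have r0: "r \<ge> 0" using r norm_ge_zero order_trans by blast
    have "(cmod \<mu>)\<^sup>2 \<le> r\<^sup>2" using r by (simp add: power_mono)
    then have 1: "of_int (m\<^sup>2 + m*n + n\<^sup>2) \<le> r\<^sup>2" using cmod_lattice[of m n] * by (simp only:)
    have "of_int n ^ 2 + of_int n * of_int m + of_int m ^ 2 \<le> r\<^sup>2" using 1 by (simp add: algebra_simps)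
    with 1 have "(of_int m)\<^sup>2 \<le> (2*r)\<^sup>2" "(of_int n)\<^sup>2 \<le> (2*r)\<^sup>2"
      using quadratic_form_bound[of "of_int m" "of_int n" r] quadratic_form_bound[of "of_int n" "of_int m" r] by auto
    then have "\<bar>of_int m\<bar> \<le> 2*r" "\<bar>of_int n\<bar> \<le> 2*r"
      using r0 by (simp_all only: power2_le_iff_abs_le[of "2*r"] mult_nonneg_nonneg zero_le_numeral)
    then have "\<bar>m\<bar> \<le> K" "\<bar>n\<bar> \<le> K" unfolding K_def by linarith+
    then show "\<mu> \<in> (\<lambda>(m,n). of_int m + of_int n * eis_omega) ` ({-K..K} \<times> {-K..K})"
      using * by (intro image_eqI[of _ _ "(m,n)"]) auto
  qed
  then show ?thesis by (rule finite_subset) auto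
qed

lemma finite_primes_bounded: "finite {P\<in>eis_nonzero_primes. eis_norm P \<le> x}"
proof (rule inj_on_finite)
  show "inj_on prime_gen {P\<in>eis_nonzero_primes. eis_norm P \<le> x}" using inj_on_prime_gen by (rule inj_on_subset) auto
  show "prime_gen ` {P\<in>eis_nonzero_primes. eis_norm P \<le> x} \<subseteq> {\<mu>\<in>Eis. cmod \<mu> \<le> sqrt x}"
    using prime_gen(1) eis_norm_prime_gen by (auto intro: real_le_rsqrt)
  show "finite {\<mu>\<in>Eis. cmod \<mu> \<le> sqrt x}" by (rule finite_Eis_bounded)
qed

section \<open>Prime divisors and multiplicities\<close>

lemma eis_dvd_trans: "eis_dvd u v \<Longrightarrow> eis_dvd v w \<Longrightarrow> eis_dvd u w"
  unfolding eis_dvd_def by (metis Eis_mult mult.assoc)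

lemma eis_dvd_norm_le: "eis_dvd u v \<Longrightarrow> v \<noteq> 0 \<Longrightarrow> cmod u \<le> cmod v"
  unfolding eis_dvd_def using Eis_norm_ge_1 by (auto simp: norm_mult mult_le_cancel_left1)

text \<open>A non-unit divisor \<nu> of least norm is prime. If \<nu> divides u v, let d generate
  the ideal (\<nu>, u). If d is not a unit, minimality makes it an associate of \<nu>, so \<nu>
  divides u; if d is a unit, a Bezout relation multiplied by v shows that \<nu> divides v.\<close>

lemma exists_prime_divisor:
  assumes "\<mu> \<in> Eis" "cmod \<mu> > 1"
  obtains P where "P \<in> eis_nonzero_primes" "eis_dvd (prime_gen P) \<mu>"
proof -
  define A where "A = {\<nu>\<in>Eis. cmod \<nu> > 1 \<and> eis_dvd \<nu> \<mu>}"
  have "\<mu> \<in> A" using assms by (auto simp: A_def eis_dvd_def intro!: bexI[of _ 1])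
  then obtain \<nu> where "\<nu> \<in> A" and least: "\<And>\<xi>. \<xi> \<in> A \<Longrightarrow> cmod \<nu> \<le> cmod \<xi>"
    using Eis_has_least_norm[of A] by (auto simp: A_def)
  then have \<nu>: "\<nu> \<in> Eis" "cmod \<nu> > 1" "eis_dvd \<nu> \<mu>" by (auto simp: A_def)
  have prime: "eis_dvd \<nu> u \<or> eis_dvd \<nu> v" if uv: "u \<in> Eis" "v \<in> Eis" "eis_dvd \<nu> (u * v)" for u v
  proof -
    define I where "I = {\<nu> * r + u * s | r s. r \<in> Eis \<and> s \<in> Eis}"
    have "eis_ideal I" unfolding eis_ideal_def
    proof (intro conjI ballI)
      show "I \<subseteq> Eis" using that \<nu> by (auto simp: I_def)
      show "0 \<in> I" unfolding I_def by (intro CollectI exI[of _ 0]) auto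
      fix x y assume "x \<in> I" "y \<in> I"
      then obtain r s r' s' where "x = \<nu> * r + u * s" "y = \<nu> * r' + u * s'" "r\<in>Eis" "s\<in>Eis" "r'\<in>Eis" "s'\<in>Eis"
        by (auto simp: I_def)
      then have "x + y = \<nu> * (r+r') + u * (s+s')" "r+r' \<in> Eis" "s+s' \<in> Eis" by (auto simp: algebra_simps)
      then show "x + y \<in> I" unfolding I_def by blast
    next
      fix q x assume "q \<in> Eis" "x \<in> I"
      then obtain r s where "x = \<nu> * r + u * s" "r\<in>Eis" "s\<in>Eis" by (auto simp: I_def)
      then have "q * x = \<nu> * (q*r) + u * (q * s)" "q*r\<in>Eis" "q * s\<in>Eis" using \<open>q \<in> Eis\<close> by (auto simp: algebra_simps)
      then show "q * x \<in> I" unfolding I_def by blast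
    qed
    then obtain d where d: "d \<in> Eis" "I = eis_principal d" using eis_ideal_is_principal by blast
    have "\<nu> = \<nu> * 1 + u * 0" "u = \<nu> * 0 + u * 1" "d = d * 1" by auto
    then have "\<nu> \<in> I" "u \<in> I" unfolding I_def using Eis_0 Eis_1 by blast+
    then have dd: "eis_dvd d \<nu>" "eis_dvd d u" using d mem_eis_principal by auto
    have dI: "d \<in> I" using d by (auto simp: eis_principal_def intro!: exI[of _ 1])
    show ?thesis
    proof (cases "cmod d > 1")
      case True
      then have "d \<in> A" using d dd \<nu> eis_dvd_trans by (auto simp: A_def)
      then have le: "cmod \<nu> \<le> cmod d" by (rule least)
      obtain r where r: "r \<in> Eis" "\<nu> = d * r" using dd by (auto simp: eis_dvd_def)
      have r0: "r \<noteq> 0" using r \<nu> by auto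
      have "cmod r \<le> 1"
      proof (rule ccontr)
        assume "\<not> cmod r \<le> 1"
        then have "cmod d * 1 < cmod d * cmod r" using True by (intro mult_strict_left_mono) auto
        then show False using le r by (simp add: norm_mult)
      qed
      then have "cmod r = 1" using Eis_norm_ge_1[of r] r r0 by simp
      then have "r * r ^ 5 = 1" using Eis_unit_power6[of r] r by (simp flip: power_Suc)
      then have "d = \<nu> * r ^ 5" using r(2) by (simp add: mult.assoc)
      then have "eis_dvd \<nu> d" using r(1) by (auto simp: eis_dvd_def)
      then show ?thesis using dd eis_dvd_trans by blast
    next
      case False
      have "d \<noteq> 0" using dd \<nu> by (auto simp: eis_dvd_def)
      then have "cmod d = 1" using False Eis_norm_ge_1[of d] d by simp
      then have d6: "d * d ^ 5 = 1" using Eis_unit_power6[of d] d by (simp flip: power_Suc)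
      obtain r s where rs: "d = \<nu> * r + u * s" "r\<in>Eis" "s\<in>Eis" using dI by (auto simp: I_def)
      obtain w where w: "u * v = \<nu> * w" "w \<in> Eis" using uv(3) unfolding eis_dvd_def by blast
      have "v = d * d^5 * v" by (simp add: d6)
      also have "\<dots> = (\<nu> * r * v + (u * v) * s) * d^5" by (subst rs(1)) (simp add: algebra_simps)
      also have "\<dots> = \<nu> * ((r * v + w * s) * d^5)" unfolding w by (simp add: algebra_simps)
      finally show ?thesis using that rs w d unfolding eis_dvd_def by (metis Eis_add Eis_mult Eis_power)
    qed
  qed
  define P where "P = eis_principal \<nu>"
  have "P \<in> eis_nonzero_primes"
    unfolding eis_nonzero_primes_def eis_prime_ideal_def
  proof (intro CollectI conjI ballI impI)
    show "eis_ideal P" using \<nu> eis_ideal_principal by (simp add: P_def)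
    have "\<not> eis_dvd \<nu> 1" using eis_dvd_norm_le[of \<nu> 1] \<nu> by auto
    then show "P \<noteq> Eis" using Eis_1 mem_eis_principal unfolding P_def by blast
    show "u \<in> P \<or> v \<in> P" if "u \<in> Eis" "v \<in> Eis" "u * v \<in> P" for u v
      using prime[of u v] that by (simp add: P_def mem_eis_principal)
    have "\<nu> \<in> P" by (auto simp: P_def eis_principal_def intro!: exI[of _ 1])
    then show "P \<noteq> {0}" using \<nu> by auto
  qed
  moreover have "eis_dvd (prime_gen P) \<nu>"
    using prime_gen(2)[OF calculation] unfolding P_def mem_eis_principal[symmetric] by (auto simp: eis_principal_def intro!: exI[of _ 1])
  ultimately show ?thesis using that \<nu> eis_dvd_trans by blast
qed

text \<open>Induction on the exponent: once the k factors known to divide \<nu> are cancelled,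
  primality of Q applies to what remains. Q cannot divide the generator of P, since P would then
  divide either the generator of Q, making the ideals equal, or a proper cofactor of smaller
  norm.\<close>

lemma eis_dvd_prime_power_cancel:
  assumes P: "P \<in> eis_nonzero_primes" and Q: "Q \<in> eis_nonzero_primes" and "P \<noteq> Q" "\<nu> \<in> Eis"
    and "eis_dvd (prime_gen Q ^ k) (prime_gen P * \<nu>)"
  shows "eis_dvd (prime_gen Q ^ k) \<nu>"
  using assms(4,5)
proof (induction k)
  case 0
  then show ?case by (auto simp: eis_dvd_def)
next
  case (Suc k)
  have "eis_dvd (prime_gen Q ^ k) (prime_gen P * \<nu>)"
    using Suc.prems(2) eis_dvd_trans[of "prime_gen Q ^ k" "prime_gen Q ^ Suc k"] prime_gen(1)[OF Q] by (auto simp: eis_dvd_def mult.commute)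
  then obtain \<nu>' where \<nu>': "\<nu> = prime_gen Q ^ k * \<nu>'" "\<nu>' \<in> Eis" using Suc by (auto simp: eis_dvd_def)
  obtain r where r: "prime_gen P * \<nu> = prime_gen Q ^ Suc k * r" "r \<in> Eis" using Suc.prems by (auto simp: eis_dvd_def)
  have "prime_gen Q ^ k * (prime_gen P * \<nu>') = prime_gen Q ^ k * (prime_gen Q * r)" using r \<nu>' by (simp add: algebra_simps)
  then have eq: "prime_gen P * \<nu>' = prime_gen Q * r" using prime_gen(3)[OF Q] by simp
  then have "eis_dvd (prime_gen Q) (prime_gen P * \<nu>')" using r by (auto simp: eis_dvd_def)
  then have "eis_dvd (prime_gen Q) (prime_gen P) \<or> eis_dvd (prime_gen Q) \<nu>'" using prime_gen(5)[OF Q] prime_gen(1)[OF P] \<nu>' by blast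
  moreover have "\<not> eis_dvd (prime_gen Q) (prime_gen P)"
  proof
    assume QP: "eis_dvd (prime_gen Q) (prime_gen P)"
    then obtain t where t: "prime_gen P = prime_gen Q * t" "t \<in> Eis" by (auto simp: eis_dvd_def)
    then have "eis_dvd (prime_gen P) (prime_gen Q * t)" by (auto simp: eis_dvd_def intro!: bexI[of _ 1])
    then consider "eis_dvd (prime_gen P) (prime_gen Q)" | "eis_dvd (prime_gen P) t" using prime_gen(5)[OF P] prime_gen(1)[OF Q] t by blast
    then show False
    proof cases
      case 1
      then have "eis_principal (prime_gen P) = eis_principal (prime_gen Q)"
        using QP eis_dvd_trans mem_eis_principal by blast
      then show False using prime_gen(2)[OF P] prime_gen(2)[OF Q] \<open>P \<noteq> Q\<close> by simp
    next
      case 2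
      then have "cmod (prime_gen P) \<le> cmod t" using eis_dvd_norm_le t prime_gen(3)[OF P] by auto
      also have "\<dots> < cmod (prime_gen Q) * cmod t" using prime_gen(4)[OF Q] t prime_gen(3)[OF P] by auto
      finally show False using t by (simp add: norm_mult)
    qed
  qed
  ultimately have "eis_dvd (prime_gen Q) \<nu>'" by blast
  then show ?case using \<nu>' by (auto simp: eis_dvd_def mult.assoc mult.commute mult.left_commute)
qed

definition prime_powers :: "(complex set \<times> nat) set" where
  "prime_powers = eis_nonzero_primes \<times> {1..}"

definition prime_power_divisors :: "complex \<Rightarrow> (complex set \<times> nat) set" where
  "prime_power_divisors \<mu> = {(P,k)\<in>prime_powers. eis_dvd (prime_gen P ^ k) \<mu>}"

text \<open>The convolution identity \<open>ln = \<Lambda> * 1\<close> in \<open>\<int>[\<omega>]\<close>, equivalent to unique factorisation.\<close>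
lemma ln_norm_eq_sum_prime_power_divisors:
  assumes "\<mu> \<in> Eis" "\<mu> \<noteq> 0"
  shows "finite (prime_power_divisors \<mu>) \<and> (\<Sum>(P,k)\<in>prime_power_divisors \<mu>. ln ((cmod (prime_gen P))\<^sup>2)) = ln ((cmod \<mu>)\<^sup>2)"
proof -
  obtain n :: nat where "(cmod \<mu>)\<^sup>2 = real n" using Eis_norm_nat assms by blast
  then show ?thesis using assms
  proof (induction n arbitrary: \<mu> rule: less_induct)
    case (less n)
    show ?case
    proof (cases "cmod \<mu> > 1")
      case False
      then have 1: "cmod \<mu> = 1" using Eis_norm_ge_1 less.prems by force
      have "prime_power_divisors \<mu> = {}"
      proof (rule ccontr)
        assume "prime_power_divisors \<mu> \<noteq> {}"
        then obtain P k where Pk: "P \<in> eis_nonzero_primes" "k \<ge> 1" "eis_dvd (prime_gen P ^ k) \<mu>" by (auto simp: prime_power_divisors_def prime_powers_def)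
        then have "cmod (prime_gen P ^ k) \<le> 1" using eis_dvd_norm_le less.prems 1 by metis
        moreover have "cmod (prime_gen P ^ k) > 1" using prime_gen(4)[OF Pk(1)] Pk(2) by (simp add: norm_power one_less_power)
        ultimately show False by simp
      qed
      then show ?thesis using 1 by simp
    next
      case True
      obtain P where P: "P \<in> eis_nonzero_primes" "eis_dvd (prime_gen P) \<mu>" using exists_prime_divisor less.prems True by blast
      let ?p = "prime_gen P"
      note gP = prime_gen[OF P(1)]
      obtain \<nu> where \<nu>: "\<mu> = ?p * \<nu>" "\<nu> \<in> Eis" using P by (auto simp: eis_dvd_def)
      then have \<nu>0: "\<nu> \<noteq> 0" using less.prems by auto
      obtain m :: nat where m: "(cmod \<nu>)\<^sup>2 = real m" using Eis_norm_nat \<nu> by blast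
      have "cmod \<nu> < cmod \<mu>" using \<nu> \<nu>0 gP(4) by (simp add: norm_mult)
      then have "(cmod \<nu>)\<^sup>2 < (cmod \<mu>)\<^sup>2" by (simp add: power_strict_mono)
      then have "m < n" using m less.prems by simp
      from less.IH[OF this m \<nu>(2) \<nu>0] have fin: "finite (prime_power_divisors \<nu>)"
        and IH: "(\<Sum>(P,k)\<in>prime_power_divisors \<nu>. ln ((cmod (prime_gen P))\<^sup>2)) = ln ((cmod \<nu>)\<^sup>2)" by auto
      \<comment> \<open>K is an initial segment of the naturals and its maximum v is the
        multiplicity of P in \<nu>. Multiplying by the generator of P raises this multiplicity by
        one and leaves all other primes alone, so exactly the pair \<open>(P, Suc v)\<close> is
        new.\<close>
      define K where "K = {k. eis_dvd (?p ^ k) \<nu>}"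
      have K_down: "j \<in> K" if "k \<in> K" "j \<le> k" for j k
      proof -
        have "?p ^ k = ?p ^ j * ?p ^ (k - j)" using that by (simp flip: power_add)
        then have "eis_dvd (?p ^ j) (?p ^ k)" using gP(1) by (auto simp: eis_dvd_def)
        then show ?thesis using that eis_dvd_trans by (auto simp: K_def)
      qed
      have finK: "finite K"
      proof -
        have "K \<subseteq> insert 0 (snd ` prime_power_divisors \<nu>)"
        proof
          fix k assume "k \<in> K"
          then have "k = 0 \<or> (P,k) \<in> prime_power_divisors \<nu>" using P by (auto simp: K_def prime_power_divisors_def prime_powers_def)
          then show "k \<in> insert 0 (snd ` prime_power_divisors \<nu>)" by force
        qed
        then show ?thesis using fin by (meson finite.insertI finite_imageI finite_subset)
      qed
      have "0 \<in> K" using \<nu> by (auto simp: K_def eis_dvd_def)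
      define v where "v = Max K"
      have vK1: "v \<in> K" unfolding v_def using Max_in[OF finK] \<open>0 \<in> K\<close> by blast
      have vK2: "k \<in> K \<longleftrightarrow> k \<le> v" for k
        using K_down[OF vK1] Max_ge[OF finK] by (auto simp: v_def)
      have Pk: "eis_dvd (?p ^ k) \<mu> \<longleftrightarrow> k \<le> Suc v" if k1: "k \<ge> 1" for k
      proof -
        obtain j where j: "k = Suc j" using k1 by (cases k) auto
        have "eis_dvd (?p ^ k) \<mu> \<longleftrightarrow> eis_dvd (?p ^ j) \<nu>" using gP(3) by (simp add: \<nu>(1) j eis_dvd_def mult.assoc)
        then show ?thesis using vK2[of j] by (simp add: K_def j)
      qed
      have "prime_power_divisors \<mu> = insert (P, Suc v) (prime_power_divisors \<nu>)"
      proof (rule set_eqI, clarify)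
        fix Q k
        show "(Q, k) \<in> prime_power_divisors \<mu> \<longleftrightarrow> (Q, k) \<in> insert (P, Suc v) (prime_power_divisors \<nu>)"
        proof (cases "Q = P")
          case True
          have "k \<le> v \<longleftrightarrow> eis_dvd (?p ^ k) \<nu>" using vK2[of k] by (simp add: K_def)
          then show ?thesis using True Pk[of k] P by (auto simp: prime_power_divisors_def prime_powers_def)
        next
          case False
          have "eis_dvd \<nu> \<mu>" using \<nu> gP(1) by (auto simp: eis_dvd_def mult.commute)
          then show ?thesis using False eis_dvd_prime_power_cancel[OF P(1), of Q \<nu> k] \<nu> eis_dvd_trans
            by (auto simp: prime_power_divisors_def prime_powers_def)
        qed
      qed
      moreover have "(P, Suc v) \<notin> prime_power_divisors \<nu>" using vK2[of "Suc v"] by (auto simp: prime_power_divisors_def K_def)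
      ultimately show ?thesis using fin IH \<nu>0 gP(3)
        by (simp add: \<nu>(1) norm_mult power_mult_distrib ln_mult)
    qed
  qed
qed

section \<open>Lattice points in a disc\<close>

text \<open>Integration takes place on \<open>real^2\<close>, where ball volumes and determinants of
  linear maps are at hand; \<open>cplx\<close> carries points to the complex plane.\<close>

definition cplx :: "real^2 \<Rightarrow> complex" where "cplx x = Complex (x $ 1) (x $ 2)"

text \<open>\<open>ucoord\<close> and \<open>vcoord\<close> are the coordinates with respect to the
  lattice basis 1, \<omega>, as \<open>cplx_coords\<close> confirms.\<close>

definition vcoord :: "real^2 \<Rightarrow> real" where "vcoord x = x $ 2 * (2 / sqrt 3)"
definition ucoord :: "real^2 \<Rightarrow> real" where "ucoord x = x $ 1 - vcoord x / 2"

text \<open>The lattice corner of the half-open fundamental parallelogram that contains the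
  point.\<close>

definition eis_floor :: "real^2 \<Rightarrow> complex" where
  "eis_floor x = of_int \<lfloor>ucoord x\<rfloor> + of_int \<lfloor>vcoord x\<rfloor> * eis_omega"

definition eis_cell :: "complex \<Rightarrow> (real^2) set" where "eis_cell \<mu> = eis_floor -` {\<mu>}"

text \<open>The covolume is kept symbolic; its positivity is read off from the point count in
  \<open>eis_covol_pos\<close>.\<close>

definition eis_covol :: real where "eis_covol = measure lborel (eis_cell 0)"

lemma norm_real2: "norm (x :: real^2) = cmod (cplx x)"
  by (simp add: norm_vec_def L2_set_def sum_2 cplx_def cmod_def)

lemma cplx_coords: "cplx x = of_real (ucoord x) + of_real (vcoord x) * eis_omega"
  by (simp add: complex_eq_iff cplx_def ucoord_def vcoord_def eis_omega_eq)

lemma lattice_coords_inject: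
  fixes u v u' v' :: real
  assumes "of_real u + of_real v * eis_omega = of_real u' + of_real v' * eis_omega"
  shows "u = u'" "v = v'"
  using assms by (auto simp: complex_eq_iff eis_omega_eq)

lemma Eis_coords_inject:
  assumes "of_int u + of_int v * eis_omega = of_int u' + of_int v' * eis_omega"
  shows "u = u'" "v = v'"
  using lattice_coords_inject[of "of_int u" "of_int v" "of_int u'" "of_int v'"] assms by auto

lemma eis_floor_in_Eis: "eis_floor x \<in> Eis"
  by (auto simp: eis_floor_def)

lemma eis_floor_dist: "cmod (eis_floor x - cplx x) < 2"
proof -
  define u where "u = frac (ucoord x)"
  define v where "v = frac (vcoord x)"
  have uv: "0 \<le> u" "u < 1" "0 \<le> v" "v < 1" by (auto simp: u_def v_def frac_lt_1)
  have "cplx x - eis_floor x = of_real u + of_real v * eis_omega"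
    by (simp add: cplx_coords eis_floor_def u_def v_def frac_def algebra_simps)
  then have "(cmod (eis_floor x - cplx x))\<^sup>2 = u\<^sup>2 + u * v + v\<^sup>2"
    by (metis cmod_lattice_real norm_minus_commute)
  also have "\<dots> \<le> 1 + 1 * 1 + 1"
    using uv by (intro add_mono mult_mono power_le_one) auto
  also have "\<dots> < 2\<^sup>2" by simp
  finally show ?thesis by (rule power2_less_imp_less) simp
qed

lemma eis_cell_0: "eis_cell 0 = {x. 0 \<le> ucoord x \<and> ucoord x < 1 \<and> 0 \<le> vcoord x \<and> vcoord x < 1}"
proof -
  have "eis_floor x = 0 \<longleftrightarrow> \<lfloor>ucoord x\<rfloor> = 0 \<and> \<lfloor>vcoord x\<rfloor> = 0" for x
    using Eis_coords_inject[of "\<lfloor>ucoord x\<rfloor>" "\<lfloor>vcoord x\<rfloor>" 0 0] by (auto simp: eis_floor_def)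
  then show ?thesis by (auto simp: eis_cell_def floor_eq_iff)
qed

lemma borel_eis_cell_0: "eis_cell 0 \<in> sets borel"
proof -
  have [measurable]: "ucoord \<in> borel_measurable borel" "vcoord \<in> borel_measurable borel"
    unfolding ucoord_def[abs_def] vcoord_def[abs_def]
    by (auto intro!: borel_measurable_continuous_onI continuous_intros)
  show ?thesis unfolding eis_cell_0 by measurable
qed

definition vec_of :: "complex \<Rightarrow> real^2" where "vec_of z = vector [Re z, Im z]"

lemma cplx_vec_of [simp]: "cplx (vec_of z) = z" by (simp add: cplx_def vec_of_def)

lemma cplx_add: "cplx (x + y) = cplx x + cplx y" by (simp add: cplx_def complex_eq_iff)

lemma eis_floor_translate:
  assumes "\<mu> \<in> Eis" shows "eis_floor (vec_of \<mu> + x) = \<mu> + eis_floor x"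
proof -
  obtain m n where *: "\<mu> = of_int m + of_int n * eis_omega" using assms by (meson Eis_E)
  have "of_real (ucoord (vec_of \<mu> + x)) + of_real (vcoord (vec_of \<mu> + x)) * eis_omega
     = of_real (of_int m + ucoord x) + of_real (of_int n + vcoord x) * eis_omega"
    unfolding cplx_coords[symmetric] cplx_add cplx_vec_of by (simp add: * cplx_coords[of x] algebra_simps)
  from lattice_coords_inject[OF this] show ?thesis
    by (simp add: eis_floor_def * algebra_simps)
qed

lemma eis_cell_translate:
  assumes "\<mu> \<in> Eis"
  shows "(+) (- vec_of \<mu>) -` eis_cell 0 = eis_cell \<mu>"
proof -
  have "eis_floor (- vec_of \<mu> + x) = 0 \<longleftrightarrow> eis_floor x = \<mu>" for x
    using eis_floor_translate[OF assms, of "- vec_of \<mu> + x"] by auto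
  then show ?thesis by (auto simp: eis_cell_def)
qed

lemma borel_eis_cell: assumes "\<mu> \<in> Eis" shows "eis_cell \<mu> \<in> sets borel"
proof -
  have "(+) (- vec_of \<mu>) \<in> borel_measurable borel" by (intro borel_measurable_continuous_onI continuous_intros)
  from measurable_sets[OF this borel_eis_cell_0] show ?thesis using eis_cell_translate[OF assms] by simp
qed

lemma measure_eis_cell: assumes "\<mu> \<in> Eis" shows "measure lborel (eis_cell \<mu>) = eis_covol"
proof -
  have m: "(+) (- vec_of \<mu>) \<in> measurable lborel borel"
    using borel_measurable_continuous_onI[of "(+) (- vec_of \<mu>)"] by (simp add: continuous_intros)
  have "eis_covol = measure (distr lborel borel ((+) (- vec_of \<mu>))) (eis_cell 0)"
    by (simp add: eis_covol_def lborel_distr_plus)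
  also have "\<dots> = measure lborel (eis_cell \<mu>)"
    using measure_distr[OF m borel_eis_cell_0] eis_cell_translate[OF assms] by simp
  finally show ?thesis ..
qed

lemma eis_cell_subset: "eis_cell \<mu> \<subseteq> cball 0 (cmod \<mu> + 2)"
proof
  fix x assume "x \<in> eis_cell \<mu>"
  then have "cmod (\<mu> - cplx x) < 2" using eis_floor_dist[of x] by (simp add: eis_cell_def)
  then show "x \<in> cball 0 (cmod \<mu> + 2)"
    using norm_triangle_ineq2[of "cplx x" \<mu>] by (simp add: norm_real2 norm_minus_commute)
qed

lemma integrable_indicator_eis_cell:
  assumes "\<mu> \<in> Eis" shows "integrable lborel (indicator (eis_cell \<mu>) :: _ \<Rightarrow> real)"
proof -
  have "emeasure lborel (eis_cell \<mu>) < \<infinity>"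
    using eis_cell_subset bounded_cball bounded_subset emeasure_bounded_finite by blast
  then show ?thesis using borel_eis_cell[OF assms] by (simp add: integrable_indicator_iff)
qed

section \<open>Lattice sums compared with integrals\<close>

lemma powi_unit_diff_le:
  fixes u v :: complex assumes u: "cmod u = 1" and v: "cmod v = 1"
  shows "cmod (u powi k - v powi k) \<le> \<bar>of_int k\<bar> * cmod (u - v)"
proof (cases "k \<ge> 0")
  case True
  then show ?thesis using norm_power_diff[of u v "nat k"] u v by (simp add: power_int_def)
next
  case False
  have uv: "u \<noteq> 0" "v \<noteq> 0" using u v by auto
  \<comment> \<open>Inversion is an isometry of the unit circle, which reduces negative exponents to
    natural ones.\<close>
  have "cmod (inverse u - inverse v) = cmod (u - v)"
    using uv u v by (simp add: inverse_diff_inverse norm_mult norm_inverse norm_minus_commute)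
  then show ?thesis using False norm_power_diff[of "inverse u" "inverse v" "nat (-k)"] u v
    by (simp add: power_int_def norm_inverse)
qed

lemma normalize_diff_le:
  fixes w z :: complex assumes "w \<noteq> 0" "z \<noteq> 0"
  shows "cmod (w / of_real (cmod w) - z / of_real (cmod z)) \<le> 2 * cmod (w - z) / cmod z"
proof -
  have "w / of_real (cmod w) - z / of_real (cmod z)
     = (w / of_real (cmod w)) * (of_real (cmod z - cmod w) / of_real (cmod z)) + (w - z) / of_real (cmod z)"
    using assms by (simp add: field_simps)
  also have "cmod \<dots> \<le> cmod ((w / of_real (cmod w)) * (of_real (cmod z - cmod w) / of_real (cmod z))) + cmod ((w - z) / of_real (cmod z))"
    by (rule norm_triangle_ineq)
  also have "\<dots> = \<bar>cmod z - cmod w\<bar> / cmod z + cmod (w - z) / cmod z"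
    using assms by (simp add: norm_mult norm_divide del: of_real_diff)
  also have "\<dots> \<le> cmod (w - z) / cmod z + cmod (w - z) / cmod z"
    using norm_triangle_ineq3[of z w] by (intro add_mono divide_right_mono) (auto simp: norm_minus_commute)
  finally show ?thesis by simp
qed

text \<open>24 = 6 * 2 * 2: the exponent, the loss in normalising, and the distance. If w = 0, then
  |z| < 2, so for \<open>a \<noteq> 0\<close> the right side exceeds 12, while the left side is 1
  because \<open>hecke_ang a 0 = 0\<close>.\<close>

lemma hecke_ang_diff_le:
  assumes "cmod (w - z) < 2" "z \<noteq> 0"
  shows "cmod (hecke_ang a w - hecke_ang a z) \<le> 24 * \<bar>of_int a\<bar> / cmod z"
proof (cases "w = 0")
  case False
  have "cmod (hecke_ang a w - hecke_ang a z) \<le> \<bar>of_int (6 * a)\<bar> * cmod (w / of_real (cmod w) - z / of_real (cmod z))"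
    unfolding hecke_ang_def using False assms by (intro powi_unit_diff_le) (auto simp: norm_divide)
  also have "\<dots> \<le> \<bar>of_int (6 * a)\<bar> * (2 * cmod (w - z) / cmod z)"
    using normalize_diff_le[OF False assms(2)] by (intro mult_left_mono) auto
  also have "\<dots> \<le> \<bar>of_int (6 * a)\<bar> * (2 * 2 / cmod z)"
    using assms by (intro mult_left_mono divide_right_mono) auto
  also have "\<dots> = 24 * \<bar>of_int a\<bar> / cmod z" by (simp add: abs_mult)
  finally show ?thesis .
next
  case True
  show ?thesis
  proof (cases "a = 0")
    case False
    then have "\<bar>real_of_int a\<bar> \<ge> 1" by linarith
    then have "cmod z \<le> 24 * \<bar>of_int a\<bar>" using assms True by simp
    then have "1 \<le> 24 * \<bar>of_int a\<bar> / cmod z" using assms by simp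
    moreover have "hecke_ang a w = 0" using True False by (simp add: hecke_ang_def)
    ultimately show ?thesis using cmod_hecke_ang[OF assms(2)] by simp
  qed (simp add: hecke_ang_def)
qed

lemma measurable_hecke_ang_cplx [measurable]: "(\<lambda>x. hecke_ang a (cplx x)) \<in> borel_measurable borel"
proof -
  have c [measurable]: "cplx \<in> borel_measurable borel"
    unfolding cplx_def[abs_def] Complex_eq by (intro borel_measurable_continuous_onI continuous_intros)
  have "(\<lambda>z. hecke_ang a z) \<in> borel_measurable borel"
  proof -
    have "(\<lambda>z::complex. if z \<in> - {0} then hecke_ang a z else hecke_ang a 0) \<in> borel_measurable borel"
      by (intro borel_measurable_continuous_on_if)
         (auto simp: hecke_ang_def intro!: continuous_intros)
    also have "(\<lambda>z. if z \<in> - {0} then hecke_ang a z else hecke_ang a 0) = (\<lambda>z. hecke_ang a z)" by auto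
    finally show ?thesis .
  qed
  then show ?thesis using c by (rule measurable_compose_rev)
qed

text \<open>The number w is a phase: aligned with a complex sum it turns the modulus of the sum into
  a real part, so that real integrals suffice.\<close>

definition disc_hecke_ang :: "int \<Rightarrow> complex \<Rightarrow> real \<Rightarrow> complex \<Rightarrow> real" where
  "disc_hecke_ang a w r z = (if cmod z \<le> r then Re (w * hecke_ang a z) else 0)"

lemma abs_disc_hecke_ang_le: "cmod w = 1 \<Longrightarrow> \<bar>disc_hecke_ang a w r z\<bar> \<le> 1"
  using cmod_hecke_ang_le[of a z] abs_Re_le_cmod[of "w * hecke_ang a z"] by (auto simp: disc_hecke_ang_def norm_mult)

text \<open>There are three sources of error: points within 2 of the circle, where the cutoff may
  affect only one of the two arguments; points within \<open>sqrt r\<close> of the origin, where the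
  angle varies too fast; and the remaining ones, where \<open>hecke_ang_diff_le\<close> applies with
  |z| > \<open>sqrt r\<close>. The majorant consists of disc indicators only, so its integral is
  explicit.\<close>

lemma disc_hecke_ang_floor_diff:
  fixes x :: "real^2"
  assumes w: "cmod w = 1" and r: "r \<ge> 1"
  shows "\<bar>disc_hecke_ang a w r (eis_floor x) - disc_hecke_ang a w r (cplx x)\<bar>
     \<le> 2 * (indicator (cball 0 (r+2)) x - indicator (cball 0 (max 0 (r-2))) x)
        + 2 * indicator (cball 0 (sqrt r)) x + 24 * \<bar>of_int a\<bar> / sqrt r * indicator (cball 0 r) x"
    (is "?L \<le> ?R")
proof -
  define z where "z = cplx x"
  define f where "f = eis_floor x"
  have fz: "cmod (f - z) < 2" using eis_floor_dist[of x] by (simp add: f_def z_def)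
  have nx: "norm x = cmod z" by (simp add: norm_real2 z_def)
  have L2: "?L \<le> 2" using abs_disc_hecke_ang_le[OF w, of a r f] abs_disc_hecke_ang_le[OF w, of a r z] by (simp add: f_def z_def)
  have a0: "24 * \<bar>of_int a\<bar> / sqrt r \<ge> 0" using r by simp
  have ann: "indicator (cball 0 (r+2)) x - indicator (cball 0 (max 0 (r-2))) x \<ge> (0::real)"
    using r by (auto simp: indicator_def)
  have fz': "cmod f < cmod z + 2" "cmod z < cmod f + 2"
    using norm_triangle_ineq2[of f z] norm_triangle_ineq2[of z f] fz by (auto simp: norm_minus_commute)
  consider "cmod z \<le> sqrt r" | "cmod z > r + 2" | "cmod z > max 0 (r-2)" "cmod z \<le> r + 2"
    | "cmod z > sqrt r" "cmod z \<le> max 0 (r - 2)" by linarith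
  then show ?thesis
  proof cases
    case 1
    then have "indicator (cball 0 (sqrt r)) x = (1::real)" using nx by simp
    moreover have "24 * \<bar>of_int a\<bar> / sqrt r * indicator (cball 0 r) x \<ge> 0" using a0 by (intro mult_nonneg_nonneg) auto
    moreover have "L \<le> 2 \<Longrightarrow> 0 \<le> D \<Longrightarrow> I = 1 \<Longrightarrow> 0 \<le> E \<Longrightarrow> L \<le> 2 * D + 2 * I + E" for L D I E :: real by simp
    ultimately show ?thesis using L2 ann by blast
  next
    case 2
    then have "?L = 0" using fz' by (simp add: disc_hecke_ang_def f_def z_def)
    then show ?thesis using ann a0 by (simp add: indicator_def)
  next
    case 3
    then have "indicator (cball 0 (r+2)) x = (1::real)" "indicator (cball 0 (max 0 (r-2))) x = (0::real)"
      using nx by (auto simp: indicator_def max_def split: if_splits)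
    moreover have "24 * \<bar>of_int a\<bar> / sqrt r * indicator (cball 0 r) x \<ge> 0" using a0 by (intro mult_nonneg_nonneg) auto
    moreover have "indicator (cball 0 (sqrt r)) x \<ge> (0::real)" by simp
    moreover have "A = 1 \<Longrightarrow> B = 0 \<Longrightarrow> 0 \<le> E \<Longrightarrow> 0 \<le> I \<Longrightarrow> L \<le> 2 \<Longrightarrow> L \<le> 2 * (A - B) + 2 * I + E" for L A B I E :: real by simp
    ultimately show ?thesis using L2 by blast
  next
    case 4
    have "sqrt r \<ge> 0" using r by simp
    then have z0: "z \<noteq> 0" using 4 by auto
    then have "cmod z > 0" by simp
    then have le: "cmod z \<le> r - 2" using 4 by (auto simp: max_def split: if_splits)
    then have "?L = \<bar>Re (w * (hecke_ang a f - hecke_ang a z))\<bar>" using fz' by (simp add: disc_hecke_ang_def f_def z_def algebra_simps)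
    also have "\<dots> \<le> cmod (hecke_ang a f - hecke_ang a z)" using abs_Re_le_cmod[of "w * (hecke_ang a f - hecke_ang a z)"] w by (simp add: norm_mult)
    also have "\<dots> \<le> 24 * \<bar>of_int a\<bar> / cmod z" by (rule hecke_ang_diff_le[OF fz z0])
    also have "\<dots> \<le> 24 * \<bar>of_int a\<bar> / sqrt r" using 4 r z0 by (intro divide_left_mono mult_pos_pos) auto
    finally have "?L \<le> 24 * \<bar>of_int a\<bar> / sqrt r" .
    moreover have "indicator (cball 0 r) x = (1::real)" using nx le by simp
    moreover have "indicator (cball 0 (sqrt r)) x \<ge> (0::real)" by simp
    moreover have "L \<le> c \<Longrightarrow> J = 1 \<Longrightarrow> 0 \<le> I \<Longrightarrow> 0 \<le> D \<Longrightarrow> L \<le> 2 * D + 2 * I + c * J" for L c J I D :: real by simp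
    ultimately show ?thesis using ann by blast
  qed
qed

text \<open>The integrand is constant on each cell and all cells have the same area.\<close>

lemma sum_eis_covol_eq_integral:
  "(\<Sum>\<mu>\<in>{\<mu>\<in>Eis. cmod \<mu> \<le> r}. disc_hecke_ang a w r \<mu>) * eis_covol = (\<integral>x. disc_hecke_ang a w r (eis_floor x) \<partial>lborel)"
  and integrable_disc_hecke_ang_floor: "integrable lborel (\<lambda>x. disc_hecke_ang a w r (eis_floor x))"
proof -
  let ?A = "{\<mu>\<in>Eis. cmod \<mu> \<le> r}"
  have eq: "disc_hecke_ang a w r (eis_floor x) = (\<Sum>\<mu>\<in>?A. disc_hecke_ang a w r \<mu> * indicator (eis_cell \<mu>) x)" for x
  proof -
    have "(\<Sum>\<mu>\<in>?A. disc_hecke_ang a w r \<mu> * indicator (eis_cell \<mu>) x) = (\<Sum>\<mu>\<in>?A. if \<mu> = eis_floor x then disc_hecke_ang a w r \<mu> else 0)"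
      by (intro sum.cong) (auto simp: eis_cell_def)
    also have "\<dots> = disc_hecke_ang a w r (eis_floor x)"
      using finite_Eis_bounded[of r] eis_floor_in_Eis[of x] by (subst sum.delta) (auto simp: disc_hecke_ang_def)
    finally show ?thesis ..
  qed
  have int: "integrable lborel (\<lambda>x. disc_hecke_ang a w r \<mu> * indicator (eis_cell \<mu>) x)" if "\<mu> \<in> ?A" for \<mu>
    using integrable_indicator_eis_cell that by simp
  show "integrable lborel (\<lambda>x. disc_hecke_ang a w r (eis_floor x))"
    unfolding eq using int by (rule Bochner_Integration.integrable_sum)
  have "(\<integral>x. disc_hecke_ang a w r (eis_floor x) \<partial>lborel) = (\<Sum>\<mu>\<in>?A. \<integral>x. disc_hecke_ang a w r \<mu> * indicator (eis_cell \<mu>) x \<partial>lborel)"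
    unfolding eq using int by (rule Bochner_Integration.integral_sum)
  also have "\<dots> = (\<Sum>\<mu>\<in>?A. disc_hecke_ang a w r \<mu> * eis_covol)"
    by (intro sum.cong) (auto simp: measure_eis_cell)
  finally show "(\<Sum>\<mu>\<in>?A. disc_hecke_ang a w r \<mu>) * eis_covol = (\<integral>x. disc_hecke_ang a w r (eis_floor x) \<partial>lborel)"
    by (simp add: sum_distrib_right)
qed

lemma integrable_indicator_cball: "integrable lborel (indicator (cball (c :: real^2) r) :: _ \<Rightarrow> real)"
  using emeasure_lborel_cball_finite[of c r] by (simp add: integrable_indicator_iff)

lemma integral_indicator_cball: "r \<ge> 0 \<Longrightarrow> (\<integral>x. indicator (cball (0 :: real^2) r) x \<partial>lborel) = pi * r\<^sup>2"
  using content_cball[of r "0 :: real^2"] by (simp add: unit_ball_vol_2)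

lemma integrable_disc_hecke_ang: "cmod w = 1 \<Longrightarrow> integrable lborel (\<lambda>x. disc_hecke_ang a w r (cplx x))"
proof (rule Bochner_Integration.integrable_bound[OF integrable_indicator_cball[of 0 r]])
  assume w: "cmod w = 1"
  have c [measurable]: "cplx \<in> borel_measurable borel"
    unfolding cplx_def[abs_def] Complex_eq by (intro borel_measurable_continuous_onI continuous_intros)
  show "(\<lambda>x. disc_hecke_ang a w r (cplx x)) \<in> borel_measurable lborel"
    unfolding disc_hecke_ang_def by measurable
  show "AE x in lborel. norm (disc_hecke_ang a w r (cplx x)) \<le> norm (indicator (cball 0 r) x :: real)"
  proof (rule AE_I2)
    fix x :: "real^2"
    show "norm (disc_hecke_ang a w r (cplx x)) \<le> norm (indicator (cball 0 r) x :: real)"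
    proof (cases "cmod (cplx x) \<le> r")
      case True
      then show ?thesis using abs_disc_hecke_ang_le[OF w, of a r "cplx x"] by (simp add: norm_real2)
    qed (simp add: disc_hecke_ang_def)
  qed
qed

text \<open>The annulus has area at most 16 pi r and the inner disc area pi r, both with weight 2;
  this gives 34 = 32 + 2. The outer part has area at most pi r^2 and weight 24 |a| /
  \<open>sqrt r\<close>.\<close>

lemma lattice_sum_integral_diff:
  assumes w: "cmod w = 1" and r: "r \<ge> 1"
  shows "\<bar>(\<Sum>\<mu>\<in>{\<mu>\<in>Eis. cmod \<mu> \<le> r}. disc_hecke_ang a w r \<mu>) * eis_covol - (\<integral>x. disc_hecke_ang a w r (cplx x) \<partial>lborel)\<bar>
    \<le> (34 + 24 * \<bar>of_int a\<bar>) * pi * (r * sqrt r)"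
proof -
  define B where "B = (\<lambda>x::real^2. 2 * (indicator (cball 0 (r+2)) x - indicator (cball 0 (max 0 (r-2))) x)
        + 2 * indicator (cball 0 (sqrt r)) x + 24 * \<bar>of_int a\<bar> / sqrt r * indicator (cball 0 r) x :: real)"
  have "\<bar>(\<Sum>\<mu>\<in>{\<mu>\<in>Eis. cmod \<mu> \<le> r}. disc_hecke_ang a w r \<mu>) * eis_covol - (\<integral>x. disc_hecke_ang a w r (cplx x) \<partial>lborel)\<bar>
     = \<bar>\<integral>x. disc_hecke_ang a w r (eis_floor x) - disc_hecke_ang a w r (cplx x) \<partial>lborel\<bar>"
    unfolding sum_eis_covol_eq_integral
    by (subst Bochner_Integration.integral_diff) (auto intro: integrable_disc_hecke_ang_floor integrable_disc_hecke_ang w)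
  also have "\<dots> \<le> (\<integral>x. \<bar>disc_hecke_ang a w r (eis_floor x) - disc_hecke_ang a w r (cplx x)\<bar> \<partial>lborel)"
    by (rule integral_abs_bound)
  also have "\<dots> \<le> (\<integral>x. B x \<partial>lborel)"
    unfolding B_def using disc_hecke_ang_floor_diff[OF w r]
    by (intro integral_mono Bochner_Integration.integrable_abs Bochner_Integration.integrable_diff integrable_disc_hecke_ang_floor integrable_disc_hecke_ang w
        Bochner_Integration.integrable_add integrable_mult_right integrable_indicator_cball) auto
  also have "\<dots> = 2 * (pi * (r+2)\<^sup>2 - pi * (max 0 (r-2))\<^sup>2) + 2 * (pi * (sqrt r)\<^sup>2) + 24 * \<bar>of_int a\<bar> / sqrt r * (pi * r\<^sup>2)"
    unfolding B_def using r
    by (subst Bochner_Integration.integral_add Bochner_Integration.integral_diff integral_mult_right_zero integral_indicator_cball;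
        (intro Bochner_Integration.integrable_diff Bochner_Integration.integrable_add integrable_mult_right integrable_indicator_cball)?; (simp add: content_cball unit_ball_vol_2)?)+
  also have "\<dots> \<le> (34 + 24 * \<bar>of_int a\<bar>) * pi * (r * sqrt r)"
  proof -
    have 1: "(r+2)\<^sup>2 - (max 0 (r-2))\<^sup>2 \<le> 16 * r"
    proof (cases "r \<ge> 2")
      case True then show ?thesis by (simp add: power2_eq_square algebra_simps)
    next
      case False
      then have "(r+2) * (r+2) \<le> 4 * (4 * r)" using r by (intro mult_mono) auto
      then show ?thesis using False by (simp add: power2_eq_square max_def)
    qed
    have 2: "r \<le> r * sqrt r" using r by simp
    have 3: "r\<^sup>2 / sqrt r = r * sqrt r"
      using r by (simp add: power2_eq_square field_simps)
    have "2 * (pi * (r+2)\<^sup>2 - pi * (max 0 (r-2))\<^sup>2) = 2 * pi * ((r+2)\<^sup>2 - (max 0 (r-2))\<^sup>2)"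
      by (simp add: algebra_simps)
    also have "\<dots> \<le> 2 * pi * (16 * (r * sqrt r))" using 1 2 by (intro mult_left_mono) auto
    finally have 4: "2 * (pi * (r+2)\<^sup>2 - pi * (max 0 (r-2))\<^sup>2) \<le> 32 * pi * (r * sqrt r)" by simp
    have 5: "2 * (pi * (sqrt r)\<^sup>2) \<le> 2 * pi * (r * sqrt r)" using 2 r by simp
    have 6: "24 * \<bar>of_int a\<bar> / sqrt r * (pi * r\<^sup>2) = 24 * \<bar>of_int a\<bar> * pi * (r * sqrt r)"
      unfolding 3[symmetric] by simp
    have "X \<le> 32 * pi * q \<Longrightarrow> Y \<le> 2 * pi * q \<Longrightarrow> Z = 24 * k * pi * q \<Longrightarrow> X + Y + Z \<le> (34 + 24 * k) * pi * q"
      for X Y Z k q :: real by (simp add: algebra_simps)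
    from this[OF 4 5 6] show ?thesis .
  qed
  finally show ?thesis .
qed

text \<open>Rotating the disc by \<open>\<pi> / (6 a)\<close> changes the sign of the integrand.\<close>
lemma integral_disc_hecke_ang_eq_0:
  assumes a: "a \<noteq> 0" and w: "cmod w = 1"
  shows "(\<integral>x. disc_hecke_ang a w r (cplx x) \<partial>lborel) = 0"
proof -
  define t where "t = pi / (6 * of_int a)"
  define g :: "real^2 \<Rightarrow> real^2" where "g x = vec_of (cis t * cplx x)" for x
  \<comment> \<open>Values are placed in \<open>real^1\<close> because the linear change of
    variables is stated for vector-valued functions.\<close>
  define f :: "real^2 \<Rightarrow> real^1" where "f x = vec (disc_hecke_ang a w r (cplx x))" for x
  have lin: "linear g"
    unfolding g_def vec_of_def cplx_def
    by (rule linearI) (auto simp: vec_eq_iff forall_2 algebra_simps)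
  have ng: "norm (g x) = norm x" for x by (simp add: norm_real2 g_def norm_mult)
  have orth: "orthogonal_transformation g" unfolding orthogonal_transformation using lin ng by blast
  have surj: "g ` UNIV = UNIV"
    using orthogonal_transformation_surj[OF orth] by simp
  have fg: "f (g x) = - f x" for x
  proof -
    have "hecke_ang a (cis t) = -1" using a by (simp add: hecke_ang_def cis_power_int t_def)
    then have "disc_hecke_ang a w r (cis t * cplx x) = - disc_hecke_ang a w r (cplx x)"
      by (simp add: disc_hecke_ang_def hecke_ang_mult norm_mult)
    then show ?thesis by (simp add: f_def g_def vec_eq_iff)
  qed
  have int: "integrable lborel (\<lambda>x. disc_hecke_ang a w r (cplx x))" by (rule integrable_disc_hecke_ang[OF w])
  have intf: "integrable lborel f"
  proof -
    have "integrable lborel (\<lambda>x. disc_hecke_ang a w r (cplx x) *\<^sub>R (vec 1 :: real^1))" using int by simp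
    moreover have "(\<lambda>x. disc_hecke_ang a w r (cplx x) *\<^sub>R (vec 1 :: real^1)) = f" by (auto simp: f_def vec_eq_iff)
    ultimately show ?thesis by simp
  qed
  have absf: "f absolutely_integrable_on (g ` UNIV)"
    unfolding surj using intf integrable_completion[of f lborel] by (auto simp: set_integrable_def)
  have "integral (g ` UNIV) f = \<bar>det (matrix g)\<bar> *\<^sub>R integral UNIV (f \<circ> g)"
    using integral_change_of_variables_linear[OF lin] absf by blast
  then have "integral UNIV f = integral UNIV (\<lambda>x. - f x)"
    using orth by (simp add: surj o_def fg)
  then have "integral UNIV f = 0" by (simp add: vec_eq_iff)
  then have "(\<integral>x. f x \<partial>lborel) = 0" using integral_lborel[OF intf] by simp
  moreover have "(\<integral>x. f x \<partial>lborel) = (\<integral>x. disc_hecke_ang a w r (cplx x) \<partial>lborel) *\<^sub>R (vec 1 :: real^1)"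
  proof -
    have "(\<integral>x. f x \<partial>lborel) = (\<integral>x. disc_hecke_ang a w r (cplx x) *\<^sub>R (vec 1 :: real^1) \<partial>lborel)"
      by (intro Bochner_Integration.integral_cong) (auto simp: f_def vec_eq_iff)
    then show ?thesis using int by simp
  qed
  ultimately show ?thesis by (simp add: vec_eq_iff)
qed

lemma norm_hecke_ang_sum_le:
  assumes a: "a \<noteq> 0" and r: "r \<ge> 1"
  shows "cmod (\<Sum>\<mu>\<in>{\<mu>\<in>Eis. cmod \<mu> \<le> r}. hecke_ang a \<mu>) * eis_covol \<le> 58 * pi * \<bar>of_int a\<bar> * (r * sqrt r)"
proof (cases "(\<Sum>\<mu>\<in>{\<mu>\<in>Eis. cmod \<mu> \<le> r}. hecke_ang a \<mu>) = 0")
  case True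
  then show ?thesis using r by simp
next
  case False
  define S where "S = (\<Sum>\<mu>\<in>{\<mu>\<in>Eis. cmod \<mu> \<le> r}. hecke_ang a \<mu>)"
  define w where "w = cnj S / of_real (cmod S)"
  have w: "cmod w = 1" using False unfolding S_def[symmetric] by (simp add: w_def norm_divide)
  have "w * S = of_real (cmod S)"
    using False complex_norm_square[of S] by (simp add: w_def S_def[symmetric] power2_eq_square field_simps)
  then have "cmod S = Re (w * S)" by simp
  also have "\<dots> = (\<Sum>\<mu>\<in>{\<mu>\<in>Eis. cmod \<mu> \<le> r}. disc_hecke_ang a w r \<mu>)"
    unfolding S_def sum_distrib_left Re_sum by (intro sum.cong) (auto simp: disc_hecke_ang_def)
  finally have "cmod S * eis_covol \<le> (34 + 24 * \<bar>of_int a\<bar>) * pi * (r * sqrt r)"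
    using lattice_sum_integral_diff[OF w r, of a] integral_disc_hecke_ang_eq_0[OF a w] by simp
  also have "\<dots> \<le> (58 * \<bar>of_int a\<bar>) * pi * (r * sqrt r)"
  proof (intro mult_right_mono)
    have "\<bar>real_of_int a\<bar> \<ge> 1" using a by linarith
    then show "34 + 24 * \<bar>real_of_int a\<bar> \<le> 58 * \<bar>real_of_int a\<bar>" by simp
  qed (use r in auto)
  finally show ?thesis by (simp add: S_def mult_ac)
qed

lemma card_Eis_disc:
  assumes r: "r \<ge> 1"
  shows "\<bar>real (card {\<mu>\<in>Eis. cmod \<mu> \<le> r}) * eis_covol - pi * r\<^sup>2\<bar> \<le> 34 * pi * (r * sqrt r)"
proof -
  have d: "disc_hecke_ang 0 1 r z = indicator {z. cmod z \<le> r} z" for z by (simp add: disc_hecke_ang_def hecke_ang_def)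
  have "(\<lambda>x. disc_hecke_ang 0 1 r (cplx x)) = indicator (cball 0 r)"
    by (auto simp: d indicator_def norm_real2 fun_eq_iff)
  then have "(\<integral>x. disc_hecke_ang 0 1 r (cplx x) \<partial>lborel) = pi * r\<^sup>2" using r integral_indicator_cball[of r] by simp
  moreover have "(\<Sum>\<mu>\<in>{\<mu>\<in>Eis. cmod \<mu> \<le> r}. disc_hecke_ang 0 1 r \<mu>) = real (card {\<mu>\<in>Eis. cmod \<mu> \<le> r})"
    by (simp add: d)
  ultimately show ?thesis using lattice_sum_integral_diff[of 1 r 0] r by simp
qed

lemma eis_covol_pos: "eis_covol > 0"
proof (rule ccontr)
  assume "\<not> eis_covol > 0"
  moreover have "eis_covol \<ge> 0" by (simp add: eis_covol_def)
  ultimately have "eis_covol = 0" by simp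
  \<comment> \<open>Covolume zero would force pi r^2 \<le> 34 pi r^(3/2), that is
    \<open>sqrt r\<close> \<le> 34. The square 2500 = 50^2 violates this and keeps the root
    exact.\<close>
  then have "pi * 2500\<^sup>2 \<le> 34 * pi * (2500 * sqrt (50\<^sup>2))" using card_Eis_disc[of 2500] by simp
  then show False unfolding real_sqrt_abs by simp
qed

section \<open>Borel-Caratheodory and zeros\<close>

lemma ln_norm_mono: "z \<noteq> 0 \<Longrightarrow> norm z \<le> K \<Longrightarrow> ln (norm z) \<le> ln K"
  by (smt (verit) ln_le_cancel_iff zero_less_norm_iff)

text \<open>The map w -> w / (2 M - w) sends the half plane Re w < M into the unit disc and fixes 0,
  so the Schwarz lemma applies after rescaling. Its two conclusions yield the growth bound and the
  bound for the derivative at the centre.\<close>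

lemma borel_caratheodory:
  assumes hol: "g holomorphic_on ball c R" and R: "R > 0" and gc: "g c = 0"
    and M: "\<And>z. z \<in> ball c R \<Longrightarrow> Re (g z) < M"
  shows "norm (deriv g c) \<le> 2 * M / R"
    and "\<And>z. z \<in> ball c R \<Longrightarrow> norm (g z) \<le> 2 * M * dist c z / (R - dist c z)"
proof -
  have M0: "M > 0" using M[of c] gc R by simp
  define G where "G w = g (c + of_real R * w)" for w
  define h where "h w = G w / (of_real (2*M) - G w)" for w
  have inb: "c + of_real R * w \<in> ball c R" if "norm w < 1" for w
    using that R by (simp add: dist_norm norm_mult)
  have ReG: "Re (G w) < M" if "norm w < 1" for w using M inb[OF that] by (simp add: G_def)
  have nz: "of_real (2*M) - G w \<noteq> 0" if "norm w < 1" for w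
  proof
    assume "of_real (2*M) - G w = 0"
    then have "Re (G w) = 2*M" by (simp add: complex_eq_iff)
    with ReG[OF that] M0 show False by simp
  qed
  have holG: "G holomorphic_on ball 0 1"
    unfolding G_def
    by (rule holomorphic_on_compose_gen[OF _ hol, unfolded o_def]) (auto intro!: holomorphic_intros simp: inb[unfolded mem_ball])
  have holh: "h holomorphic_on ball 0 1"
    unfolding h_def using nz by (intro holomorphic_intros holG) auto
  have G0: "G 0 = 0" by (simp add: G_def gc)
  have h0: "h 0 = 0" by (simp add: h_def G_def gc)
  have hlt: "norm (h w) < 1" if "norm w < 1" for w
  proof -
    have "(norm (G w))\<^sup>2 < (norm (of_real (2*M) - G w))\<^sup>2"
    proof -
      have "(norm (of_real (2*M) - G w))\<^sup>2 - (norm (G w))\<^sup>2 = 4 * M * (M - Re (G w))"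
        unfolding cmod_power2 by (simp add: power2_eq_square algebra_simps)
      moreover have "\<dots> > 0" using ReG[OF that] M0 by simp
      ultimately show ?thesis by linarith
    qed
    then have "norm (G w) < norm (of_real (2*M) - G w)" by (rule power2_less_imp_less) simp
    then show ?thesis using nz[OF that] by (simp add: h_def norm_divide)
  qed
  have Gh: "G w * (1 + h w) = of_real (2*M) * h w" if "norm w < 1" for w
    using nz[OF that] by (simp add: h_def field_simps)
  have sch: "norm (h w) \<le> norm w" if "norm w < 1" for w
    by (rule Schwarz_Lemma(1)[OF holh h0 hlt that])
  have sch': "norm (deriv h 0) \<le> 1"
    by (rule Schwarz_Lemma(2)[OF holh h0 hlt, of 0]) auto
  show "norm (g z) \<le> 2 * M * dist c z / (R - dist c z)" if z: "z \<in> ball c R" for z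
  proof -
    define w where "w = (z - c) / of_real R"
    have nw: "norm w = dist c z / R" using R by (simp add: w_def norm_divide dist_norm norm_minus_commute)
    have w1: "norm w < 1" using z R by (simp add: nw)
    have gz: "g z = G w" using R by (simp add: G_def w_def)
    have "norm (G w) * (1 - norm w) \<le> norm (G w) * (1 - norm (h w))"
      using sch[OF w1] by (intro mult_left_mono) auto
    also have "\<dots> \<le> norm (G w) * norm (1 + h w)"
      using norm_triangle_ineq2[of 1 "- h w"] by (intro mult_left_mono) auto
    also have "\<dots> = 2 * M * norm (h w)" using Gh[OF w1] M0 by (simp flip: norm_mult) (simp add: norm_mult)
    also have "\<dots> \<le> 2 * M * norm w" using sch[OF w1] M0 by simp
    finally have "norm (G w) \<le> 2 * M * norm w / (1 - norm w)" using w1 by (simp add: pos_le_divide_eq)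
    also have "\<dots> = 2 * M * dist c z / (R - dist c z)" using R z by (simp add: nw field_simps)
    finally show ?thesis by (simp add: gz)
  qed
  have dG: "(G has_field_derivative deriv G 0) (at 0)" and dh: "(h has_field_derivative deriv h 0) (at 0)"
    using holG holh by (auto intro: holomorphic_derivI)
  have dg: "(g has_field_derivative deriv g c) (at c)" using hol R by (auto intro: holomorphic_derivI)
  have "(G has_field_derivative deriv g c * of_real R) (at 0)"
    unfolding G_def by (rule DERIV_chain2[of g]) (use dg in \<open>auto intro!: derivative_eq_intros\<close>)
  then have dG': "deriv G 0 = deriv g c * of_real R" by (rule DERIV_imp_deriv)
  have "((\<lambda>w. G w / (of_real (2*M) - G w)) has_field_derivative deriv G 0 / of_real (2*M)) (at 0)"
    using M0 G0 by (auto intro!: derivative_eq_intros dG simp: divide_simps)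
  then have "deriv h 0 = deriv G 0 / of_real (2*M)" unfolding h_def[abs_def] by (rule DERIV_imp_deriv)
  then have "norm (deriv g c) * R / (2 * M) \<le> 1" using sch' R M0 by (simp add: dG' norm_mult norm_divide)
  then show "norm (deriv g c) \<le> 2 * M / R" using R M0 by (simp add: field_simps)
qed

lemma deriv_holomorphic_log:
  assumes g: "g holomorphic_on S" "open S" "c \<in> S" "\<And>z. z \<in> S \<Longrightarrow> f z = exp (g z)"
  shows "deriv (\<lambda>z. g z - k) c = deriv f c / f c"
proof -
  have dg: "(g has_field_derivative deriv g c) (at c)" by (rule holomorphic_derivI[OF g(1-3)])
  then have "((\<lambda>z. exp (g z)) has_field_derivative (exp (g c) * deriv g c)) (at c)"
    by (auto intro!: derivative_eq_intros)
  then have "(f has_field_derivative (exp (g c) * deriv g c)) (at c)"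
    by (rule has_field_derivative_transform_within_open[OF _ g(2,3)]) (use g(4) in auto)
  then have "deriv f c = f c * deriv g c" using g(4)[OF g(3)] by (simp add: DERIV_imp_deriv)
  moreover have "deriv (\<lambda>z. g z - k) c = deriv g c"
    by (rule DERIV_imp_deriv) (auto intro!: derivative_eq_intros dg)
  ultimately show ?thesis using g(4)[OF g(3)] by simp
qed

text \<open>Dividing by the Blaschke factor of the disc removes \<rho> without changing the modulus
  on the boundary circle, so K survives by the maximum principle. As \<rho> lies in the inner half
  of the disc, the value at the centre at least doubles. The last clause isolates the contribution
  of \<rho> to the logarithmic derivative.\<close>

lemma blaschke_step:
  assumes U: "open U" "cball c R \<subseteq> U" and hol: "f holomorphic_on U" and R: "R > 0" and fc: "f c \<noteq> 0"
    and K: "\<And>z. z \<in> cball c R \<Longrightarrow> norm (f z) \<le> K"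
    and \<rho>: "\<rho> \<in> ball c (R/2)" "f \<rho> = 0"
  obtains g where "g holomorphic_on U" "g c \<noteq> 0" "\<And>z. z \<in> cball c R \<Longrightarrow> norm (g z) \<le> K"
    "2 * norm (f c) \<le> norm (g c)" "\<And>z. z \<in> ball c R \<Longrightarrow> g z = 0 \<Longrightarrow> f z = 0"
    "Re (deriv f c / f c) = Re (deriv g c / g c) + Re (c - \<rho>) * (1 / (norm (c - \<rho>))\<^sup>2 - 1 / R\<^sup>2)"
proof -
  define h where "h z = (if z = \<rho> then deriv f \<rho> else (f z - f \<rho>) / (z - \<rho>))" for z
  have holh: "h holomorphic_on U" unfolding h_def by (rule pole_lemma_open[OF hol U(1)])
  have fh: "f z = (z - \<rho>) * h z" for z by (simp add: h_def \<rho>)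
  define q where "q z = (of_real (R\<^sup>2) - cnj (\<rho> - c) * (z - c)) / of_real R" for z
  define g where "g z = h z * q z" for z
  have holg: "g holomorphic_on U" unfolding g_def q_def using R by (intro holomorphic_intros holh) auto
  have cU: "c \<in> U" using U R by auto
  have hc: "h c \<noteq> 0" using fc fh by auto
  have c\<rho>: "c \<noteq> \<rho>" using fc \<rho> by auto
  have qc: "q c = of_real R" using R by (simp add: q_def power2_eq_square)
  have gc: "g c \<noteq> 0" using hc qc R by (simp add: g_def)
  have \<rho>R: "norm (\<rho> - c) < R/2" using \<rho> by (simp add: dist_norm norm_minus_commute)
  have qsphere: "norm (q z) = norm (z - \<rho>)" if "norm (z - c) = R" for z
  proof -
    let ?w = "z - c" and ?r = "\<rho> - c"
    have "of_real (R\<^sup>2) = ?w * cnj ?w" using that by (metis complex_norm_square of_real_power)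
    then have "of_real (R\<^sup>2) - cnj ?r * ?w = ?w * cnj (?w - ?r)" by (simp add: algebra_simps)
    then have "norm (q z) = norm (?w * cnj (?w - ?r)) / R" using R by (simp add: q_def norm_divide)
    also have "\<dots> = norm (z - \<rho>)" using that R by (simp only: norm_mult complex_mod_cnj) simp
    finally show ?thesis .
  qed
  have gK: "norm (g z) \<le> K" if "z \<in> cball c R" for z
  proof (rule maximum_modulus_frontier[of g "cball c R"])
    show "g holomorphic_on interior (cball c R)" using holg U by (meson holomorphic_on_subset interior_subset order_trans)
    show "continuous_on (closure (cball c R)) g" using holg U
      by (metis closed_cball closure_closed holomorphic_on_imp_continuous_on holomorphic_on_subset)
    show "bounded (cball c R)" by simp
    show "z \<in> cball c R" by fact
    fix z assume "z \<in> frontier (cball c R)"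
    then have z: "norm (z - c) = R" using R by (simp add: dist_norm norm_minus_commute)
    then have "norm (g z) = norm (f z)" using qsphere[OF z] by (simp add: g_def fh norm_mult)
    also have "\<dots> \<le> K" using z by (intro K) (simp add: dist_norm norm_minus_commute)
    finally show "norm (g z) \<le> K" .
  qed
  have "2 * norm (f c) \<le> norm (g c)"
  proof -
    have "norm (f c) = norm (\<rho> - c) * norm (h c)" by (simp add: fh norm_mult norm_minus_commute)
    also have "\<dots> \<le> R/2 * norm (h c)" using \<rho>R by (intro mult_right_mono) auto
    finally show ?thesis using R by (simp add: g_def qc norm_mult mult.commute)
  qed
  moreover have "f z = 0" if "z \<in> ball c R" "g z = 0" for z
  proof -
    have "q z \<noteq> 0"
    proof
      assume "q z = 0"
      then have "of_real (R\<^sup>2) = cnj (\<rho> - c) * (z - c)" using R by (simp add: q_def)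
      then have "norm (of_real (R\<^sup>2) :: complex) = norm (cnj (\<rho> - c) * (z - c))" by simp
      then have "R\<^sup>2 = norm (\<rho> - c) * norm (z - c)" by (simp only: norm_mult norm_of_real complex_mod_cnj abs_power2)
      also have "\<dots> \<le> R/2 * R" using \<rho>R that R by (intro mult_mono) (auto simp: dist_norm norm_minus_commute)
      finally show False using R by (simp add: power2_eq_square)
    qed
    then show ?thesis using that by (simp add: g_def fh)
  qed
  moreover have "Re (deriv f c / f c) = Re (deriv g c / g c) + Re (c - \<rho>) * (1 / (norm (c - \<rho>))\<^sup>2 - 1 / R\<^sup>2)"
  proof -
    have dh: "(h has_field_derivative deriv h c) (at c)" using holomorphic_derivI[OF holh U(1) cU] .
    have "((\<lambda>z. (z - \<rho>) * h z) has_field_derivative (h c + (c - \<rho>) * deriv h c)) (at c)"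
      by (auto intro!: derivative_eq_intros dh)
    then have "deriv f c = h c + (c - \<rho>) * deriv h c"
      using fh by (metis (no_types, lifting) DERIV_imp_deriv ext)
    then have 1: "deriv f c / f c = 1 / (c - \<rho>) + deriv h c / h c" using hc c\<rho> by (simp add: fh divide_simps)
    have dq: "(q has_field_derivative (- cnj (\<rho> - c) / of_real R)) (at c)"
      unfolding q_def[abs_def] using R by (auto intro!: derivative_eq_intros)
    have "(g has_field_derivative (deriv h c * of_real R + h c * (- cnj (\<rho> - c) / of_real R))) (at c)"
      unfolding g_def[abs_def] using DERIV_mult[OF dh dq] by (simp add: qc mult.commute)
    then have "deriv g c = deriv h c * of_real R + h c * (- cnj (\<rho> - c) / of_real R)" by (rule DERIV_imp_deriv)
    then have "deriv g c / g c = deriv h c / h c - cnj (\<rho> - c) / of_real R / of_real R"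
      using hc R by (simp add: g_def qc field_simps)
    then have 2: "deriv g c / g c = deriv h c / h c + cnj (c - \<rho>) / of_real (R\<^sup>2)"
      by (simp add: power2_eq_square diff_divide_distrib)
    have "Re (1 / (c - \<rho>)) = Re (c - \<rho>) / (norm (c - \<rho>))\<^sup>2"
      unfolding cmod_power2 by (simp add: Re_divide)
    moreover have "Re (cnj (c - \<rho>) / of_real (R\<^sup>2)) = Re (c - \<rho>) / R\<^sup>2"
      by (metis Re_divide_of_real complex_cnj(1) cnj.sel(1))
    ultimately show ?thesis unfolding 1 2 by (simp add: algebra_simps)
  qed
  ultimately show ?thesis using that[of g] holg gc gK by blast
qed

text \<open>Zeros in the inner half are divided out one at a time. Each step doubles the value at
  the centre while K remains an upper bound, so K < |f c| 2^n allows fewer than n + 1 steps: the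
  induction on n takes the place of a zero count. A zero that is not to the right of c contributes a
  nonnegative amount, which is dropped. When none is left, f has a holomorphic logarithm and
  Borel-Caratheodory applies.\<close>

lemma landau_re_logderiv:
  assumes U: "open U" "cball c R \<subseteq> U" and R: "R > 0"
    and hol: "f holomorphic_on U" and fc: "f c \<noteq> 0"
    and K: "\<And>z. z \<in> cball c R \<Longrightarrow> norm (f z) \<le> K"
    and zeros: "\<And>z. z \<in> ball c (R/2) \<Longrightarrow> f z = 0 \<Longrightarrow> Re z \<le> Re c"
  shows "Re (deriv f c / f c) \<ge> - (4 / R * (ln (K / norm (f c)) + 1))"
proof -
  have "\<exists>n. K / norm (f c) < 2 ^ n" by (rule real_arch_pow) simp
  then obtain n where "K < norm (f c) * 2 ^ n" using fc by (auto simp: field_simps)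
  then show ?thesis using hol fc K zeros
  proof (induction n arbitrary: f)
    case 0
    then have "norm (f c) \<le> K" using R by simp
    with 0 show ?case by simp
  next
    case (Suc n)
    have fcK: "norm (f c) \<le> K" using Suc.prems R by simp
    show ?case
    proof (cases "\<exists>\<rho>\<in>ball c (R/2). f \<rho> = 0")
      case False
      have "f holomorphic_on ball c (R/2)"
        using Suc.prems(2) by (rule holomorphic_on_subset) (use U R in auto)
      then obtain g where g: "g holomorphic_on ball c (R/2)" "\<And>z. z \<in> ball c (R/2) \<Longrightarrow> f z = exp (g z)"
        using contractible_imp_holomorphic_log[of f "ball c (R/2)"] False convex_imp_contractible[OF convex_ball] by metis
      define G where "G z = g z - g c" for z
      \<comment> \<open>The summand 1 provides the strict inequality that
        \<open>borel_caratheodory\<close> asks for; the radius R / 2 then gives the factor 4 /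
        R.\<close>
      define M where "M = ln (K / norm (f c)) + 1"
      have holG: "G holomorphic_on ball c (R/2)" unfolding G_def by (intro holomorphic_intros g)
      have "norm (deriv G c) \<le> 2 * M / (R/2)"
      proof (rule borel_caratheodory(1)[OF holG])
        fix z assume z: "z \<in> ball c (R/2)"
        have "norm (f z) \<le> K" using z R by (intro Suc.prems) auto
        moreover have "f z \<noteq> 0" using False z by blast
        ultimately have "ln (norm (f z)) \<le> ln K" using ln_norm_mono by blast
        moreover have "Re (g z) = ln (norm (f z))" using g(2)[OF z] by simp
        moreover have "Re (g c) = ln (norm (f c))" using g(2)[of c] R by simp
        moreover have "K > 0" using fcK Suc.prems(3) by (meson dual_order.trans less_le_not_le linorder_not_less zero_less_norm_iff)
        ultimately show "Re (G z) < M" using Suc.prems(3) by (simp add: G_def M_def ln_div)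
      qed (use R in \<open>auto simp: G_def\<close>)
      moreover have "deriv G c = deriv f c / f c"
        unfolding G_def[abs_def] by (rule deriv_holomorphic_log[OF g(1) open_ball _ g(2)]) (use R in auto)
      ultimately have "norm (deriv f c / f c) \<le> 4 / R * M" by simp
      moreover have "- norm (deriv f c / f c) \<le> Re (deriv f c / f c)"
        using abs_Re_le_cmod[of "deriv f c / f c"] by linarith
      ultimately show ?thesis unfolding M_def by linarith
    next
      case True
      then obtain \<rho> where \<rho>: "\<rho> \<in> ball c (R/2)" "f \<rho> = 0" by blast
      obtain g where g: "g holomorphic_on U" "g c \<noteq> 0" "\<And>z. z \<in> cball c R \<Longrightarrow> norm (g z) \<le> K"
        "2 * norm (f c) \<le> norm (g c)" "\<And>z. z \<in> ball c R \<Longrightarrow> g z = 0 \<Longrightarrow> f z = 0"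
        "Re (deriv f c / f c) = Re (deriv g c / g c) + Re (c - \<rho>) * (1 / (norm (c - \<rho>))\<^sup>2 - 1 / R\<^sup>2)"
        using blaschke_step[OF U Suc.prems(2) R Suc.prems(3,4) \<rho>] by blast
      have "K < norm (f c) * 2 ^ Suc n" by fact
      also have "\<dots> \<le> norm (g c) * 2 ^ n" using g(4) by simp
      finally have "Re (deriv g c / g c) \<ge> - (4 / R * (ln (K / norm (g c)) + 1))"
        using g(1-3,5) Suc.prems(5) R by (intro Suc.IH) auto
      moreover have "ln (K / norm (g c)) \<le> ln (K / norm (f c))"
      proof -
        have "0 < norm (f c)" "norm (f c) \<le> norm (g c)" "0 < norm (g c)" using g(2,4) Suc.prems(3) norm_ge_zero[of "f c"] by (auto simp del: norm_ge_zero)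
        moreover have "0 < K" using calculation fcK by linarith
        ultimately show ?thesis by (simp add: ln_div)
      qed
      then have "4 / R * (ln (K / norm (g c)) + 1) \<le> 4 / R * (ln (K / norm (f c)) + 1)"
        using R by (intro mult_left_mono) auto
      moreover have "Re (c - \<rho>) * (1 / (norm (c - \<rho>))\<^sup>2 - 1 / R\<^sup>2) \<ge> 0"
      proof (rule mult_nonneg_nonneg)
        show "0 \<le> Re (c - \<rho>)" using Suc.prems(5)[OF \<rho>] by simp
        have "norm (c - \<rho>) \<le> R" "0 < norm (c - \<rho>)" using \<rho> Suc.prems(3) R by (auto simp: dist_norm)
        then show "0 \<le> 1 / (norm (c - \<rho>))\<^sup>2 - 1 / R\<^sup>2" by (simp add: frac_le power_mono)
      qed
      ultimately show ?thesis unfolding g(6) by linarith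
    qed
  qed
qed

text \<open>One zero is divided out by hand and its contribution retained, the others are dropped.
  The retained term is what repels a zero from the line Re s = 1.\<close>

lemma landau_re_logderiv_zero:
  assumes U: "open U" "cball c R \<subseteq> U" and R: "R > 0"
    and hol: "f holomorphic_on U" and fc: "f c \<noteq> 0"
    and K: "\<And>z. z \<in> cball c R \<Longrightarrow> norm (f z) \<le> K"
    and zeros: "\<And>z. z \<in> ball c (R/2) \<Longrightarrow> f z = 0 \<Longrightarrow> Re z \<le> Re c"
    and \<rho>: "\<rho> \<in> ball c (R/2)" "f \<rho> = 0"
  shows "Re (deriv f c / f c) \<ge> Re (c - \<rho>) * (1 / (norm (c - \<rho>))\<^sup>2 - 1 / R\<^sup>2) - 4 / R * (ln (K / norm (f c)) + 1)"
proof -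
  obtain g where g: "g holomorphic_on U" "g c \<noteq> 0" "\<And>z. z \<in> cball c R \<Longrightarrow> norm (g z) \<le> K"
        "2 * norm (f c) \<le> norm (g c)" "\<And>z. z \<in> ball c R \<Longrightarrow> g z = 0 \<Longrightarrow> f z = 0"
        "Re (deriv f c / f c) = Re (deriv g c / g c) + Re (c - \<rho>) * (1 / (norm (c - \<rho>))\<^sup>2 - 1 / R\<^sup>2)"
    using blaschke_step[OF U hol R fc K \<rho>] by blast
  have "Re (deriv g c / g c) \<ge> - (4 / R * (ln (K / norm (g c)) + 1))"
    using g(1-3,5) zeros R by (intro landau_re_logderiv[OF U R]) auto
  moreover have "ln (K / norm (g c)) \<le> ln (K / norm (f c))"
  proof -
    have "0 < norm (f c)" "norm (f c) \<le> norm (g c)" "0 < norm (g c)" using g(2,4) fc norm_ge_zero[of "f c"] by (auto simp del: norm_ge_zero)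
    moreover have "norm (f c) \<le> K" using K[of c] R by simp
    ultimately show ?thesis by (simp add: ln_div)
  qed
  then have "4 / R * (ln (K / norm (g c)) + 1) \<le> 4 / R * (ln (K / norm (f c)) + 1)"
    using R by (intro mult_left_mono) auto
  ultimately show ?thesis unfolding g(6) by linarith
qed

text \<open>Borel-Caratheodory is applied twice to a logarithm g of f. About c it gives |g(s) -
  g(c)| \<le> 2 M. About s, with radius R / 2 and real part below M + 2 M, it bounds the derivative
  by 2 * (3 M) / (R / 2) = 12 M / R.\<close>

lemma logderiv_bound_nonvanishing:
  assumes hol: "f holomorphic_on ball c R" and R: "R > 0" and nz: "\<And>z. z \<in> ball c R \<Longrightarrow> f z \<noteq> 0"
    and K: "\<And>z. z \<in> ball c R \<Longrightarrow> norm (f z) \<le> K"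
    and s: "dist c s \<le> R / 2"
  shows "norm (deriv f s / f s) \<le> 12 / R * (ln (K / norm (f c)) + 1)"
proof -
  obtain g where g: "g holomorphic_on ball c R" "\<And>z. z \<in> ball c R \<Longrightarrow> f z = exp (g z)"
    using contractible_imp_holomorphic_log[of f "ball c R"] hol nz convex_imp_contractible[OF convex_ball] by metis
  have c: "c \<in> ball c R" using R by simp
  have sb: "s \<in> ball c R" using R s by simp
  have fc: "norm (f c) > 0" using nz c by simp
  have fcK: "norm (f c) \<le> K" using K c by simp
  define M where "M = ln (K / norm (f c)) + 1"
  have "ln (K / norm (f c)) \<ge> 0" using fc fcK by (simp add: ln_ge_zero)
  then have M0: "M > 0" by (simp add: M_def)
  have ReG: "Re (g z - g c) < M" if z: "z \<in> ball c R" for z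
  proof -
    have "ln (norm (f z)) \<le> ln K" using K[OF z] nz[OF z] ln_norm_mono by blast
    moreover have "Re (g z) = ln (norm (f z))" "Re (g c) = ln (norm (f c))" using g(2)[OF z] g(2)[OF c] by simp_all
    moreover have "K > 0" using fc fcK by linarith
    ultimately show ?thesis using fc by (simp add: M_def ln_div)
  qed
  have "norm (g s - g c) \<le> 2 * M * dist c s / (R - dist c s)"
    by (rule borel_caratheodory(2)[of "\<lambda>z. g z - g c"]) (use g R ReG sb in \<open>auto intro!: holomorphic_intros\<close>)
  also have "\<dots> \<le> 2 * M * (R/2) / (R/2)" using s R M0 by (intro frac_le mult_left_mono) auto
  finally have gs: "norm (g s - g c) \<le> 2 * M" using R by simp
  have sub: "ball s (R/2) \<subseteq> ball c R"
  proof
    fix z assume "z \<in> ball s (R/2)"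
    then show "z \<in> ball c R" using s dist_triangle[of c z s] by (simp add: dist_commute)
  qed
  have "norm (deriv (\<lambda>z. g z - g s) s) \<le> 2 * (3 * M) / (R/2)"
  proof (rule borel_caratheodory(1))
    show "(\<lambda>z. g z - g s) holomorphic_on ball s (R/2)"
      by (intro holomorphic_intros holomorphic_on_subset[OF g(1) sub])
    show "Re (g z - g s) < 3 * M" if "z \<in> ball s (R/2)" for z
    proof -
      have "Re (g z - g c) < M" using that sub ReG by blast
      moreover have "Re (g c - g s) \<le> norm (g s - g c)" by (metis complex_Re_le_cmod norm_minus_commute)
      ultimately show ?thesis using gs by simp
    qed
  qed (use R in auto)
  moreover have "deriv (\<lambda>z. g z - g s) s = deriv f s / f s"
    by (rule deriv_holomorphic_log[OF g(1) open_ball sb g(2)])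
  ultimately have "norm (deriv f s / f s) \<le> 12 / R * M" by simp
  then show ?thesis by (simp add: M_def)
qed

section \<open>The truncated Perron integral\<close>

lemma convex_contour_integral_path_independent:
  assumes "convex S" "open S" "f holomorphic_on S"
    and "valid_path p" "path_image p \<subseteq> S" "valid_path q" "path_image q \<subseteq> S"
    and "pathstart p = pathstart q" "pathfinish p = pathfinish q"
  shows "contour_integral p f = contour_integral q f"
proof -
  obtain g where g: "\<And>x. x \<in> S \<Longrightarrow> (g has_field_derivative f x) (at x within S)"
    using holomorphic_convex_primitive'[OF assms(1-3)] by blast
  have "(f has_contour_integral (g (pathfinish p) - g (pathstart p))) p"
    by (rule contour_integral_primitive[of S g f p]) (use g assms in auto)
  moreover have "(f has_contour_integral (g (pathfinish q) - g (pathstart q))) q"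
    by (rule contour_integral_primitive[of S g f q]) (use g assms in auto)
  ultimately show ?thesis using assms(8,9) by (simp add: contour_integral_unique)
qed

text \<open>The segment is bent onto the circle about 0 through its endpoints, whose radius R is at
  least T. On the right arc for L \<le> 0, and on the left arc for L > 0, the exponential has
  modulus at most exp (\<sigma> L); in the second case the full circle contributes the residue L of
  the double pole. The kernel decays like 1 / R^2, so arc length times maximum is already O(1 / T),
  uniformly near L = 0.\<close>

lemma perron_truncated:
  fixes L \<sigma> T :: real
  assumes "\<sigma> > 0" "T > 0"
  shows "norm (contour_integral (linepath (Complex \<sigma> (-T)) (Complex \<sigma> T)) (\<lambda>s. exp (s * of_real L) / s\<^sup>2)
     - 2 * pi * \<i> * of_real (max 0 L)) \<le> 2 * pi * exp (\<sigma> * L) / T"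
proof -
  define f where "f = (\<lambda>s::complex. exp (s * of_real L) / s\<^sup>2)"
  define \<phi> where "\<phi> = arctan (T / \<sigma>)"
  define R where "R = sqrt (\<sigma>\<^sup>2 + T\<^sup>2)"
  have \<phi>: "0 < \<phi>" "\<phi> < pi/2" using assms using arctan_ubound[of "T / \<sigma>"] by (auto simp: \<phi>_def)
  have R: "R > 0" "R \<ge> T" using assms by (auto simp: R_def sum_power2_gt_zero_iff intro!: real_le_rsqrt)
  have R2: "R\<^sup>2 = \<sigma>\<^sup>2 + T\<^sup>2" by (simp add: R_def)
  have cosp: "R * cos \<phi> = \<sigma>" "R * sin \<phi> = T"
  proof -
    have 1: "sqrt (1 + (T/\<sigma>)\<^sup>2) = R / \<sigma>"
    proof (rule real_sqrt_unique)
      show "(R / \<sigma>)\<^sup>2 = 1 + (T / \<sigma>)\<^sup>2" using assms by (simp add: power_divide R2 add_divide_distrib)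
    qed (use R assms in auto)
    show "R * cos \<phi> = \<sigma>" using R assms unfolding \<phi>_def cos_arctan 1 by simp
    show "R * sin \<phi> = T" using R assms unfolding \<phi>_def sin_arctan 1 by simp
  qed
  define F where "F t = f (R * cis t) * R * \<i> * cis t" for t
  have Fcont: "continuous_on A F" for A
    unfolding F_def f_def using R by (intro continuous_intros) auto
  have Fint: "F integrable_on {a..b}" for a b by (intro integrable_continuous_interval Fcont)
  have arc: "contour_integral (part_circlepath 0 R a b) f = integral {a..b} F" if "a < b" for a b
    using contour_integral_part_circlepath_eq[OF that, of 0 R f] by (simp add: F_def[abs_def])
  have fin: "f contour_integrable_on (part_circlepath 0 R a b)" for a b
    by (rule contour_integrable_continuous_part_circlepath)
       (use R in \<open>auto simp: f_def path_image_part_circlepath' intro!: continuous_intros\<close>)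
  have bound: "norm (contour_integral (part_circlepath 0 R a b) f) \<le> 2 * pi * exp (\<sigma> * L) / T"
    if ab: "a \<le> b" "b - a \<le> 2 * pi" and re: "\<And>t. a \<le> t \<Longrightarrow> t \<le> b \<Longrightarrow> R * cos t * L \<le> \<sigma> * L" for a b
  proof -
    have "norm (contour_integral (part_circlepath 0 R a b) f) \<le> exp (\<sigma> * L) / R\<^sup>2 * R * (b - a)"
    proof (rule has_contour_integral_bound_part_circlepath[OF has_contour_integral_integral[OF fin]])
      fix x assume "x \<in> path_image (part_circlepath 0 R a b)"
      then obtain t where t: "a \<le> t" "t \<le> b" "x = of_real R * cis t"
        using ab(1) by (auto simp: path_image_part_circlepath' closed_segment_eq_real_ivl)
      then have "norm x = R" using R by (simp add: norm_mult)
      moreover have "Re (x * of_real L) \<le> \<sigma> * L" using re[OF t(1,2)] t(3) by simp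
      ultimately show "norm (f x) \<le> exp (\<sigma> * L) / R\<^sup>2"
        using R by (simp add: f_def norm_divide norm_power divide_right_mono)
    qed (use R ab in auto)
    also have "\<dots> = exp (\<sigma> * L) * ((b - a) / R)" using R by (simp add: power2_eq_square)
    also have "\<dots> \<le> exp (\<sigma> * L) * (2 * pi / T)"
      using R ab assms by (intro mult_left_mono frac_le) auto
    finally show ?thesis by (simp add: mult.commute)
  qed
  have line: "contour_integral (linepath (Complex \<sigma> (-T)) (Complex \<sigma> T)) f
      = contour_integral (part_circlepath 0 R (-\<phi>) \<phi>) f"
  proof (rule convex_contour_integral_path_independent[of "{s. Re s > 0}"])
    show "convex {s. 0 < Re s}" by (rule convex_halfspace_Re_gt)
    show "open {s. 0 < Re s}" by (rule open_halfspace_Re_gt)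
    show "f holomorphic_on {s. 0 < Re s}" unfolding f_def by (intro holomorphic_intros) auto
    show "path_image (linepath (Complex \<sigma> (-T)) (Complex \<sigma> T)) \<subseteq> {s. 0 < Re s}"
    proof -
      have "closed_segment (Complex \<sigma> (-T)) (Complex \<sigma> T) \<subseteq> {s. 0 < Re s}"
        using assms by (intro closed_segment_subset convex_halfspace_Re_gt) auto
      then show ?thesis by simp
    qed
    show "path_image (part_circlepath 0 R (-\<phi>) \<phi>) \<subseteq> {s. 0 < Re s}"
    proof
      fix x assume "x \<in> path_image (part_circlepath 0 R (-\<phi>) \<phi>)"
      then obtain t where t: "- \<phi> \<le> t" "t \<le> \<phi>" "x = of_real R * cis t"
        using \<phi> by (auto simp: path_image_part_circlepath' closed_segment_eq_real_ivl)
      then have "cos t > 0" using \<phi> by (intro cos_gt_zero_pi) auto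
      then show "x \<in> {s. 0 < Re s}" using t R by simp
    qed
    have "Complex \<sigma> T = of_real R * cis \<phi>" "Complex \<sigma> (-T) = of_real R * cis (-\<phi>)"
      using cosp by (simp_all add: complex_eq_iff)
    then show "pathstart (linepath (Complex \<sigma> (-T)) (Complex \<sigma> T)) = pathstart (part_circlepath 0 R (-\<phi>) \<phi>)"
      "pathfinish (linepath (Complex \<sigma> (-T)) (Complex \<sigma> T)) = pathfinish (part_circlepath 0 R (-\<phi>) \<phi>)"
      by (simp_all add: cis_conv_exp)
  qed auto
  show ?thesis
  proof (cases "L \<le> 0")
    case True
    have "norm (contour_integral (part_circlepath 0 R (-\<phi>) \<phi>) f) \<le> 2 * pi * exp (\<sigma> * L) / T"
    proof (rule bound)
      fix t assume t: "- \<phi> \<le> t" "t \<le> \<phi>"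
      have "cos \<phi> \<le> cos \<bar>t\<bar>" using t \<phi> by (intro cos_monotone_0_pi_le) auto
      then have "\<sigma> \<le> R * cos t" using R cosp(1) by (metis cos_abs_real mult_le_cancel_left_pos)
      then show "R * cos t * L \<le> \<sigma> * L" using True by (simp add: mult_right_mono_neg)
    qed (use \<phi> in auto)
    then show ?thesis unfolding f_def[symmetric] line max_absorb1[OF True] by simp
  next
    case False
    \<comment> \<open>Shifting the last piece of the angle range by a period exhibits the arc from -
      \<phi> to \<phi> as the full circle minus the left arc.\<close>
    have per: "integral {2*pi - \<phi>..2*pi} F = integral {-\<phi>..0} F"
    proof -
      have "integral {2*pi - \<phi> - 2*pi..2*pi - 2*pi} (\<lambda>t. F (t + 2*pi)) = integral {2*pi - \<phi>..2*pi} F"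
        by (rule integral_shift_real_ivl)
      moreover have "(\<lambda>t. F (t + 2*pi)) = F" by (simp add: F_def cis.ctr fun_eq_iff)
      ultimately show ?thesis by simp
    qed
    have "integral {0..2*pi} F = integral {0..\<phi>} F + integral {\<phi>..2*pi - \<phi>} F + integral {2*pi - \<phi>..2*pi} F"
    proof -
      have "integral {0..2*pi} F = integral {0..\<phi>} F + integral {\<phi>..2*pi} F"
        using \<phi> by (intro Henstock_Kurzweil_Integration.integral_combine[symmetric] Fint) auto
      also have "integral {\<phi>..2*pi} F = integral {\<phi>..2*pi-\<phi>} F + integral {2*pi - \<phi>..2*pi} F"
        using \<phi> by (intro Henstock_Kurzweil_Integration.integral_combine[symmetric] Fint) auto
      finally show ?thesis by simp
    qed
    moreover have "integral {-\<phi>..\<phi>} F = integral {-\<phi>..0} F + integral {0..\<phi>} F"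
      using \<phi> by (intro Henstock_Kurzweil_Integration.integral_combine[symmetric] Fint) auto
    ultimately have split: "integral {-\<phi>..\<phi>} F = integral {0..2*pi} F - integral {\<phi>..2*pi - \<phi>} F"
      using per by simp
    have full: "integral {0..2*pi} F = 2 * pi * \<i> * of_real L"
    proof -
      have "contour_integral (circlepath 0 R) (\<lambda>u. exp (u * of_real L) / (u - 0)\<^sup>2) = (2 * pi * \<i>) * deriv (\<lambda>u. exp (u * of_real L)) 0"
        using R by (intro Cauchy_contour_integral_circlepath_2) (auto intro!: continuous_intros holomorphic_intros)
      moreover have "deriv (\<lambda>u. exp (u * complex_of_real L)) 0 = of_real L"
        by (rule DERIV_imp_deriv) (auto intro!: derivative_eq_intros)
      ultimately show ?thesis using arc[of 0 "2*pi"] by (simp add: f_def circlepath_def)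
    qed
    have "norm (contour_integral (part_circlepath 0 R \<phi> (2*pi-\<phi>)) f) \<le> 2 * pi * exp (\<sigma> * L) / T"
    proof (rule bound)
      fix t assume t: "\<phi> \<le> t" "t \<le> 2 * pi - \<phi>"
      have "cos t \<le> cos \<phi>"
      proof (cases "t \<le> pi")
        case True then show ?thesis using t \<phi> by (intro cos_monotone_0_pi_le) auto
      next
        case False
        have "cos (2*pi - t) \<le> cos \<phi>" using False t \<phi> by (intro cos_monotone_0_pi_le) auto
        then show ?thesis by (simp add: cos_diff)
      qed
      then have "R * cos t \<le> \<sigma>" using R cosp(1) by (metis mult_le_cancel_left_pos)
      then show "R * cos t * L \<le> \<sigma> * L" using False by (intro mult_right_mono) auto
    qed (use \<phi> in auto)
    then have "norm (integral {\<phi>..2*pi - \<phi>} F) \<le> 2 * pi * exp (\<sigma> * L) / T"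
      using arc[of \<phi> "2*pi - \<phi>"] \<phi> by simp
    moreover have "contour_integral (linepath (Complex \<sigma> (-T)) (Complex \<sigma> T)) f = 2 * pi * \<i> * of_real L - integral {\<phi>..2*pi - \<phi>} F"
      using line arc[of "-\<phi>" \<phi>] \<phi> split full by simp
    ultimately show ?thesis using False by (simp add: f_def)
  qed
qed

section \<open>Dirichlet series with small partial sums\<close>

text \<open>The power x^(-s) for positive x, entire in s; the real logarithm avoids any choice of
  branch.\<close>

definition neg_cpow :: "real \<Rightarrow> complex \<Rightarrow> complex" where
  "neg_cpow x s = exp (- s * of_real (ln x))"

lemma norm_neg_cpow: "x > 0 \<Longrightarrow> norm (neg_cpow x s) = x powr (- Re s)"
  by (simp add: neg_cpow_def powr_def)

lemma neg_cpow_mult: "x > 0 \<Longrightarrow> y > 0 \<Longrightarrow> neg_cpow (x * y) s = neg_cpow x s * neg_cpow y s"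
  by (simp add: neg_cpow_def ln_mult exp_add[symmetric] ring_distribs)

lemma neg_cpow_1 [simp]: "neg_cpow 1 s = 1"
  by (simp add: neg_cpow_def)

lemma neg_cpow_power: "x > 0 \<Longrightarrow> neg_cpow (x ^ k) s = neg_cpow x s ^ k"
  by (induction k) (auto simp: neg_cpow_mult)

lemma neg_cpow_of_real: "x > 0 \<Longrightarrow> neg_cpow x (of_real \<sigma>) = of_real (x powr (- \<sigma>))"
  by (simp add: neg_cpow_def powr_def flip: exp_of_real)

lemma has_field_derivative_neg_cpow: "(neg_cpow x has_field_derivative (- of_real (ln x) * neg_cpow x s)) (at s within A)"
  unfolding neg_cpow_def[abs_def] by (auto intro!: derivative_eq_intros)

lemma holomorphic_neg_cpow [holomorphic_intros]: "neg_cpow x holomorphic_on A"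
  unfolding neg_cpow_def[abs_def] by (intro holomorphic_intros)

lemma has_vector_derivative_neg_cpow:
  assumes "x > 0" shows "((\<lambda>x. neg_cpow x s) has_vector_derivative (- s * neg_cpow x (s + 1))) (at x within A)"
proof -
  have 1: "((\<lambda>x. - s * of_real (ln x)) has_vector_derivative (- s * of_real (1 / x))) (at x within A)"
    using assms
    by (auto intro!: derivative_eq_intros has_vector_derivative_mult_right has_vector_derivative_of_real
        simp flip: has_real_derivative_iff_has_vector_derivative)
  have "((exp \<circ> (\<lambda>x. - s * of_real (ln x))) has_vector_derivative ((- s * of_real (1 / x)) * exp (- s * of_real (ln x)))) (at x within A)"
    by (rule field_vector_diff_chain_within[OF 1]) (auto intro!: derivative_eq_intros)
  moreover have "neg_cpow x (s + 1) = neg_cpow x s * of_real (1 / x)"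
    using assms by (simp add: neg_cpow_def ring_distribs exp_diff exp_of_real)
  ultimately show ?thesis by (simp add: neg_cpow_def o_def mult_ac)
qed

lemma vector_derivative_norm_bound:
  fixes f :: "real \<Rightarrow> complex"
  assumes "a \<le> b" and d: "\<And>x. a \<le> x \<Longrightarrow> x \<le> b \<Longrightarrow> (f has_vector_derivative f' x) (at x within {a..b})"
    and B: "\<And>x. a \<le> x \<Longrightarrow> x \<le> b \<Longrightarrow> norm (f' x) \<le> B"
  shows "norm (f b - f a) \<le> B * (b - a)"
proof -
  have "norm (f b - f a) \<le> B * norm (b - a)"
  proof (rule differentiable_bound[of "{a..b}" f "\<lambda>x h. h *\<^sub>R f' x"])
    fix x assume x: "x \<in> {a..b}"
    then show "(f has_derivative (\<lambda>h. h *\<^sub>R f' x)) (at x within {a..b})"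
      using d[of x] by (simp add: has_vector_derivative_def)
    show "onorm (\<lambda>h. h *\<^sub>R f' x) \<le> B"
      using B[of x] x by (intro onorm_le) (auto simp: mult.commute[of B] intro: mult_left_mono)
  qed (use assms in auto)
  then show ?thesis using assms by simp
qed

lemma neg_cpow_diff_le:
  assumes "a > 0" "a \<le> b" "Re s \<ge> - 1"
  shows "norm (neg_cpow a s - neg_cpow b s) \<le> norm s * a powr (- Re s - 1) * (b - a)"
proof -
  have "norm (neg_cpow b s - neg_cpow a s) \<le> norm s * a powr (- Re s - 1) * (b - a)"
  proof (rule vector_derivative_norm_bound[OF assms(2)])
    fix x assume x: "a \<le> x" "x \<le> b"
    show "((\<lambda>x. neg_cpow x s) has_vector_derivative - s * neg_cpow x (s + 1)) (at x within {a..b})"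
      using x assms by (intro has_vector_derivative_neg_cpow) auto
    have "x powr (- Re s - 1) \<le> a powr (- Re s - 1)"
      using x assms by (intro powr_mono2') auto
    then show "norm (- s * neg_cpow x (s + 1)) \<le> norm s * a powr (- Re s - 1)"
      using x assms by (simp add: norm_mult norm_neg_cpow mult_left_mono)
  qed
  then show ?thesis by (simp add: norm_minus_commute)
qed

lemma holomorphic_on_suminf:
  assumes op: "open S" and hol: "\<And>n. f n holomorphic_on S"
    and bound: "\<And>x. x \<in> S \<Longrightarrow> \<exists>d h. 0 < d \<and> summable h \<and> (\<forall>n. \<forall>y\<in>ball x d. norm (f n y) \<le> h n)"
  shows "(\<lambda>x. \<Sum>n. f n x) holomorphic_on S"
proof -
  have "\<exists>g g'. \<forall>x\<in>S. ((\<lambda>n. f n x) sums g x) \<and> ((\<lambda>n. deriv (f n) x) sums g' x) \<and> (g has_field_derivative g' x) (at x)"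
  proof (rule series_and_derivative_comparison_local[OF op])
    show "(f n has_field_derivative deriv (f n) x) (at x)" if "x \<in> S" for n x
      by (rule holomorphic_derivI[OF hol op that])
    show "\<exists>d h. 0 < d \<and> summable h \<and> (\<forall>\<^sub>F n in sequentially. \<forall>y\<in>ball x d \<inter> S. norm (f n y) \<le> h n)"
      if x: "x \<in> S" for x
    proof -
      obtain d h where "0 < d" "summable h" "\<forall>n. \<forall>y\<in>ball x d. norm (f n y) \<le> h n" using bound[OF x] by blast
      then show ?thesis by (intro exI[of _ d] exI[of _ h]) auto
    qed
  qed
  then obtain g g' where g: "\<And>x. x \<in> S \<Longrightarrow> (\<lambda>n. f n x) sums g x"
    and g': "\<And>x. x \<in> S \<Longrightarrow> (g has_field_derivative g' x) (at x)"
    by blast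
  have "g holomorphic_on S" using g' op by (auto simp: holomorphic_on_open)
  then show ?thesis by (rule holomorphic_transform) (simp add: sums_unique[OF g])
qed

definition cont_term :: "(nat \<Rightarrow> complex) \<Rightarrow> nat \<Rightarrow> complex \<Rightarrow> complex" where
  "cont_term c n s = (\<Sum>k\<le>n. c k) * (neg_cpow (real n + 1) s - neg_cpow (real n + 2) s)"

definition cont_series :: "(nat \<Rightarrow> complex) \<Rightarrow> complex \<Rightarrow> complex" where
  "cont_series c s = (\<Sum>n. cont_term c n s)"

text \<open>The exponent -9/8 is -7/8 - 1/4, so this constant serves the half plane Re s \<ge> 7/8,
  which contains every disc of radius 1/8 about a point to the right of 1.\<close>

definition decay_sum :: real where
  "decay_sum = (\<Sum>n. (real n + 1) powr (- 9/8))"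

lemma filterlim_real_Suc: "filterlim (\<lambda>n. real n + 1) at_top sequentially"
  by (rule filterlim_at_top_mono[OF filterlim_real_sequentially]) auto

lemma summable_shift_powr: "p < - 1 \<Longrightarrow> summable (\<lambda>n. (real n + 1) powr p)"
  using summable_Suc_iff[of "\<lambda>n. real n powr p"] summable_real_powr_iff[of p] by (simp add: add.commute)

lemma decay_sum_nonneg: "decay_sum \<ge> 0"
  unfolding decay_sum_def by (intro suminf_nonneg summable_shift_powr) auto

text \<open>The coefficient \<open>c n\<close> belongs to \<open>(n + 1)^-s\<close>; partial summation continues the series to \<open>Re s > 3/4\<close>.\<close>
locale small_partial_sums =
  fixes c :: "nat \<Rightarrow> complex" and B :: real
  assumes bound: "norm (\<Sum>k\<le>n. c k) \<le> B * (real n + 1) powr (3/4)"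
begin

lemma B_nonneg: "B \<ge> 0"
  using bound[of 0] by (simp add: order_trans[OF norm_ge_zero])

lemma cont_term_le:
  assumes "Re s \<ge> 0" shows "norm (cont_term c n s) \<le> B * norm s * (real n + 1) powr (- Re s - 1/4)"
proof -
  have "norm (cont_term c n s) \<le> (B * (real n + 1) powr (3/4)) * (norm s * (real n + 1) powr (- Re s - 1) * ((real n + 2) - (real n + 1)))"
    unfolding cont_term_def norm_mult
    using bound B_nonneg assms by (intro mult_mono neg_cpow_diff_le) auto
  also have "\<dots> = B * norm s * ((real n + 1) powr (3/4) * (real n + 1) powr (- Re s - 1))" by simp
  also have "(real n + 1) powr (3/4) * (real n + 1) powr (- Re s - 1) = (real n + 1) powr (- Re s - 1/4)"
    unfolding powr_add[symmetric] by (rule arg_cong[where f="\<lambda>e. _ powr e"]) simp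
  finally show ?thesis .
qed

lemma summable_cont_term:
  assumes "Re s > 3/4" shows "summable (\<lambda>n. cont_term c n s)"
proof (rule summable_comparison_test)
  show "\<exists>N. \<forall>n\<ge>N. norm (cont_term c n s) \<le> B * norm s * (real n + 1) powr (- Re s - 1/4)"
    using cont_term_le[of s] assms by auto
  show "summable (\<lambda>n. B * norm s * (real n + 1) powr (- Re s - 1/4))"
    using assms by (intro summable_mult summable_shift_powr) auto
qed

lemma cont_series_le:
  assumes "Re s \<ge> 7/8" shows "norm (cont_series c s) \<le> B * norm s * decay_sum"
proof -
  have s: "summable (\<lambda>n. B * norm s * (real n + 1) powr (- 9/8))"
    by (intro summable_mult summable_shift_powr) auto
  have "norm (cont_series c s) \<le> (\<Sum>n. B * norm s * (real n + 1) powr (- 9/8))"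
    unfolding cont_series_def
  proof (rule norm_suminf_le[OF _ s])
    fix n
    have "norm (cont_term c n s) \<le> B * norm s * (real n + 1) powr (- Re s - 1/4)"
      using assms by (intro cont_term_le) auto
    also have "\<dots> \<le> B * norm s * (real n + 1) powr (- 9/8)"
      using assms B_nonneg by (intro mult_left_mono powr_mono) auto
    finally show "norm (cont_term c n s) \<le> B * norm s * (real n + 1) powr (- 9/8)" .
  qed
  also have "\<dots> = B * norm s * decay_sum"
    unfolding decay_sum_def by (intro suminf_mult summable_shift_powr) auto
  finally show ?thesis .
qed

lemma cont_series_holomorphic: "cont_series c holomorphic_on {s. Re s > 3/4}"
proof -
  let ?S = "{s. Re s > 3/4}"
  have op: "open ?S" by (rule open_halfspace_Re_gt)
  have hol: "cont_term c n holomorphic_on ?S" for n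
    unfolding cont_term_def[abs_def] by (intro holomorphic_intros)
  show ?thesis
    unfolding cont_series_def[abs_def]
  proof (rule holomorphic_on_suminf[OF op hol])
    fix x assume x: "x \<in> ?S"
    define d where "d = (Re x - 3/4) / 2"
    have d: "d > 0" using x by (simp add: d_def)
    define h where "h n = B * (norm x + d) * (real n + 1) powr (- 1 - d)" for n
    have "summable h" unfolding h_def using d by (intro summable_mult summable_shift_powr) auto
    moreover have "norm (cont_term c n y) \<le> h n" if y: "y \<in> ball x d" for n y
    proof -
      have "\<bar>Re x - Re y\<bar> < d" using y abs_Re_le_cmod[of "x - y"] by (simp add: dist_norm)
      then have Rey: "Re y \<ge> 3/4 + d" using x unfolding d_def by (auto simp: field_simps abs_if split: if_splits)
      have ny: "norm y \<le> norm x + d" using y norm_triangle_ineq2[of y x] by (simp add: dist_norm norm_minus_commute)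
      have "norm (cont_term c n y) \<le> B * norm y * (real n + 1) powr (- Re y - 1/4)"
        using Rey d by (intro cont_term_le) auto
      also have "\<dots> \<le> B * (norm x + d) * (real n + 1) powr (- 1 - d)"
        using Rey ny B_nonneg d by (intro mult_mono powr_mono) auto
      finally show ?thesis by (simp add: h_def)
    qed
    ultimately show "\<exists>d h. 0 < d \<and> summable h \<and> (\<forall>n. \<forall>y\<in>ball x d. norm (cont_term c n y) \<le> h n)"
      using d by (intro exI[of _ d] exI[of _ h]) auto
  qed
qed

text \<open>Summation by parts leaves the boundary term A(N) (N + 2)^(-s), of size O(N^(3/4 - Re
  s)), which tends to 0.\<close>

lemma cont_series_sums:
  assumes "Re s > 3/4" shows "(\<lambda>n. c n * neg_cpow (real n + 1) s) sums cont_series c s"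
proof -
  define A where "A n = (\<Sum>k\<le>n. c k)" for n
  define p where "p n = neg_cpow (real n + 1) s" for n
  have abel: "(\<Sum>k\<le>N. c k * p k) = (\<Sum>k\<le>N. cont_term c k s) + A N * p (Suc N)" for N
  proof (induction N)
    case 0 then show ?case by (simp add: cont_term_def A_def p_def algebra_simps)
  next
    case (Suc N)
    have "(\<Sum>k\<le>Suc N. c k * p k) = (\<Sum>k\<le>N. cont_term c k s) + (A N * p (Suc N) + c (Suc N) * p (Suc N))" using Suc by simp
    also have "A N * p (Suc N) + c (Suc N) * p (Suc N) = A (Suc N) * p (Suc N)" by (simp add: A_def algebra_simps)
    finally show ?case by (simp add: cont_term_def A_def p_def algebra_simps)
  qed
  have lim0: "(\<lambda>N. A N * p (Suc N)) \<longlonglongrightarrow> 0"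
  proof (rule Lim_null_comparison)
    show "\<forall>\<^sub>F N in sequentially. norm (A N * p (Suc N)) \<le> B * (real N + 1) powr (3/4 - Re s)"
    proof (intro always_eventually allI)
      fix N
      have "(real N + 2) powr (- Re s) \<le> (real N + 1) powr (- Re s)" using assms by (intro powr_mono2') auto
      then have "norm (A N * p (Suc N)) \<le> (B * (real N + 1) powr (3/4)) * (real N + 1) powr (- Re s)"
        unfolding norm_mult using bound[of N] B_nonneg
        by (intro mult_mono) (auto simp: A_def p_def norm_neg_cpow add.commute)
      then show "norm (A N * p (Suc N)) \<le> B * (real N + 1) powr (3/4 - Re s)"
        by (simp flip: powr_add add: mult.assoc)
    qed
    have "(\<lambda>N. (real N + 1) powr (3/4 - Re s)) \<longlonglongrightarrow> 0"
      by (rule tendsto_neg_powr) (use assms filterlim_real_Suc in auto)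
    then show "(\<lambda>N. B * (real N + 1) powr (3/4 - Re s)) \<longlonglongrightarrow> 0" by (rule tendsto_mult_right_zero)
  qed
  have "(\<lambda>N. \<Sum>k\<le>N. cont_term c k s) \<longlonglongrightarrow> cont_series c s"
    using summable_sums[OF summable_cont_term[OF assms]] unfolding sums_def_le cont_series_def .
  from tendsto_add[OF this lim0] show ?thesis
    unfolding sums_def_le p_def[symmetric] abel by simp
qed

end

text \<open>\<open>(s - 1) \<zeta>(s)\<close>, obtained by comparing \<open>(n + 1)^-s\<close> with the integral of \<open>u^-s\<close> over \<open>[n + 1, n + 2]\<close>.\<close>
definition zeta_term :: "nat \<Rightarrow> complex \<Rightarrow> complex" where
  "zeta_term n s = (s - 1) * neg_cpow (real n + 1) s - neg_cpow (real n + 1) (s - 1) + neg_cpow (real n + 2) (s - 1)"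

definition zeta_reg :: "complex \<Rightarrow> complex" where
  "zeta_reg s = 1 + (\<Sum>n. zeta_term n s)"

text \<open>\<open>zeta_term n s\<close> is the increment over [n + 1, n + 2] of a function with
  derivative (s - 1) ((n + 1)^(-s) - x^(-s)), and the difference of powers gains one power of
  n.\<close>

lemma zeta_term_le:
  assumes "Re s > 0" shows "norm (zeta_term n s) \<le> norm (s - 1) * norm s * (real n + 1) powr (- Re s - 1)"
proof -
  let ?a = "real n + 1"
  define \<phi> where "\<phi> x = neg_cpow x (s - 1) + of_real x * ((s - 1) * neg_cpow ?a s)" for x
  have "norm (\<phi> (?a + 1) - \<phi> ?a) \<le> (norm (s - 1) * norm s * ?a powr (- Re s - 1)) * ((?a + 1) - ?a)"
  proof (rule vector_derivative_norm_bound)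
    fix x assume x: "?a \<le> x" "x \<le> ?a + 1"
    have "(\<phi> has_vector_derivative (- (s - 1) * neg_cpow x ((s - 1) + 1) + (s - 1) * neg_cpow ?a s)) (at x within {?a..?a+1})"
      unfolding \<phi>_def using x by (auto intro!: derivative_eq_intros has_vector_derivative_neg_cpow)
    moreover have "- (s - 1) * neg_cpow x ((s - 1) + 1) + (s - 1) * neg_cpow ?a s = (s - 1) * (neg_cpow ?a s - neg_cpow x s)"
      by (simp add: algebra_simps)
    ultimately show "(\<phi> has_vector_derivative ((s - 1) * (neg_cpow ?a s - neg_cpow x s))) (at x within {?a..?a+1})" by simp
    have "norm (neg_cpow ?a s - neg_cpow x s) \<le> norm s * ?a powr (- Re s - 1) * (x - ?a)"
      using x assms by (intro neg_cpow_diff_le) auto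
    also have "\<dots> \<le> norm s * ?a powr (- Re s - 1) * 1" using x by (intro mult_left_mono) auto
    finally show "norm ((s - 1) * (neg_cpow ?a s - neg_cpow x s)) \<le> norm (s - 1) * norm s * ?a powr (- Re s - 1)"
      by (simp add: norm_mult mult.assoc mult_left_mono)
  qed auto
  moreover have "\<phi> (?a + 1) - \<phi> ?a = zeta_term n s" by (simp add: \<phi>_def zeta_term_def algebra_simps)
  ultimately show ?thesis by simp
qed

lemma zeta_reg_holomorphic: "zeta_reg holomorphic_on {s. Re s > 0}"
proof -
  let ?S = "{s. Re s > 0}"
  have op: "open ?S" by (rule open_halfspace_Re_gt)
  have hol: "zeta_term n holomorphic_on ?S" for n
    unfolding zeta_term_def[abs_def] by (intro holomorphic_intros holomorphic_on_compose[of "\<lambda>s. s - 1" _ "neg_cpow x" for x, unfolded o_def])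
  have "(\<lambda>s. \<Sum>n. zeta_term n s) holomorphic_on ?S"
  proof (rule holomorphic_on_suminf[OF op hol])
    fix x assume x: "x \<in> ?S"
    define d where "d = Re x / 2"
    have d: "d > 0" using x by (simp add: d_def)
    define h where "h n = (norm x + d + 1) * (norm x + d) * (real n + 1) powr (- 1 - d)" for n
    have "summable h" unfolding h_def using d by (intro summable_mult summable_shift_powr) auto
    moreover have "norm (zeta_term n y) \<le> h n" if y: "y \<in> ball x d" for n y
    proof -
      have "\<bar>Re x - Re y\<bar> < d" using y abs_Re_le_cmod[of "x - y"] by (simp add: dist_norm)
      then have Rey: "Re y \<ge> d" using x unfolding d_def by (auto simp: field_simps abs_if split: if_splits)
      have ny: "norm y \<le> norm x + d" using y norm_triangle_ineq2[of y x] by (simp add: dist_norm norm_minus_commute)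
      have ny1: "norm (y - 1) \<le> norm x + d + 1" using norm_triangle_ineq4[of y 1] ny by simp
      have "norm (zeta_term n y) \<le> norm (y - 1) * norm y * (real n + 1) powr (- Re y - 1)"
        using Rey d by (intro zeta_term_le) auto
      also have "\<dots> \<le> (norm x + d + 1) * (norm x + d) * (real n + 1) powr (- 1 - d)"
        using Rey ny ny1 d by (intro mult_mono powr_mono) auto
      finally show ?thesis by (simp add: h_def)
    qed
    ultimately show "\<exists>d h. 0 < d \<and> summable h \<and> (\<forall>n. \<forall>y\<in>ball x d. norm (zeta_term n y) \<le> h n)"
      using d by (intro exI[of _ d] exI[of _ h]) auto
  qed
  then show ?thesis unfolding zeta_reg_def[abs_def] by (intro holomorphic_intros)
qed

lemma zeta_reg_1: "zeta_reg 1 = 1"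
  by (simp add: zeta_reg_def zeta_term_def neg_cpow_def)

lemma zeta_reg_sums:
  assumes "Re s > 1" shows "(\<lambda>n. (s - 1) * neg_cpow (real n + 1) s) sums zeta_reg s"
proof -
  define p where "p n = neg_cpow (real n + 1) (s - 1)" for n
  have sz: "summable (\<lambda>n. zeta_term n s)"
  proof (rule summable_comparison_test)
    show "\<exists>N. \<forall>n\<ge>N. norm (zeta_term n s) \<le> norm (s - 1) * norm s * (real n + 1) powr (- Re s - 1)"
      using zeta_term_le[of s] assms by auto
    show "summable (\<lambda>n. norm (s - 1) * norm s * (real n + 1) powr (- Re s - 1))"
      using assms by (intro summable_mult summable_shift_powr) auto
  qed
  have "p \<longlonglongrightarrow> 0"
  proof (rule Lim_null_comparison)
    show "\<forall>\<^sub>F N in sequentially. norm (p N) \<le> (real N + 1) powr (1 - Re s)"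
      by (simp add: p_def norm_neg_cpow)
    show "(\<lambda>N. (real N + 1) powr (1 - Re s)) \<longlonglongrightarrow> 0"
      by (rule tendsto_neg_powr) (use assms filterlim_real_Suc in auto)
  qed
  from telescope_sums'[OF this] have "(\<lambda>n. p n - p (Suc n)) sums 1" by (simp add: p_def)
  from sums_add[OF this summable_sums[OF sz]]
  have "(\<lambda>n. p n - p (Suc n) + zeta_term n s) sums zeta_reg s" by (simp add: zeta_reg_def)
  moreover have "p n - p (Suc n) + zeta_term n s = (s - 1) * neg_cpow (real n + 1) s" for n
    by (simp add: p_def zeta_term_def add.commute)
  ultimately show ?thesis by simp
qed

section \<open>The Hecke series\<close>

definition Eis0 :: "complex set" where "Eis0 = Eis - {0}"
definition sq_norm :: "complex \<Rightarrow> real" where "sq_norm \<mu> = (cmod \<mu>)\<^sup>2"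

lemma sq_norm_mult: "sq_norm (\<mu> * \<nu>) = sq_norm \<mu> * sq_norm \<nu>" by (simp add: sq_norm_def norm_mult power_mult_distrib)
lemma sq_norm_power: "sq_norm (\<mu> ^ k) = sq_norm \<mu> ^ k" by (simp add: sq_norm_def norm_power power_mult[symmetric] mult.commute)
lemma sq_norm_pos: "\<mu> \<noteq> 0 \<Longrightarrow> sq_norm \<mu> > 0" by (simp add: sq_norm_def)
lemma sq_norm_ge_1: "\<mu> \<in> Eis0 \<Longrightarrow> sq_norm \<mu> \<ge> 1"
  using Eis_norm_ge_1[of \<mu>] by (simp add: sq_norm_def Eis0_def)
lemma sq_norm_nat: assumes "\<mu> \<in> Eis0" obtains k where "sq_norm \<mu> = real (Suc k)"
proof -
  obtain n :: nat where n: "sq_norm \<mu> = real n" using Eis_norm_nat[of \<mu>] assms by (auto simp: Eis0_def sq_norm_def)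
  with sq_norm_ge_1[OF assms] have "n \<ge> 1" by simp
  then show ?thesis using n that[of "n - 1"] by simp
qed

definition Eis_upto :: "nat \<Rightarrow> complex set" where "Eis_upto N = {\<mu>\<in>Eis0. sq_norm \<mu> \<le> real N}"
text \<open>Index k stands for norm k + 1: \<open>Eis_sphere 0\<close> is the set of the six units,
  and many spheres are empty.\<close>

definition Eis_sphere :: "nat \<Rightarrow> complex set" where "Eis_sphere k = {\<mu>\<in>Eis0. sq_norm \<mu> = real (Suc k)}"

lemma finite_Eis_upto [simp]: "finite (Eis_upto N)"
proof -
  have "Eis_upto N \<subseteq> {\<mu>\<in>Eis. cmod \<mu> \<le> sqrt (real N)}"
    by (auto simp: Eis_upto_def Eis0_def sq_norm_def intro: real_le_rsqrt)
  then show ?thesis using finite_Eis_bounded finite_subset by blast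
qed

lemma Eis_sphere_subset: "Eis_sphere k \<subseteq> Eis_upto (Suc k)" by (auto simp: Eis_sphere_def Eis_upto_def)
lemma finite_Eis_sphere [simp]: "finite (Eis_sphere k)" using Eis_sphere_subset finite_Eis_upto finite_subset by blast

lemma sum_Eis_upto: "(\<Sum>\<mu>\<in>Eis_upto N. f \<mu>) = (\<Sum>k<N. \<Sum>\<mu>\<in>Eis_sphere k. f \<mu>)"
proof (induction N)
  case 0
  have "Eis_upto 0 = {}" using sq_norm_ge_1 by (fastforce simp: Eis_upto_def)
  then show ?case by simp
next
  case (Suc N)
  have "Eis_upto (Suc N) = Eis_upto N \<union> Eis_sphere N"
  proof (intro equalityI subsetI)
    fix \<mu> assume m: "\<mu> \<in> Eis_upto (Suc N)"
    then obtain k where "sq_norm \<mu> = real (Suc k)" using sq_norm_nat[of \<mu>] by (auto simp: Eis_upto_def)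
    with m show "\<mu> \<in> Eis_upto N \<union> Eis_sphere N" by (auto simp: Eis_upto_def Eis_sphere_def)
  qed (auto simp: Eis_upto_def Eis_sphere_def)
  moreover have "Eis_upto N \<inter> Eis_sphere N = {}" by (auto simp: Eis_upto_def Eis_sphere_def)
  ultimately show ?case using Suc by (simp add: sum.union_disjoint)
qed

definition hecke_coeff :: "int \<Rightarrow> nat \<Rightarrow> complex" where "hecke_coeff a k = (\<Sum>\<mu>\<in>Eis_sphere k. hecke_ang a \<mu>)"

lemma hecke_coeff_partial_sum:
  "(\<Sum>k\<le>n. hecke_coeff a k) = (\<Sum>\<mu>\<in>{\<mu>\<in>Eis. cmod \<mu> \<le> sqrt (real n + 1)}. hecke_ang a \<mu>) - hecke_ang a 0"
proof -
  have "{\<mu>\<in>Eis. cmod \<mu> \<le> sqrt (real n + 1)} = insert 0 (Eis_upto (Suc n))"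
  proof -
    have iff: "cmod \<mu> \<le> sqrt (real n + 1) \<longleftrightarrow> sq_norm \<mu> \<le> real (Suc n)" for \<mu>
    proof -
      have "cmod \<mu> = sqrt (sq_norm \<mu>)" by (simp add: sq_norm_def)
      then show ?thesis by (simp add: add.commute)
    qed
    show ?thesis
    proof (rule set_eqI)
      fix \<mu> show "\<mu> \<in> {\<mu>\<in>Eis. cmod \<mu> \<le> sqrt (real n + 1)} \<longleftrightarrow> \<mu> \<in> insert 0 (Eis_upto (Suc n))"
        using iff[of \<mu>] by (cases "\<mu> = 0") (auto simp: Eis_upto_def Eis0_def)
    qed
  qed
  moreover have "0 \<notin> Eis_upto (Suc n)" by (simp add: Eis_upto_def Eis0_def)
  ultimately have "(\<Sum>\<mu>\<in>{\<mu>\<in>Eis. cmod \<mu> \<le> sqrt (real n + 1)}. hecke_ang a \<mu>) = hecke_ang a 0 + (\<Sum>\<mu>\<in>Eis_upto (Suc n). hecke_ang a \<mu>)" by simp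
  then show ?thesis by (simp add: sum_Eis_upto hecke_coeff_def lessThan_Suc_atMost)
qed

lemma sqrt_mult_sqrt_sqrt: "x > 0 \<Longrightarrow> sqrt x * sqrt (sqrt x) = x powr (3/4)"
  by (simp add: powr_half_sqrt[symmetric] powr_powr powr_add[symmetric])

definition lattice_const :: real where "lattice_const = 58 * pi / eis_covol"

lemma lattice_const_pos: "lattice_const > 0" using eis_covol_pos by (simp add: lattice_const_def)

lemma small_partial_sums_hecke_coeff:
  assumes "a \<noteq> 0" shows "small_partial_sums (hecke_coeff a) (lattice_const * \<bar>of_int a\<bar>)"
proof
  fix n
  let ?S = "\<Sum>\<mu>\<in>{\<mu>\<in>Eis. cmod \<mu> \<le> sqrt (real n + 1)}. hecke_ang a \<mu>"
  \<comment> \<open>The disc contains the origin, but its term vanishes for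
    \<open>a \<noteq> 0\<close>.\<close>
  have "hecke_ang a 0 = 0" using assms by (simp add: hecke_ang_def)
  then have "norm (\<Sum>k\<le>n. hecke_coeff a k) = norm ?S" by (simp add: hecke_coeff_partial_sum)
  moreover have "norm ?S * eis_covol \<le> 58 * pi * \<bar>of_int a\<bar> * (real n + 1) powr (3/4)"
    using norm_hecke_ang_sum_le[OF assms, of "sqrt (real n + 1)"] sqrt_mult_sqrt_sqrt[of "real n + 1"] by simp
  ultimately show "norm (\<Sum>k\<le>n. hecke_coeff a k) \<le> lattice_const * \<bar>of_int a\<bar> * (real n + 1) powr (3/4)"
    using eis_covol_pos by (simp add: lattice_const_def field_simps)
qed

definition eis_density :: real where "eis_density = pi / eis_covol"
lemma eis_density_pos: "eis_density > 0" using eis_covol_pos by (simp add: eis_density_def)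

text \<open>The extra 1 pays for the origin, whose term equals 1 when \<open>a = 0\<close> and which
  the Dirichlet series omits.\<close>

definition zeta_const :: real where "zeta_const = 34 * pi / eis_covol + 1"

lemma small_partial_sums_coef0: "small_partial_sums (\<lambda>k. hecke_coeff 0 k - of_real eis_density) zeta_const"
proof
  fix n
  let ?A = "{\<mu>\<in>Eis. cmod \<mu> \<le> sqrt (real n + 1)}"
  define X where "X = (real n + 1) powr (3/4)"
  have X1: "X \<ge> 1" unfolding X_def by (rule ge_one_powr_ge_zero) auto
  have "(\<Sum>k\<le>n. hecke_coeff 0 k - of_real eis_density) = of_real (real (card ?A) - 1 - (real n + 1) * eis_density)"
    unfolding sum_subtractf hecke_coeff_partial_sum by (simp add: hecke_ang_def algebra_simps)
  then have "norm (\<Sum>k\<le>n. hecke_coeff 0 k - of_real eis_density) = \<bar>real (card ?A) - 1 - (real n + 1) * eis_density\<bar>"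
    by (simp only: norm_of_real)
  also have "\<dots> \<le> \<bar>real (card ?A) - (real n + 1) * eis_density\<bar> + 1" by linarith
  also have "\<dots> \<le> zeta_const * X"
  proof -
    have "(real (card ?A) - (real n + 1) * eis_density) * eis_covol = real (card ?A) * eis_covol - pi * (sqrt (real n + 1))\<^sup>2"
      using eis_covol_pos by (simp add: eis_density_def left_diff_distrib)
    moreover have "\<bar>real (card ?A) - (real n + 1) * eis_density\<bar> * eis_covol = \<bar>(real (card ?A) - (real n + 1) * eis_density) * eis_covol\<bar>"
      using eis_covol_pos by (simp add: abs_mult)
    ultimately have "\<bar>real (card ?A) - (real n + 1) * eis_density\<bar> * eis_covol = \<bar>real (card ?A) * eis_covol - pi * (sqrt (real n + 1))\<^sup>2\<bar>"
      by presburger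
    also have "\<dots> \<le> 34 * pi * X"
      using card_Eis_disc[of "sqrt (real n + 1)"] sqrt_mult_sqrt_sqrt[of "real n + 1"] by (simp add: X_def)
    finally have "\<bar>real (card ?A) - (real n + 1) * eis_density\<bar> \<le> 34 * pi / eis_covol * X"
      using eis_covol_pos by (simp add: field_simps)
    then show ?thesis using X1 by (simp add: zeta_const_def distrib_right)
  qed
  finally show "norm (\<Sum>k\<le>n. hecke_coeff 0 k - of_real eis_density) \<le> zeta_const * (real n + 1) powr (3/4)"
    by (simp add: X_def)
qed

text \<open>Bridge from unordered sums over lattice points, in which double sums can be rearranged,
  to series ordered by the norm, to which partial summation applies.\<close>

lemma filterlim_Eis_upto: "filterlim Eis_upto (finite_subsets_at_top Eis0) sequentially"
  unfolding filterlim_iff eventually_finite_subsets_at_top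
proof safe
  fix P X assume X: "finite X" "X \<subseteq> Eis0" and P: "\<forall>Y. finite Y \<and> X \<subseteq> Y \<and> Y \<subseteq> Eis0 \<longrightarrow> P Y"
  define M where "M = (\<Sum>\<mu>\<in>X. sq_norm \<mu>)"
  have M: "sq_norm \<mu> \<le> M" if "\<mu> \<in> X" for \<mu>
    unfolding M_def using X that by (intro member_le_sum) (auto simp: sq_norm_def)
  show "\<forall>\<^sub>F n in sequentially. P (Eis_upto n)"
    using eventually_ge_at_top[of "nat \<lceil>M\<rceil>"]
  proof eventually_elim
    case (elim n)
    then have "M \<le> real n" by linarith
    then have "X \<subseteq> Eis_upto n" using M X by (force simp: Eis_upto_def)
    moreover have "Eis_upto n \<subseteq> Eis0" by (auto simp: Eis_upto_def)
    ultimately show ?case using P by simp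
  qed
qed

lemma sum_Eis_sphere_neg_cpow: "(\<Sum>\<mu>\<in>Eis_sphere k. hecke_ang a \<mu> * neg_cpow (sq_norm \<mu>) s) = hecke_coeff a k * neg_cpow (real k + 1) s"
  unfolding hecke_coeff_def sum_distrib_right by (intro sum.cong) (auto simp: Eis_sphere_def add.commute)

text \<open>The mean density is split off the coefficients. What remains has small partial sums; the
  constant part is a multiple of the ordinary zeta series and carries the pole at 1.\<close>

lemma coef0_sums:
  assumes "Re s > 1"
  shows "(\<lambda>k. hecke_coeff 0 k * neg_cpow (real k + 1) s) sums (cont_series (\<lambda>k. hecke_coeff 0 k - of_real eis_density) s + of_real eis_density * zeta_reg s / (s - 1))"
proof -
  interpret small_partial_sums "\<lambda>k. hecke_coeff 0 k - of_real eis_density" zeta_const by (rule small_partial_sums_coef0)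
  have s1: "s \<noteq> 1" using assms by auto
  have "(\<lambda>k. of_real eis_density / (s - 1) * ((s - 1) * neg_cpow (real k + 1) s)) sums (of_real eis_density / (s - 1) * zeta_reg s)"
    by (intro sums_mult zeta_reg_sums assms)
  moreover have "(\<lambda>k. (hecke_coeff 0 k - of_real eis_density) * neg_cpow (real k + 1) s) sums cont_series (\<lambda>k. hecke_coeff 0 k - of_real eis_density) s"
    using assms by (intro cont_series_sums) auto
  ultimately have "(\<lambda>k. (hecke_coeff 0 k - of_real eis_density) * neg_cpow (real k + 1) s + of_real eis_density / (s - 1) * ((s - 1) * neg_cpow (real k + 1) s))
     sums (cont_series (\<lambda>k. hecke_coeff 0 k - of_real eis_density) s + of_real eis_density / (s - 1) * zeta_reg s)"
    by (rule sums_add[rotated])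
  moreover have "(hecke_coeff 0 k - of_real eis_density) * neg_cpow (real k + 1) s + of_real eis_density / (s - 1) * ((s - 1) * neg_cpow (real k + 1) s)
      = hecke_coeff 0 k * neg_cpow (real k + 1) s" for k
  proof -
    have "of_real eis_density / (s - 1) * ((s - 1) * neg_cpow (real k + 1) s) = of_real eis_density * neg_cpow (real k + 1) s" using s1 by simp
    then show ?thesis by (simp only: left_diff_distrib) simp
  qed
  ultimately show ?thesis by simp
qed

lemma coef0: "hecke_coeff 0 k = of_nat (card (Eis_sphere k))"
  by (simp add: hecke_coeff_def hecke_ang_def)

text \<open>For \<open>a = 0\<close> the coefficients count lattice points, so convergence of the
  series ordered by norm bounds every finite sum of these nonnegative terms.\<close>

lemma summable_sq_norm_powr:
  assumes "\<sigma> > 1" shows "(\<lambda>\<mu>. sq_norm \<mu> powr (- \<sigma>)) summable_on Eis0"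
proof (rule nonneg_bdd_above_summable_on)
  define f where "f k = real (card (Eis_sphere k)) * (real k + 1) powr (- \<sigma>)" for k
  have "summable (\<lambda>k. hecke_coeff 0 k * neg_cpow (real k + 1) (of_real \<sigma>))"
    using coef0_sums[of "of_real \<sigma>"] assms by (auto simp: sums_iff)
  then have "summable (\<lambda>k. of_real (f k) :: complex)" by (simp add: coef0 neg_cpow_of_real f_def)
  then have f: "summable f" by (simp add: summable_of_real_iff)
  show "bdd_above (sum (\<lambda>\<mu>. sq_norm \<mu> powr (- \<sigma>)) ` {F. F \<subseteq> Eis0 \<and> finite F})"
  proof (rule bdd_aboveI2)
    fix F assume F: "F \<in> {F. F \<subseteq> Eis0 \<and> finite F}"
    have "eventually (\<lambda>Y. F \<subseteq> Y) (finite_subsets_at_top Eis0)"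
      unfolding eventually_finite_subsets_at_top using F by blast
    then have "eventually (\<lambda>n. F \<subseteq> Eis_upto n) sequentially" using filterlim_Eis_upto by (simp add: filterlim_iff)
    then obtain n where n: "F \<subseteq> Eis_upto n" by (auto simp: eventually_sequentially)
    have "(\<Sum>\<mu>\<in>F. sq_norm \<mu> powr (- \<sigma>)) \<le> (\<Sum>\<mu>\<in>Eis_upto n. sq_norm \<mu> powr (- \<sigma>))"
      using n by (intro sum_mono2) auto
    also have "\<dots> = (\<Sum>k<n. f k)" unfolding sum_Eis_upto f_def
      by (intro sum.cong refl) (simp add: Eis_sphere_def add.commute)
    also have "\<dots> \<le> suminf f"
    proof (rule sum_le_suminf[OF f])
      show "0 \<le> f k" for k by (simp add: f_def)
    qed auto
    finally show "(\<Sum>\<mu>\<in>F. sq_norm \<mu> powr (- \<sigma>)) \<le> suminf f" .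
  qed
qed auto

text \<open>Summing over lattice points instead of ideals meets each ideal once for every unit. The
  series is therefore six times the L-function of the character, with the same zeros and the same
  logarithmic derivative.\<close>

definition hecke_series :: "int \<Rightarrow> complex \<Rightarrow> complex" where
  "hecke_series a s = (\<Sum>\<^sub>\<infinity>\<mu>\<in>Eis0. hecke_ang a \<mu> * neg_cpow (sq_norm \<mu>) s)"

lemma norm_hecke_series_term: "\<mu> \<in> Eis0 \<Longrightarrow> norm (hecke_ang a \<mu> * neg_cpow (sq_norm \<mu>) s) = sq_norm \<mu> powr (- Re s)"
  using cmod_hecke_ang[of \<mu> a] sq_norm_pos[of \<mu>] by (simp add: norm_mult norm_neg_cpow Eis0_def)

lemma hecke_series_abs_summable: assumes "Re s > 1"
  shows "(\<lambda>\<mu>. norm (hecke_ang a \<mu> * neg_cpow (sq_norm \<mu>) s)) summable_on Eis0"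
  using summable_sq_norm_powr[OF assms] norm_hecke_series_term by (simp cong: summable_on_cong)

lemma hecke_series_has_sum: assumes "Re s > 1"
  shows "((\<lambda>\<mu>. hecke_ang a \<mu> * neg_cpow (sq_norm \<mu>) s) has_sum hecke_series a s) Eis0"
  unfolding hecke_series_def by (rule has_sum_infsum[OF abs_summable_summable[OF hecke_series_abs_summable[OF assms]]])

lemma hecke_series_sums:
  assumes "Re s > 1" shows "(\<lambda>k. hecke_coeff a k * neg_cpow (real k + 1) s) sums hecke_series a s"
proof -
  have "((\<lambda>A. \<Sum>\<mu>\<in>A. hecke_ang a \<mu> * neg_cpow (sq_norm \<mu>) s) \<longlongrightarrow> hecke_series a s) (finite_subsets_at_top Eis0)"
    using hecke_series_has_sum[OF assms] by (simp add: has_sum_def)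
  from filterlim_compose[OF this filterlim_Eis_upto] show ?thesis
    by (simp add: sum_Eis_upto sum_Eis_sphere_neg_cpow sums_def)
qed

definition hecke_L :: "int \<Rightarrow> complex \<Rightarrow> complex" where "hecke_L a = cont_series (hecke_coeff a)"

lemma hecke_series_eq_hecke_L: assumes "a \<noteq> 0" "Re s > 1" shows "hecke_series a s = hecke_L a s"
proof -
  interpret small_partial_sums "hecke_coeff a" "lattice_const * \<bar>of_int a\<bar>" by (rule small_partial_sums_hecke_coeff[OF assms(1)])
  show ?thesis using sums_unique2[OF hecke_series_sums[OF assms(2)] cont_series_sums[of s]] assms by (simp add: hecke_L_def)
qed

lemma hecke_L_holomorphic: "a \<noteq> 0 \<Longrightarrow> hecke_L a holomorphic_on {s. Re s > 3/4}"
  unfolding hecke_L_def using small_partial_sums.cont_series_holomorphic[OF small_partial_sums_hecke_coeff] .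

lemma hecke_L_le: "a \<noteq> 0 \<Longrightarrow> Re s \<ge> 7/8 \<Longrightarrow> norm (hecke_L a s) \<le> lattice_const * \<bar>of_int a\<bar> * norm s * decay_sum"
  unfolding hecke_L_def using small_partial_sums.cont_series_le[OF small_partial_sums_hecke_coeff] .

text \<open>The zeta function of the lattice times s - 1, continued past its pole; its value at 1 is
  the lattice density.\<close>

definition eis_zeta_reg :: "complex \<Rightarrow> complex" where
  "eis_zeta_reg s = (s - 1) * cont_series (\<lambda>k. hecke_coeff 0 k - of_real eis_density) s + of_real eis_density * zeta_reg s"

lemma eis_zeta_reg_holomorphic: "eis_zeta_reg holomorphic_on {s. Re s > 3/4}"
  unfolding eis_zeta_reg_def[abs_def]
  by (intro holomorphic_intros small_partial_sums.cont_series_holomorphic[OF small_partial_sums_coef0]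
      holomorphic_on_subset[OF zeta_reg_holomorphic]) auto

lemma eis_zeta_reg_1: "eis_zeta_reg 1 = of_real eis_density" by (simp add: eis_zeta_reg_def zeta_reg_1)

lemma eis_zeta_reg_eq: assumes "Re s > 1" shows "eis_zeta_reg s = (s - 1) * hecke_series 0 s"
proof -
  have "hecke_series 0 s = cont_series (\<lambda>k. hecke_coeff 0 k - of_real eis_density) s + of_real eis_density * zeta_reg s / (s - 1)"
    using sums_unique2[OF hecke_series_sums[OF assms] coef0_sums[OF assms]] by simp
  moreover have "s \<noteq> 1" using assms by auto
  ultimately show ?thesis by (simp add: eis_zeta_reg_def field_simps)
qed

text \<open>Weierstrass bounds on a disc inside Re s > 1 permit termwise differentiation. The
  derivative is recorded as an unordered sum because it will be rearranged over prime power
  divisors.\<close>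

lemma hecke_series_derivative:
  assumes s: "Re s > 1"
  shows "((\<lambda>\<mu>. - of_real (ln (sq_norm \<mu>)) * (hecke_ang a \<mu> * neg_cpow (sq_norm \<mu>) s)) has_sum deriv (hecke_series a) s) Eis0"
    and "(hecke_series a has_field_derivative deriv (hecke_series a) s) (at s)"
proof -
  define r where "r = (Re s - 1) / 2"
  have r: "r > 0" using s by (simp add: r_def)
  define f where "f A w = (\<Sum>\<mu>\<in>A. hecke_ang a \<mu> * neg_cpow (sq_norm \<mu>) w)" for A w
  define f' where "f' A w = (\<Sum>\<mu>\<in>A. - of_real (ln (sq_norm \<mu>)) * (hecke_ang a \<mu> * neg_cpow (sq_norm \<mu>) w))" for A w
  have Rew: "Re w \<ge> 1 + r" if "w \<in> cball s r" for w
    using that abs_Re_le_cmod[of "s - w"] unfolding r_def by (simp add: dist_norm abs_if field_simps split: if_splits)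
  have der: "(f A has_field_derivative f' A w) (at w)" for A w
    unfolding f_def f'_def
    by (rule DERIV_sum) (auto intro!: derivative_eq_intros has_field_derivative_neg_cpow)
  have ul: "uniform_limit (cball s r) f (hecke_series a) (finite_subsets_at_top Eis0)"
    unfolding f_def hecke_series_def
  proof (rule Weierstrass_m_test_general)
    show "(\<lambda>\<mu>. sq_norm \<mu> powr (- (1 + r))) summable_on Eis0" using r by (intro summable_sq_norm_powr) auto
    fix \<mu> w assume "\<mu> \<in> Eis0" "w \<in> cball s r"
    then show "norm (hecke_ang a \<mu> * neg_cpow (sq_norm \<mu>) w) \<le> sq_norm \<mu> powr (- (1 + r))"
      using norm_hecke_series_term[of \<mu> a w] Rew[of w] sq_norm_ge_1[of \<mu>] by (simp add: powr_mono)
  qed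
  have cont: "continuous_on (cball s r) (f A)" for A
    using der by (meson DERIV_continuous continuous_at_imp_continuous_on)
  have "\<forall>\<^sub>F A in finite_subsets_at_top Eis0. continuous_on (cball s r) (f A) \<and> (\<forall>w \<in> ball s r. (f A has_field_derivative f' A w) (at w))"
    using cont der by simp
  then obtain g' where g': "\<And>w. w \<in> ball s r \<Longrightarrow> (hecke_series a has_field_derivative g' w) (at w) \<and> ((\<lambda>A. f' A w) \<longlongrightarrow> g' w) (finite_subsets_at_top Eis0)"
    by (rule has_complex_derivative_uniform_limit[OF _ ul _ r]) (auto simp: finite_subsets_at_top_neq_bot)
  have "s \<in> ball s r" using r by simp
  from g'[OF this] have "(hecke_series a has_field_derivative g' s) (at s)" "((\<lambda>A. f' A s) \<longlongrightarrow> g' s) (finite_subsets_at_top Eis0)" by auto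
  moreover from this(1) have "deriv (hecke_series a) s = g' s" by (rule DERIV_imp_deriv)
  ultimately show "(hecke_series a has_field_derivative deriv (hecke_series a) s) (at s)"
    "((\<lambda>\<mu>. - of_real (ln (sq_norm \<mu>)) * (hecke_ang a \<mu> * neg_cpow (sq_norm \<mu>) s)) has_sum deriv (hecke_series a) s) Eis0"
    by (auto simp: has_sum_def f'_def)
qed

definition eis_zeta :: "real \<Rightarrow> real" where "eis_zeta \<sigma> = (\<Sum>\<^sub>\<infinity>\<mu>\<in>Eis0. sq_norm \<mu> powr (- \<sigma>))"

lemma eis_zeta_has_sum: "\<sigma> > 1 \<Longrightarrow> ((\<lambda>\<mu>. sq_norm \<mu> powr (- \<sigma>)) has_sum eis_zeta \<sigma>) Eis0"
  unfolding eis_zeta_def by (intro has_sum_infsum summable_sq_norm_powr)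

lemma hecke_ang_0_left [simp]: "hecke_ang 0 \<mu> = 1" by (simp add: hecke_ang_def)

lemma hecke_series_0_of_real: assumes "\<sigma> > 1" shows "hecke_series 0 (of_real \<sigma>) = of_real (eis_zeta \<sigma>)"
proof -
  have "((\<lambda>\<mu>. of_real (sq_norm \<mu> powr (- \<sigma>)) :: complex) has_sum of_real (eis_zeta \<sigma>)) Eis0"
    using eis_zeta_has_sum[OF assms] by (rule has_sum_of_real)
  then have "((\<lambda>\<mu>. hecke_ang 0 \<mu> * neg_cpow (sq_norm \<mu>) (of_real \<sigma>)) has_sum of_real (eis_zeta \<sigma>)) Eis0"
    by (rule has_sum_cong[THEN iffD1, rotated]) (use sq_norm_pos in \<open>auto simp: neg_cpow_of_real Eis0_def\<close>)
  with hecke_series_has_sum[of "of_real \<sigma>" 0] assms show ?thesis by (auto intro: has_sum_unique)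
qed

lemma summable_ln_sq_norm_powr:
  assumes "\<sigma> > 1" shows "(\<lambda>\<mu>. ln (sq_norm \<mu>) * sq_norm \<mu> powr (- \<sigma>)) summable_on Eis0"
proof -
  have "(\<lambda>\<mu>. - of_real (ln (sq_norm \<mu>)) * (hecke_ang 0 \<mu> * neg_cpow (sq_norm \<mu>) (of_real \<sigma>))) summable_on Eis0"
    using hecke_series_derivative(1)[of "of_real \<sigma>" 0] assms by (auto simp: summable_on_def)
  then have "(\<lambda>\<mu>. - (- of_real (ln (sq_norm \<mu>)) * (hecke_ang 0 \<mu> * neg_cpow (sq_norm \<mu>) (of_real \<sigma>)))) summable_on Eis0"
    by (rule summable_on_uminus[THEN iffD2])
  then have "(\<lambda>\<mu>. of_real (ln (sq_norm \<mu>) * sq_norm \<mu> powr (- \<sigma>)) :: complex) summable_on Eis0"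
    by (rule summable_on_cong[THEN iffD1, rotated]) (use sq_norm_pos in \<open>auto simp: neg_cpow_of_real Eis0_def\<close>)
  from summable_on_Re[OF this] show ?thesis by simp
qed

section \<open>The von Mangoldt series\<close>

definition Lambda_term :: "int \<Rightarrow> complex \<Rightarrow> complex set \<times> nat \<Rightarrow> complex" where
  "Lambda_term a s = (\<lambda>(P,k). of_real (ln (sq_norm (prime_gen P))) * (hecke_ang a (prime_gen P) * neg_cpow (sq_norm (prime_gen P)) s) ^ k)"

definition Lambda_abs :: "real \<Rightarrow> complex set \<times> nat \<Rightarrow> real" where
  "Lambda_abs \<sigma> = (\<lambda>(P,k). ln (sq_norm (prime_gen P)) * (sq_norm (prime_gen P) ^ k) powr (- \<sigma>))"

definition hecke_Lambda :: "int \<Rightarrow> complex \<Rightarrow> complex" where "hecke_Lambda a s = (\<Sum>\<^sub>\<infinity>j\<in>prime_powers. Lambda_term a s j)"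
definition eis_Lambda :: "real \<Rightarrow> real" where "eis_Lambda \<sigma> = (\<Sum>\<^sub>\<infinity>j\<in>prime_powers. Lambda_abs \<sigma> j)"

lemma sq_norm_prime_gen_ge_2: "P \<in> eis_nonzero_primes \<Longrightarrow> sq_norm (prime_gen P) \<ge> 2"
  using prime_gen(1,4) Eis_norm_ge_2 by (simp add: sq_norm_def)

lemma power_powr_commute: "x > 0 \<Longrightarrow> (x powr b) ^ k = (x ^ k) powr (b :: real)"
  by (induction k) (auto simp: powr_mult)

lemma norm_Lambda_term: assumes j: "j \<in> prime_powers" shows "norm (Lambda_term a s j) = Lambda_abs (Re s) j"
proof -
  obtain P k where Pk: "j = (P,k)" by force
  with j have P: "P \<in> eis_nonzero_primes" by (auto simp: prime_powers_def)
  define N where "N = sq_norm (prime_gen P)"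
  have N: "N \<ge> 2" using sq_norm_prime_gen_ge_2[OF P] by (simp add: N_def)
  have "norm (Lambda_term a s j) = ln N * (N powr (- Re s)) ^ k"
    using N prime_gen(3)[OF P] by (simp add: Pk Lambda_term_def N_def[symmetric] norm_mult norm_power cmod_hecke_ang norm_neg_cpow)
  also have "(N powr (- Re s)) ^ k = (N ^ k) powr (- Re s)" using N by (intro power_powr_commute) auto
  finally show ?thesis by (simp add: Pk Lambda_abs_def N_def)
qed

lemma Lambda_abs_nonneg: "j \<in> prime_powers \<Longrightarrow> Lambda_abs \<sigma> j \<ge> 0"
  using sq_norm_prime_gen_ge_2 by (force simp: Lambda_abs_def prime_powers_def)

text \<open>The identity \<open>- Z' = (\<Sum> \<Lambda>) Z\<close>, by summing \<open>ln_norm_eq_sum_prime_power_divisors\<close> over all \<open>\<mu> = \<pi>^k \<nu>\<close>.\<close>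
lemma Lambda_term_times_hecke_series_has_sum:
  assumes s: "Re s > 1"
  shows "((\<lambda>j. Lambda_term a s j * hecke_series a s) has_sum (- deriv (hecke_series a) s)) prime_powers"
proof -
  define g where "g = (\<lambda>(\<mu>, P, k :: nat). of_real (ln (sq_norm (prime_gen P))) * (hecke_ang a \<mu> * neg_cpow (sq_norm \<mu>) s))"
  have lnP: "ln (sq_norm (prime_gen P)) \<ge> 0" if "(P,k) \<in> prime_power_divisors \<mu>" for P k \<mu>
    using that sq_norm_prime_gen_ge_2[of P] by (auto simp: prime_power_divisors_def prime_powers_def)
  have inner: "((\<lambda>j. g (\<mu>, j)) has_sum (of_real (ln (sq_norm \<mu>)) * (hecke_ang a \<mu> * neg_cpow (sq_norm \<mu>) s))) (prime_power_divisors \<mu>)" if "\<mu> \<in> Eis0" for \<mu>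
  proof -
    have fin: "finite (prime_power_divisors \<mu>)" and sum: "(\<Sum>(P,k)\<in>prime_power_divisors \<mu>. ln (sq_norm (prime_gen P))) = ln (sq_norm \<mu>)"
      using ln_norm_eq_sum_prime_power_divisors[of \<mu>] that by (auto simp: Eis0_def sq_norm_def)
    have "(\<Sum>j\<in>prime_power_divisors \<mu>. g (\<mu>, j)) = of_real (\<Sum>(P,k)\<in>prime_power_divisors \<mu>. ln (sq_norm (prime_gen P))) * (hecke_ang a \<mu> * neg_cpow (sq_norm \<mu>) s)"
      by (simp add: g_def of_real_sum sum_distrib_right case_prod_beta)
    then show ?thesis using has_sum_finite[OF fin, of "\<lambda>j. g (\<mu>, j)"] sum by simp
  qed
  \<comment> \<open>Absolute summability over all pairs licenses the exchange of sums. For each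
    \<mu> the norms add up to ln N(\<mu>) N(\<mu>)^(-Re s), a convergent series because it is minus
    the derivative of the lattice zeta function.\<close>
  have abs: "(\<lambda>x. norm (g x)) summable_on Sigma Eis0 prime_power_divisors"
  proof (rule summable_on_SigmaI)
    fix \<mu> assume \<mu>: "\<mu> \<in> Eis0"
    have fin: "finite (prime_power_divisors \<mu>)" and sum: "(\<Sum>(P,k)\<in>prime_power_divisors \<mu>. ln (sq_norm (prime_gen P))) = ln (sq_norm \<mu>)"
      using ln_norm_eq_sum_prime_power_divisors[of \<mu>] \<mu> by (auto simp: Eis0_def sq_norm_def)
    have "(\<Sum>j\<in>prime_power_divisors \<mu>. norm (g (\<mu>, j))) = (\<Sum>(P,k)\<in>prime_power_divisors \<mu>. ln (sq_norm (prime_gen P))) * sq_norm \<mu> powr (- Re s)"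
      unfolding sum_distrib_right using lnP norm_hecke_series_term[OF \<mu>, of a s]
      by (intro sum.cong) (auto simp: g_def norm_mult)
    then show "((\<lambda>j. norm (g (\<mu>, j))) has_sum (ln (sq_norm \<mu>) * sq_norm \<mu> powr (- Re s))) (prime_power_divisors \<mu>)"
      using has_sum_finite[OF fin, of "\<lambda>j. norm (g (\<mu>, j))"] sum by simp
  qed (use summable_ln_sq_norm_powr[OF s] in auto)
  have "((\<lambda>\<mu>. of_real (ln (sq_norm \<mu>)) * (hecke_ang a \<mu> * neg_cpow (sq_norm \<mu>) s)) has_sum (- deriv (hecke_series a) s)) Eis0"
    using has_sum_cmult_right[OF hecke_series_derivative(1)[OF s, of a], of "-1"] by simp
  then have T: "(g has_sum (- deriv (hecke_series a) s)) (Sigma Eis0 prime_power_divisors)"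
    by (intro has_sum_SigmaI[OF inner _ abs_summable_summable[OF abs]])
  define J where "J = (\<lambda>x :: (complex set \<times> nat) \<times> complex. (prime_gen (fst (fst x)) ^ snd (fst x) * snd x, fst x))"
  define J' where "J' = (\<lambda>y :: complex \<times> complex set \<times> nat. (snd y, fst y / prime_gen (fst (snd y)) ^ snd (snd y)))"
  have bij: "bij_betw J (prime_powers \<times> Eis0) (Sigma Eis0 prime_power_divisors)"
  proof (rule bij_betwI[of _ _ _ J'])
    show "J \<in> prime_powers \<times> Eis0 \<rightarrow> Sigma Eis0 prime_power_divisors"
      using prime_gen by (fastforce simp: J_def Eis0_def prime_power_divisors_def prime_powers_def eis_dvd_def)
    show "J' (J x) = x" if "x \<in> prime_powers \<times> Eis0" for x
      using that prime_gen(3) by (auto simp: J_def J'_def prime_powers_def)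
    have *: "\<exists>r. r \<in> Eis \<and> r \<noteq> 0 \<and> \<mu> = prime_gen P ^ k * r" if "\<mu> \<in> Eis0" "(P,k) \<in> prime_power_divisors \<mu>" for \<mu> P k
      using that by (auto simp: prime_power_divisors_def eis_dvd_def Eis0_def)
    show "J' \<in> Sigma Eis0 prime_power_divisors \<rightarrow> prime_powers \<times> Eis0"
    proof
      fix y assume "y \<in> Sigma Eis0 prime_power_divisors"
      then obtain \<mu> P k where y: "y = (\<mu>,P,k)" "\<mu> \<in> Eis0" "(P,k) \<in> prime_power_divisors \<mu>" by auto
      then obtain r where "r \<in> Eis" "r \<noteq> 0" "\<mu> = prime_gen P ^ k * r" using * by blast
      then show "J' y \<in> prime_powers \<times> Eis0" using y prime_gen(3)[of P] by (auto simp: J'_def prime_power_divisors_def prime_powers_def Eis0_def)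
    qed
    fix y assume "y \<in> Sigma Eis0 prime_power_divisors"
    then show "J (J' y) = y" using prime_gen(3) by (auto simp: J_def J'_def prime_power_divisors_def prime_powers_def)
  qed
  have gJ: "g (J x) = (case x of (j, \<nu>) \<Rightarrow> Lambda_term a s j * (hecke_ang a \<nu> * neg_cpow (sq_norm \<nu>) s))" if x: "x \<in> prime_powers \<times> Eis0" for x
  proof -
    obtain P k \<nu> where xx: "x = ((P,k),\<nu>)" and P: "P \<in> eis_nonzero_primes" and \<nu>: "\<nu> \<noteq> 0"
      using x by (auto simp: prime_powers_def Eis0_def)
    have "sq_norm (prime_gen P) > 0" "sq_norm \<nu> > 0" using prime_gen(3)[OF P] \<nu> sq_norm_pos by auto
    then have "neg_cpow (sq_norm (prime_gen P ^ k * \<nu>)) s = neg_cpow (sq_norm (prime_gen P)) s ^ k * neg_cpow (sq_norm \<nu>) s"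
      by (simp add: sq_norm_mult sq_norm_power neg_cpow_mult neg_cpow_power)
    then show ?thesis by (simp add: xx J_def g_def Lambda_term_def hecke_ang_mult hecke_ang_power power_mult_distrib mult_ac)
  qed
  have "((\<lambda>x. g (J x)) has_sum (- deriv (hecke_series a) s)) (prime_powers \<times> Eis0)"
    using T has_sum_reindex_bij_betw[OF bij, of g] by blast
  then have "((\<lambda>(j, \<nu>). Lambda_term a s j * (hecke_ang a \<nu> * neg_cpow (sq_norm \<nu>) s)) has_sum (- deriv (hecke_series a) s)) (prime_powers \<times> Eis0)"
    using has_sum_cong[of "prime_powers \<times> Eis0" "\<lambda>x. g (J x)", OF gJ] by blast
  then show ?thesis
    by (rule has_sum_SigmaD) (use has_sum_cmult_right[OF hecke_series_has_sum[OF s, of a]] in auto)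
qed

section \<open>The logarithmic derivative to the right of 1\<close>

lemma one_in_Eis0: "1 \<in> Eis0" by (simp add: Eis0_def)

lemma eis_zeta_ge_1: assumes "\<sigma> > 1" shows "eis_zeta \<sigma> \<ge> 1"
proof -
  have "(\<Sum>\<mu>\<in>{1}. sq_norm \<mu> powr (- \<sigma>)) \<le> eis_zeta \<sigma>"
    by (rule finite_sum_le_has_sum[OF eis_zeta_has_sum[OF assms]]) (use one_in_Eis0 in auto)
  then show ?thesis by (simp add: sq_norm_def)
qed

lemma Lambda_term_0_of_real: "j \<in> prime_powers \<Longrightarrow> Lambda_term 0 (of_real \<sigma>) j = of_real (Lambda_abs \<sigma> j)"
proof -
  assume j: "j \<in> prime_powers"
  obtain P k where Pk: "j = (P,k)" by force
  with j have P: "P \<in> eis_nonzero_primes" by (auto simp: prime_powers_def)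
  have N: "sq_norm (prime_gen P) > 0" using sq_norm_prime_gen_ge_2[OF P] by linarith
  then show ?thesis by (simp add: Pk Lambda_term_def Lambda_abs_def neg_cpow_of_real power_powr_commute[symmetric])
qed

text \<open>The identity for \<open>a = 0\<close> at a real point is divided by the zeta value,
  which is at least 1. This is why \<open>Lambda_term_times_hecke_series_has_sum\<close> keeps the
  series as a factor inside the sum: there the convergence of the \<Lambda>-series is still
  unknown.\<close>

lemma Lambda_abs_summable: assumes "\<sigma> > 1" shows "Lambda_abs \<sigma> summable_on prime_powers"
proof -
  have "(\<lambda>j. Lambda_term 0 (of_real \<sigma>) j * of_real (eis_zeta \<sigma>)) summable_on prime_powers"
    using Lambda_term_times_hecke_series_has_sum[of "of_real \<sigma>" 0] assms hecke_series_0_of_real[OF assms] by (auto simp: summable_on_def)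
  then have "(\<lambda>j. of_real (Lambda_abs \<sigma> j * eis_zeta \<sigma>) :: complex) summable_on prime_powers"
    by (rule summable_on_cong[THEN iffD1, rotated]) (simp add: Lambda_term_0_of_real)
  from summable_on_Re[OF this] have "(\<lambda>j. Lambda_abs \<sigma> j * eis_zeta \<sigma>) summable_on prime_powers" by simp
  from summable_on_cmult_left[OF this, of "inverse (eis_zeta \<sigma>)"]
  show ?thesis using eis_zeta_ge_1[OF assms] by (simp add: mult.assoc)
qed

lemma eis_Lambda_has_sum: "\<sigma> > 1 \<Longrightarrow> (Lambda_abs \<sigma> has_sum eis_Lambda \<sigma>) prime_powers"
  unfolding eis_Lambda_def by (intro has_sum_infsum Lambda_abs_summable)

lemma hecke_Lambda_has_sum: assumes "Re s > 1" shows "(Lambda_term a s has_sum hecke_Lambda a s) prime_powers"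
proof -
  have "(\<lambda>j. norm (Lambda_term a s j)) summable_on prime_powers"
    using Lambda_abs_summable[OF assms] norm_Lambda_term by (simp cong: summable_on_cong)
  from abs_summable_summable[OF this] show ?thesis unfolding hecke_Lambda_def by (rule has_sum_infsum)
qed

lemma norm_hecke_Lambda_le: assumes "Re s > 1" shows "norm (hecke_Lambda a s) \<le> eis_Lambda (Re s)"
  by (rule norm_infsum_le[OF hecke_Lambda_has_sum[OF assms] eis_Lambda_has_sum[OF assms]]) (simp add: norm_Lambda_term)

lemma hecke_Lambda_0_of_real: assumes "\<sigma> > 1" shows "hecke_Lambda 0 (of_real \<sigma>) = of_real (eis_Lambda \<sigma>)"
proof -
  have "((\<lambda>j. of_real (Lambda_abs \<sigma> j) :: complex) has_sum of_real (eis_Lambda \<sigma>)) prime_powers"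
    using eis_Lambda_has_sum[OF assms] by (rule has_sum_of_real)
  then have "(Lambda_term 0 (of_real \<sigma>) has_sum of_real (eis_Lambda \<sigma>)) prime_powers"
    by (rule has_sum_cong[THEN iffD1, rotated]) (simp add: Lambda_term_0_of_real)
  with hecke_Lambda_has_sum[of "of_real \<sigma>" 0] assms show ?thesis by (auto intro: has_sum_unique)
qed

lemma hecke_Lambda_times_hecke_series: assumes "Re s > 1" shows "hecke_Lambda a s * hecke_series a s = - deriv (hecke_series a) s"
  using has_sum_cmult_left[OF hecke_Lambda_has_sum[OF assms], of a "hecke_series a s"] Lambda_term_times_hecke_series_has_sum[OF assms, of a]
  by (rule has_sum_unique)

lemma Eis_sphere_0_hecke_ang: "\<mu> \<in> Eis_sphere 0 \<Longrightarrow> hecke_ang a \<mu> = 1"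
proof (rule hecke_ang_unit)
  assume "\<mu> \<in> Eis_sphere 0"
  then show "\<mu> \<in> Eis" "cmod \<mu> = 1"
    using norm_ge_zero[of \<mu>] by (auto simp: Eis_sphere_def Eis0_def sq_norm_def power2_eq_1_iff simp del: norm_ge_zero)
qed

lemma hecke_series_minus_units_le:
  assumes "Re s > 1" shows "norm (hecke_series a s - of_nat (card (Eis_sphere 0))) \<le> eis_zeta (Re s) - real (card (Eis_sphere 0))"
proof -
  have sub: "Eis_sphere 0 \<subseteq> Eis0" by (auto simp: Eis_sphere_def)
  have 1: "((\<lambda>\<mu>. hecke_ang a \<mu> * neg_cpow (sq_norm \<mu>) s) has_sum (hecke_series a s - (\<Sum>\<mu>\<in>Eis_sphere 0. hecke_ang a \<mu> * neg_cpow (sq_norm \<mu>) s))) (Eis0 - Eis_sphere 0)"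
    using sub by (intro has_sum_Diff hecke_series_has_sum assms has_sum_finite) auto
  have 2: "(\<Sum>\<mu>\<in>Eis_sphere 0. hecke_ang a \<mu> * neg_cpow (sq_norm \<mu>) s) = of_nat (card (Eis_sphere 0))"
    by (simp add: Eis_sphere_0_hecke_ang) (simp add: Eis_sphere_def)
  have 3: "((\<lambda>\<mu>. sq_norm \<mu> powr (- Re s)) has_sum (eis_zeta (Re s) - (\<Sum>\<mu>\<in>Eis_sphere 0. sq_norm \<mu> powr (- Re s)))) (Eis0 - Eis_sphere 0)"
    using sub by (intro has_sum_Diff eis_zeta_has_sum assms has_sum_finite) auto
  have 4: "(\<Sum>\<mu>\<in>Eis_sphere 0. sq_norm \<mu> powr (- Re s)) = real (card (Eis_sphere 0))" by (simp add: Eis_sphere_def)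
  show ?thesis
    using norm_infsum_le[OF 1 3] norm_hecke_series_term unfolding 2 4 by auto
qed

text \<open>Non-units have norm at least 2, so each of their terms gains 2^(2 - \<sigma>) over its
  value at 2; only the units survive as \<sigma> tends to infinity.\<close>

lemma eis_zeta_minus_units_le:
  assumes "\<sigma> \<ge> 2" shows "eis_zeta \<sigma> - real (card (Eis_sphere 0)) \<le> 2 powr (2 - \<sigma>) * (eis_zeta 2 - real (card (Eis_sphere 0)))"
proof -
  have sub: "Eis_sphere 0 \<subseteq> Eis0" by (auto simp: Eis_sphere_def)
  have *: "((\<lambda>\<mu>. sq_norm \<mu> powr (- \<sigma>)) has_sum (eis_zeta \<sigma> - real (card (Eis_sphere 0)))) (Eis0 - Eis_sphere 0)" if "\<sigma> > 1" for \<sigma>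
  proof -
    have "((\<lambda>\<mu>. sq_norm \<mu> powr (- \<sigma>)) has_sum (eis_zeta \<sigma> - (\<Sum>\<mu>\<in>Eis_sphere 0. sq_norm \<mu> powr (- \<sigma>)))) (Eis0 - Eis_sphere 0)"
      using sub that by (intro has_sum_Diff eis_zeta_has_sum has_sum_finite) auto
    then show ?thesis by (simp add: Eis_sphere_def)
  qed
  have "((\<lambda>\<mu>. 2 powr (2 - \<sigma>) * sq_norm \<mu> powr (- 2)) has_sum (2 powr (2 - \<sigma>) * (eis_zeta 2 - real (card (Eis_sphere 0))))) (Eis0 - Eis_sphere 0)"
    using *[of 2] by (intro has_sum_cmult_right) auto
  with *[of \<sigma>] show ?thesis
  proof (rule has_sum_mono)
    show "\<sigma> > 1" using assms by simp
    fix \<mu> assume \<mu>: "\<mu> \<in> Eis0 - Eis_sphere 0"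
    then obtain k where k: "sq_norm \<mu> = real (Suc k)" using sq_norm_nat[of \<mu>] by auto
    with \<mu> have "k \<noteq> 0" by (auto simp: Eis_sphere_def)
    then have n2: "sq_norm \<mu> \<ge> 2" using k by simp
    have "sq_norm \<mu> powr (- \<sigma>) = sq_norm \<mu> powr (2 - \<sigma>) * sq_norm \<mu> powr (- 2)" by (simp flip: powr_add)
    also have "\<dots> \<le> 2 powr (2 - \<sigma>) * sq_norm \<mu> powr (- 2)"
      using n2 assms by (intro mult_right_mono powr_mono2') auto
    finally show "sq_norm \<mu> powr (- \<sigma>) \<le> 2 powr (2 - \<sigma>) * sq_norm \<mu> powr (- 2)" .
  qed
qed

text \<open>\<open>|Z_a(\<sigma> + i t)| Z_0(\<sigma>)\<close> decreases in \<open>\<sigma>\<close>, because its logarithmic derivative is \<open>- Re (\<Lambda>_a + \<Lambda>_0) \<le> 0\<close>.\<close>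
lemma norm_hecke_series_times_eis_zeta_ge_1:
  assumes s: "Re s > 1" shows "norm (hecke_series a s) * eis_zeta (Re s) \<ge> 1"
proof -
  define t where "t = Im s"
  define w where "w \<sigma> = hecke_series a (Complex \<sigma> t) * hecke_series 0 (of_real \<sigma>)" for \<sigma>
  define F where "F \<sigma> = hecke_Lambda a (Complex \<sigma> t) + hecke_Lambda 0 (of_real \<sigma>)" for \<sigma>
  define u where "u = real (card (Eis_sphere 0))"
  have u1: "u \<ge> 1"
  proof -
    have "1 \<in> Eis_sphere 0" by (simp add: Eis_sphere_def one_in_Eis0) (simp add: sq_norm_def)
    then have "card (Eis_sphere 0) > 0" using finite_Eis_sphere by (metis card_gt_0_iff empty_iff)
    then show ?thesis by (simp add: u_def)
  qed
  have wd: "(w has_vector_derivative (- F \<sigma> * w \<sigma>)) (at \<sigma>)" if "\<sigma> > 1" for \<sigma>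
  proof -
    have c: "((\<lambda>\<sigma>. Complex \<sigma> t) has_vector_derivative 1) (at \<sigma>)"
      unfolding Complex_eq by (auto intro!: derivative_eq_intros)
    have c0: "((\<lambda>\<sigma>. complex_of_real \<sigma>) has_vector_derivative 1) (at \<sigma>)"
      by (auto intro!: derivative_eq_intros)
    have 1: "((\<lambda>\<sigma>. hecke_series a (Complex \<sigma> t)) has_vector_derivative (1 * deriv (hecke_series a) (Complex \<sigma> t))) (at \<sigma>)"
      using field_vector_diff_chain_at[OF c, of "hecke_series a"] hecke_series_derivative(2)[of "Complex \<sigma> t" a] that by (simp add: o_def)
    have 2: "((\<lambda>\<sigma>. hecke_series 0 (of_real \<sigma>)) has_vector_derivative (1 * deriv (hecke_series 0) (of_real \<sigma>))) (at \<sigma>)"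
      using field_vector_diff_chain_at[OF c0, of "hecke_series 0"] hecke_series_derivative(2)[of "of_real \<sigma>" 0] that by (simp add: o_def)
    have "deriv (hecke_series a) (Complex \<sigma> t) = - (hecke_Lambda a (Complex \<sigma> t) * hecke_series a (Complex \<sigma> t))"
      "deriv (hecke_series 0) (of_real \<sigma>) = - (hecke_Lambda 0 (of_real \<sigma>) * hecke_series 0 (of_real \<sigma>))"
      using hecke_Lambda_times_hecke_series[of "Complex \<sigma> t" a] hecke_Lambda_times_hecke_series[of "of_real \<sigma>" 0] that by simp_all
    with has_vector_derivative_mult[OF 1 2] show ?thesis
      unfolding w_def F_def by (simp add: algebra_simps)
  qed
  \<comment> \<open>The \<Lambda>-series of the character is dominated in modulus by the one for
    \<open>a = 0\<close>, which is real and nonnegative.\<close>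
  have ReF: "Re (F \<sigma>) \<ge> 0" if "\<sigma> > 1" for \<sigma>
  proof -
    have "\<bar>Re (hecke_Lambda a (Complex \<sigma> t))\<bar> \<le> eis_Lambda \<sigma>"
      using norm_hecke_Lambda_le[of "Complex \<sigma> t" a] abs_Re_le_cmod[of "hecke_Lambda a (Complex \<sigma> t)"] that by simp
    then show ?thesis using hecke_Lambda_0_of_real[OF that] by (simp add: F_def)
  qed
  have dec: "w y \<bullet> w y \<le> w x \<bullet> w x" if "1 < x" "x \<le> y" for x y
  proof (rule DERIV_nonpos_imp_nonincreasing[OF that(2)])
    fix z assume z: "x \<le> z" "z \<le> y"
    then have z1: "z > 1" using that by simp
    have "((\<lambda>z. w z \<bullet> w z) has_derivative (\<lambda>h. w z \<bullet> (h *\<^sub>R (- F z * w z)) + (h *\<^sub>R (- F z * w z)) \<bullet> w z)) (at z)"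
      using wd[OF z1] unfolding has_vector_derivative_def by (intro has_derivative_inner)
    moreover have "(\<lambda>h. w z \<bullet> (h *\<^sub>R (- F z * w z)) + (h *\<^sub>R (- F z * w z)) \<bullet> w z) = (*) (- 2 * Re (F z) * (w z \<bullet> w z))"
      by (rule ext) (simp add: inner_complex_def algebra_simps)
    ultimately have "DERIV (\<lambda>z. w z \<bullet> w z) z :> - 2 * Re (F z) * (w z \<bullet> w z)"
      by (simp only: has_field_derivative_def)
    moreover have "- 2 * Re (F z) * (w z \<bullet> w z) \<le> 0" using ReF[OF z1] by (simp add: mult_nonneg_nonneg)
    ultimately show "\<exists>d. DERIV (\<lambda>z. w z \<bullet> w z) z :> d \<and> d \<le> 0" by blast
  qed
  have lim0: "((\<lambda>\<sigma>. eis_zeta \<sigma> - u) \<longlongrightarrow> 0) at_top"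
  proof (rule tendsto_sandwich)
    show "\<forall>\<^sub>F \<sigma> in at_top. 0 \<le> eis_zeta \<sigma> - u"
      using eventually_gt_at_top[of 1]
    proof eventually_elim
      case (elim \<sigma>)
      then show ?case using order_trans[OF norm_ge_zero hecke_series_minus_units_le[of "of_real \<sigma>" 0]] by (simp add: u_def)
    qed
    show "\<forall>\<^sub>F \<sigma> in at_top. eis_zeta \<sigma> - u \<le> 2 powr (2 - \<sigma>) * (eis_zeta 2 - u)"
      using eventually_ge_at_top[of 2] by eventually_elim (use eis_zeta_minus_units_le in \<open>simp add: u_def\<close>)
    have "((\<lambda>\<sigma>::real. exp ((2 - \<sigma>) * ln 2)) \<longlongrightarrow> 0) at_top"
    proof (rule filterlim_compose[OF exp_at_bot])
      show "filterlim (\<lambda>\<sigma>::real. (2 - \<sigma>) * ln 2) at_bot at_top"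
        unfolding filterlim_at_bot
      proof
        fix Z :: real
        show "\<forall>\<^sub>F \<sigma> in at_top. (2 - \<sigma>) * ln 2 \<le> Z"
          using eventually_ge_at_top[of "2 - Z / ln 2"] by eventually_elim (simp add: field_simps)
      qed
    qed
    then have "((\<lambda>\<sigma>::real. 2 powr (2 - \<sigma>)) \<longlongrightarrow> 0) at_top" by (simp add: powr_def)
    then show "((\<lambda>\<sigma>. 2 powr (2 - \<sigma>) * (eis_zeta 2 - u)) \<longlongrightarrow> 0) at_top" by (rule tendsto_mult_left_zero)
  qed simp
  have limZ: "((\<lambda>\<sigma>. hecke_series b (Complex \<sigma> y)) \<longlongrightarrow> of_real u) at_top" for b y
  proof (rule Lim_null[THEN iffD2, OF Lim_null_comparison[OF _ lim0]])
    show "\<forall>\<^sub>F \<sigma> in at_top. norm (hecke_series b (Complex \<sigma> y) - of_real u) \<le> eis_zeta \<sigma> - u"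
      using eventually_gt_at_top[of 1] by eventually_elim (use hecke_series_minus_units_le[of "Complex \<sigma> y" b for \<sigma>] in \<open>auto simp: u_def\<close>)
  qed
  \<comment> \<open>At infinity both factors tend to the number u of units, so the decreasing
    modulus never falls below u^2 \<ge> 1.\<close>
  have "(w \<longlongrightarrow> of_real u * of_real u) at_top"
    unfolding w_def using tendsto_mult[OF limZ[of a t] limZ[of 0 0]] by (simp add: complex_of_real_def)
  then have "((\<lambda>\<sigma>. w \<sigma> \<bullet> w \<sigma>) \<longlongrightarrow> (of_real u * of_real u) \<bullet> (of_real u * of_real u :: complex)) at_top"
    by (intro tendsto_inner)
  moreover have "\<forall>\<^sub>F \<sigma> in at_top. w \<sigma> \<bullet> w \<sigma> \<le> w (Re s) \<bullet> w (Re s)"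
    using eventually_ge_at_top[of "Re s"] by eventually_elim (use dec s in auto)
  ultimately have "(of_real u * of_real u) \<bullet> (of_real u * of_real u :: complex) \<le> w (Re s) \<bullet> w (Re s)"
    by (rule tendsto_upperbound) simp
  then have "(u * u)\<^sup>2 \<le> (norm (w (Re s)))\<^sup>2" by (simp add: power2_norm_eq_inner[symmetric] norm_mult power2_eq_square)
  then have "u * u \<le> norm (w (Re s))" by (rule power2_le_imp_le) simp
  moreover have "norm (w (Re s)) = norm (hecke_series a s) * eis_zeta (Re s)"
    using hecke_series_0_of_real[OF s] eis_zeta_ge_1[OF s] by (simp add: w_def t_def norm_mult)
  moreover have "1 \<le> u * u" using u1 mult_mono[of 1 u 1 u] by simp
  ultimately show ?thesis by simp
qed

lemma hecke_series_nonzero: "Re s > 1 \<Longrightarrow> hecke_series a s \<noteq> 0"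
  using norm_hecke_series_times_eis_zeta_ge_1[of s a] by auto

text \<open>\<open>eis_zeta_reg\<close> has no zero on the compact interval [1, 2]: at 1 its value
  is the positive density, and beyond 1 the series does not vanish. So it and its logarithmic
  derivative are bounded there. The pole being simple, 1 / (\<sigma> - 1) comes with coefficient
  exactly 1, as the comparison of 3 with 4 in the zero-free region demands.\<close>

lemma near_1_bounds:
  obtains K where "K \<ge> 1" "\<And>\<sigma>. 1 < \<sigma> \<Longrightarrow> \<sigma> \<le> 2 \<Longrightarrow> eis_zeta \<sigma> \<le> K / (\<sigma> - 1)"
    "\<And>\<sigma>. 1 < \<sigma> \<Longrightarrow> \<sigma> \<le> 2 \<Longrightarrow> eis_Lambda \<sigma> \<le> 1 / (\<sigma> - 1) + K"
proof -
  let ?S = "{s. Re s > 3/4}"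
  let ?I = "complex_of_real ` {1..2}"
  have op: "open ?S" by (rule open_halfspace_Re_gt)
  have I: "?I \<subseteq> ?S" by auto
  have comp: "compact ?I" by (intro compact_continuous_image continuous_intros) auto
  have c1: "continuous_on ?I eis_zeta_reg" using eis_zeta_reg_holomorphic I by (meson holomorphic_on_imp_continuous_on holomorphic_on_subset)
  have c2: "continuous_on ?I (deriv eis_zeta_reg)"
    using holomorphic_deriv[OF eis_zeta_reg_holomorphic op] I by (meson holomorphic_on_imp_continuous_on holomorphic_on_subset)
  have nz: "eis_zeta_reg s \<noteq> 0" if sI: "s \<in> ?I" for s
  proof -
    obtain x where x: "s = of_real x" "1 \<le> x" using sI by auto
    show ?thesis
    proof (cases "x = 1")
      case True then show ?thesis using eis_zeta_reg_1 eis_density_pos x by simp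
    next
      case False
      then have "Re s > 1" using x by simp
      then show ?thesis using eis_zeta_reg_eq[of s] hecke_series_nonzero[of s 0] by auto
    qed
  qed
  have c3: "continuous_on ?I (\<lambda>s. deriv eis_zeta_reg s / eis_zeta_reg s)" using nz by (intro continuous_intros c1 c2) auto
  have "bounded (eis_zeta_reg ` ?I)" "bounded ((\<lambda>s. deriv eis_zeta_reg s / eis_zeta_reg s) ` ?I)"
    by (intro compact_imp_bounded compact_continuous_image comp c1 c3)+
  then obtain A B where "\<forall>x\<in>eis_zeta_reg ` ?I. norm x \<le> A" "\<forall>x\<in>(\<lambda>s. deriv eis_zeta_reg s / eis_zeta_reg s) ` ?I. norm x \<le> B"
    unfolding bounded_iff by metis
  then have A: "norm (eis_zeta_reg s) \<le> A" and B: "norm (deriv eis_zeta_reg s / eis_zeta_reg s) \<le> B" if "s \<in> ?I" for s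
    using that by blast+
  define K where "K = max 1 (max A B)"
  show ?thesis
  proof (rule that[of K])
    show "K \<ge> 1" by (simp add: K_def)
    fix \<sigma> :: real assume \<sigma>: "1 < \<sigma>" "\<sigma> \<le> 2"
    then have mem: "of_real \<sigma> \<in> ?I" by auto
    have eis_zeta_reg: "eis_zeta_reg (of_real \<sigma>) = of_real ((\<sigma> - 1) * eis_zeta \<sigma>)" using eis_zeta_reg_eq[of "of_real \<sigma>"] hecke_series_0_of_real[of \<sigma>] \<sigma> by simp
    have "\<bar>(\<sigma> - 1) * eis_zeta \<sigma>\<bar> \<le> A" using A[OF mem] unfolding eis_zeta_reg norm_of_real .
    then have "(\<sigma> - 1) * eis_zeta \<sigma> \<le> K" by (simp add: K_def)
    then show "eis_zeta \<sigma> \<le> K / (\<sigma> - 1)" using \<sigma> by (simp add: field_simps)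
    define s where "s = complex_of_real \<sigma>"
    have s1: "Re s > 1" using \<sigma> by (simp add: s_def)
    have "((\<lambda>s. (s - 1) * hecke_series 0 s) has_field_derivative (hecke_series 0 s + (s - 1) * deriv (hecke_series 0) s)) (at s)"
      using hecke_series_derivative(2)[OF s1, of 0] by (auto intro!: derivative_eq_intros)
    then have "(eis_zeta_reg has_field_derivative (hecke_series 0 s + (s - 1) * deriv (hecke_series 0) s)) (at s)"
      by (rule has_field_derivative_transform_within_open[where S="{s. Re s > 1}"])
         (use s1 eis_zeta_reg_eq open_halfspace_Re_gt in auto)
    then have "deriv eis_zeta_reg s = hecke_series 0 s + (s - 1) * deriv (hecke_series 0) s" by (rule DERIV_imp_deriv)
    also have "deriv (hecke_series 0) s = - (hecke_Lambda 0 s * hecke_series 0 s)" using hecke_Lambda_times_hecke_series[OF s1, of 0] by simp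
    finally have dH: "deriv eis_zeta_reg s = hecke_series 0 s + (s - 1) * - (hecke_Lambda 0 s * hecke_series 0 s)" .
    have "s \<noteq> 1" using s1 by auto
    then have "deriv eis_zeta_reg s / eis_zeta_reg s = 1 / (s - 1) - hecke_Lambda 0 s"
      unfolding dH eis_zeta_reg_eq[OF s1] using hecke_series_nonzero[OF s1, of 0] by (simp add: divide_simps) (simp add: algebra_simps)
    then have "hecke_Lambda 0 s = 1 / (s - 1) - deriv eis_zeta_reg s / eis_zeta_reg s" by simp
    then have "Re (hecke_Lambda 0 s) = Re (1 / (s - 1)) - Re (deriv eis_zeta_reg s / eis_zeta_reg s)" by simp
    moreover have "Re (hecke_Lambda 0 s) = eis_Lambda \<sigma>" using hecke_Lambda_0_of_real \<sigma> by (simp add: s_def)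
    moreover have "1 / (s - 1) = of_real (1 / (\<sigma> - 1))" by (simp add: s_def)
    then have "Re (1 / (s - 1)) = 1 / (\<sigma> - 1)" by (simp only: Re_complex_of_real)
    moreover have "- Re (deriv eis_zeta_reg s / eis_zeta_reg s) \<le> K"
      using B[OF mem] abs_Re_le_cmod[of "deriv eis_zeta_reg s / eis_zeta_reg s"] by (simp add: s_def K_def)
    ultimately show "eis_Lambda \<sigma> \<le> 1 / (\<sigma> - 1) + K" by linarith
  qed
qed

text \<open>Termwise: if z is the unimodular factor of a term, doubling both \<open>a\<close> and t
  replaces it by z^2, and 3 + 4 Re z + Re (z^2) = 2 (1 + Re z)^2.\<close>

lemma three_four_one:
  assumes "\<sigma> > 1"
  shows "0 \<le> 3 * eis_Lambda \<sigma> + 4 * Re (hecke_Lambda a (Complex \<sigma> t)) + Re (hecke_Lambda (2 * a) (Complex \<sigma> (2 * t)))"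
proof -
  have "((\<lambda>j. 3 * Lambda_abs \<sigma> j + 4 * Re (Lambda_term a (Complex \<sigma> t) j) + Re (Lambda_term (2 * a) (Complex \<sigma> (2 * t)) j)) has_sum
     (3 * eis_Lambda \<sigma> + 4 * Re (hecke_Lambda a (Complex \<sigma> t)) + Re (hecke_Lambda (2 * a) (Complex \<sigma> (2 * t))))) prime_powers"
    using assms by (intro has_sum_add has_sum_cmult_right has_sum_Re hecke_Lambda_has_sum eis_Lambda_has_sum) auto
  then show ?thesis
  proof (rule has_sum_nonneg)
    fix j assume j: "j \<in> prime_powers"
    obtain P k where Pk: "j = (P,k)" by force
    with j have P: "P \<in> eis_nonzero_primes" by (auto simp: prime_powers_def)
    define N where "N = sq_norm (prime_gen P)"
    have N: "N \<ge> 2" using sq_norm_prime_gen_ge_2[OF P] by (simp add: N_def)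
    define z where "z = (hecke_ang a (prime_gen P) * exp (- \<i> * of_real t * of_real (ln N))) ^ k"
    have cz: "cmod z = 1"
      using cmod_hecke_ang[OF prime_gen(3)[OF P], of a] by (simp add: z_def norm_mult norm_power)
    have e: "neg_cpow N (Complex \<sigma> y) = of_real (N powr (- \<sigma>)) * exp (- \<i> * of_real y * of_real (ln N))" for y
      using N by (simp add: neg_cpow_def powr_def Complex_eq exp_of_real[symmetric] exp_add[symmetric] algebra_simps)
    have x: "Lambda_abs \<sigma> j \<ge> 0" using j by (rule Lambda_abs_nonneg)
    have m: "Lambda_abs \<sigma> j = ln N * (N powr (- \<sigma>)) ^ k" using N by (simp add: Pk Lambda_abs_def N_def power_powr_commute)
    have 1: "Lambda_term a (Complex \<sigma> t) j = of_real (Lambda_abs \<sigma> j) * z"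
      by (simp add: Pk m Lambda_term_def N_def[symmetric] e z_def power_mult_distrib mult_ac) (simp add: Pk m[unfolded Pk] mult_ac)
    have "hecke_ang (2 * a) (prime_gen P) = hecke_ang a (prime_gen P) ^ 2"
      by (simp add: hecke_ang_def power_int_mult[symmetric] mult.commute mult.left_commute flip: power_int_power' power_int_numeral)
    moreover have "exp (- \<i> * of_real (2 * t) * of_real (ln N)) = exp (- \<i> * of_real t * of_real (ln N)) ^ 2"
      by (simp add: exp_double[symmetric] mult_ac)
    ultimately have 2: "Lambda_term (2 * a) (Complex \<sigma> (2 * t)) j = of_real (Lambda_abs \<sigma> j) * z\<^sup>2"
      by (simp add: Pk m[unfolded Pk] Lambda_term_def N_def[symmetric] e z_def power_mult_distrib power_mult[symmetric] mult_ac)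
    have "(Re z)\<^sup>2 + (Im z)\<^sup>2 = 1" using cz by (metis cmod_power2 one_power2)
    then have Rez: "Re (z\<^sup>2) = 2 * (Re z)\<^sup>2 - 1" by (simp add: power2_eq_square)
    have R: "Re (of_real m * w) = m * Re w" for m w by simp
    have "3 * Lambda_abs \<sigma> j + 4 * Re (Lambda_term a (Complex \<sigma> t) j) + Re (Lambda_term (2 * a) (Complex \<sigma> (2 * t)) j)
      = 2 * Lambda_abs \<sigma> j * (1 + Re z)\<^sup>2"
      unfolding 1 2 R Rez by (simp add: power2_eq_square algebra_simps)
    then show "0 \<le> 3 * Lambda_abs \<sigma> j + 4 * Re (Lambda_term a (Complex \<sigma> t) j) + Re (Lambda_term (2 * a) (Complex \<sigma> (2 * t)) j)"
      using x by simp
  qed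
qed

section \<open>The zero-free region\<close>

text \<open>The summand 4 makes the logarithm at least 1 and lets a doubling of the argument be
  absorbed by squaring it in \<open>log_height_double\<close>.\<close>

definition log_height :: "int \<Rightarrow> real \<Rightarrow> real" where "log_height a t = ln (\<bar>of_int a\<bar> + \<bar>t\<bar> + 4)"

lemma log_height_ge_1: "log_height a t \<ge> 1"
proof -
  have "exp 1 \<le> \<bar>real_of_int a\<bar> + \<bar>t\<bar> + 4" using e_less_272 by linarith
  then have "ln (exp 1) \<le> log_height a t" unfolding log_height_def by (subst ln_le_cancel_iff) auto
  then show ?thesis by simp
qed

definition hecke_const :: real where "hecke_const = lattice_const * decay_sum + 1"

lemma hecke_const_ge_1: "hecke_const \<ge> 1" using lattice_const_pos decay_sum_nonneg by (simp add: hecke_const_def)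

lemma hecke_L_le_simple:
  assumes "a \<noteq> 0" "Re z \<ge> 7/8" "norm z \<le> \<bar>t\<bar> + 3"
  shows "norm (hecke_L a z) \<le> hecke_const * \<bar>of_int a\<bar> * (\<bar>t\<bar> + 3)"
proof -
  have "norm (hecke_L a z) \<le> (lattice_const * decay_sum) * (\<bar>of_int a\<bar> * norm z)"
    using hecke_L_le[OF assms(1,2)] by (simp add: mult_ac)
  also have "\<dots> \<le> hecke_const * (\<bar>of_int a\<bar> * (\<bar>t\<bar> + 3))"
    using assms(3) lattice_const_pos decay_sum_nonneg by (intro mult_mono) (auto simp: hecke_const_def)
  finally show ?thesis by (simp add: mult_ac)
qed

lemma norm_le_of_dist_Complex:
  assumes "dist (Complex \<sigma> t) z \<le> 1/8" "1 < \<sigma>" "\<sigma> \<le> 2"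
  shows "norm z \<le> \<bar>t\<bar> + 3" "Re z \<ge> 7/8"
proof -
  have "norm z \<le> norm (Complex \<sigma> t) + dist (Complex \<sigma> t) z"
    using norm_triangle_sub[of z "Complex \<sigma> t"] by (simp add: dist_norm norm_minus_commute)
  moreover have "norm (Complex \<sigma> t) \<le> \<bar>\<sigma>\<bar> + \<bar>t\<bar>" using cmod_le[of "Complex \<sigma> t"] by simp
  ultimately show "norm z \<le> \<bar>t\<bar> + 3" using assms by linarith
  have "\<sigma> - Re z \<le> 1/8" using abs_Re_le_cmod[of "Complex \<sigma> t - z"] assms(1) by (simp add: dist_norm)
  then show "Re z \<ge> 7/8" using assms by simp
qed

lemma hecke_L_nonzero_gt_1: "a \<noteq> 0 \<Longrightarrow> Re z > 1 \<Longrightarrow> hecke_L a z \<noteq> 0"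
  using hecke_series_nonzero[of z a] hecke_series_eq_hecke_L[of a z] by simp

lemma hecke_L_logderiv_gt_1:
  assumes "a \<noteq> 0" "Re s > 1" shows "deriv (hecke_L a) s / hecke_L a s = - hecke_Lambda a s"
proof -
  have "(hecke_L a has_field_derivative deriv (hecke_series a) s) (at s)"
    by (rule has_field_derivative_transform_within_open[OF hecke_series_derivative(2)[OF assms(2)], of "{s. Re s > 1}"])
       (use assms hecke_series_eq_hecke_L open_halfspace_Re_gt in auto)
  then have "deriv (hecke_L a) s = deriv (hecke_series a) s" by (rule DERIV_imp_deriv)
  also have "\<dots> = - (hecke_Lambda a s * hecke_series a s)" using hecke_Lambda_times_hecke_series[OF assms(2), of a] by simp
  finally show ?thesis using hecke_series_eq_hecke_L[OF assms] hecke_series_nonzero[OF assms(2), of a] by simp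
qed

lemma open_halfplane_34: "open {s. Re s > 3/4}" by (rule open_halfspace_Re_gt)

text \<open>This bounds the quantity ln (K / |f c|) + 1 of the Landau-type lemmas. The lower bound
  for |L| is the reciprocal of the lattice zeta function, whose pole accounts for ln (1 / (\<sigma>
  - 1)).\<close>

lemma hecke_L_lower_ln:
  obtains C where "C \<ge> 1" "\<And>a \<sigma> t. a \<noteq> 0 \<Longrightarrow> 1 < \<sigma> \<Longrightarrow> \<sigma> \<le> 2 \<Longrightarrow>
     ln (hecke_const * \<bar>of_int a\<bar> * (\<bar>t\<bar> + 3) / norm (hecke_L a (Complex \<sigma> t))) + 1 \<le> C * log_height a t + ln (1 / (\<sigma> - 1))"
proof -
  obtain K where K: "K \<ge> 1" "\<And>\<sigma>. 1 < \<sigma> \<Longrightarrow> \<sigma> \<le> 2 \<Longrightarrow> eis_zeta \<sigma> \<le> K / (\<sigma> - 1)"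
    and "\<And>\<sigma>. 1 < \<sigma> \<Longrightarrow> \<sigma> \<le> 2 \<Longrightarrow> eis_Lambda \<sigma> \<le> 1 / (\<sigma> - 1) + K"
    by (rule near_1_bounds, rule that)
  have BK: "hecke_const * K \<ge> 1" using hecke_const_ge_1 K(1) mult_mono[of 1 hecke_const 1 K] by simp
  define C where "C = ln (hecke_const * K) + 3"
  have lnBK: "ln (hecke_const * K) \<ge> 0" using BK by simp
  show ?thesis
  proof (rule that[of C])
    show "C \<ge> 1" using lnBK by (simp add: C_def)
    fix a :: int and \<sigma> t :: real assume a: "a \<noteq> 0" and \<sigma>: "1 < \<sigma>" "\<sigma> \<le> 2"
    define N where "N = norm (hecke_L a (Complex \<sigma> t))"
    have a1: "\<bar>real_of_int a\<bar> \<ge> 1" using a by linarith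
    have "N * eis_zeta \<sigma> \<ge> 1" using norm_hecke_series_times_eis_zeta_ge_1[of "Complex \<sigma> t" a] hecke_series_eq_hecke_L[OF a, of "Complex \<sigma> t"] \<sigma> by (simp add: N_def)
    moreover have "N \<ge> 0" by (simp add: N_def)
    then have "N * eis_zeta \<sigma> \<le> N * (K / (\<sigma> - 1))" using K(2)[OF \<sigma>] by (rule mult_left_mono[rotated])
    ultimately have NK: "1 \<le> N * (K / (\<sigma> - 1))" by linarith
    have N: "N > 0" using NK \<open>N \<ge> 0\<close> by (cases "N = 0") auto
    have "1 / N \<le> K / (\<sigma> - 1)" using NK N by (simp add: field_simps)
    then have "hecke_const * \<bar>of_int a\<bar> * (\<bar>t\<bar> + 3) * (1 / N) \<le> hecke_const * \<bar>of_int a\<bar> * (\<bar>t\<bar> + 3) * (K / (\<sigma> - 1))"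
      using hecke_const_ge_1 by (intro mult_left_mono) auto
    then have "ln (hecke_const * \<bar>of_int a\<bar> * (\<bar>t\<bar> + 3) / N) \<le> ln ((hecke_const * K) * \<bar>of_int a\<bar> * (\<bar>t\<bar> + 3) * (1 / (\<sigma> - 1)))"
      using hecke_const_ge_1 a1 N K(1) \<sigma> by (subst ln_le_cancel_iff) (auto simp: mult_ac)
    also have "\<dots> = ln (hecke_const * K) + ln \<bar>of_int a\<bar> + ln (\<bar>t\<bar> + 3) + ln (1 / (\<sigma> - 1))"
    proof -
      have "ln (w * x * y * z) = ln w + ln x + ln y + ln z" if "w > 0" "x > 0" "y > 0" "z > 0" for w x y z :: real
        using that by (simp add: ln_mult)
      from this[of "hecke_const * K" "\<bar>of_int a\<bar>" "\<bar>t\<bar> + 3" "1 / (\<sigma> - 1)"] show ?thesis using BK a1 \<sigma> by auto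
    qed
    also have "\<dots> \<le> ln (hecke_const * K) * log_height a t + log_height a t + log_height a t + ln (1 / (\<sigma> - 1))"
    proof (intro add_mono order_refl)
      show "ln (hecke_const * K) \<le> ln (hecke_const * K) * log_height a t" using lnBK log_height_ge_1[of a t] by (simp add: mult_le_cancel_left1)
      show "ln \<bar>real_of_int a\<bar> \<le> log_height a t" "ln (\<bar>t\<bar> + 3) \<le> log_height a t"
        using a1 unfolding log_height_def by (auto simp: ln_le_cancel_iff)
    qed
    finally show "ln (hecke_const * \<bar>of_int a\<bar> * (\<bar>t\<bar> + 3) / norm (hecke_L a (Complex \<sigma> t))) + 1 \<le> C * log_height a t + ln (1 / (\<sigma> - 1))"
      using log_height_ge_1[of a t] by (simp add: N_def C_def algebra_simps)
  qed
qed

text \<open>Both Landau-type lemmas are used on a disc of radius R = 1/8, so 4 / R = 32. A zero at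
  the same height and at distance d contributes 1 / d - 64 d; since d < 1/16, the loss is below 4,
  whence the constant 32 C + 4.\<close>

lemma Re_hecke_Lambda_bounds:
  obtains C where "C \<ge> 1"
    "\<And>a \<sigma> t. a \<noteq> 0 \<Longrightarrow> 1 < \<sigma> \<Longrightarrow> \<sigma> \<le> 2 \<Longrightarrow> Re (hecke_Lambda a (Complex \<sigma> t)) \<le> C * log_height a t + 32 * ln (1 / (\<sigma> - 1))"
    "\<And>a \<sigma> t \<beta>. a \<noteq> 0 \<Longrightarrow> 1 < \<sigma> \<Longrightarrow> \<sigma> \<le> 2 \<Longrightarrow> hecke_L a (Complex \<beta> t) = 0 \<Longrightarrow> \<beta> \<le> 1 \<Longrightarrow> \<sigma> - \<beta> < 1/16 \<Longrightarrow>
       Re (hecke_Lambda a (Complex \<sigma> t)) \<le> C * log_height a t + 32 * ln (1 / (\<sigma> - 1)) - 1 / (\<sigma> - \<beta>)"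
proof -
  obtain C where C: "C \<ge> 1" "\<And>a \<sigma> t. a \<noteq> 0 \<Longrightarrow> 1 < \<sigma> \<Longrightarrow> \<sigma> \<le> 2 \<Longrightarrow>
     ln (hecke_const * \<bar>of_int a\<bar> * (\<bar>t\<bar> + 3) / norm (hecke_L a (Complex \<sigma> t))) + 1 \<le> C * log_height a t + ln (1 / (\<sigma> - 1))"
    by (rule hecke_L_lower_ln, rule that)
  have hyp: "cball (Complex \<sigma> t) (1/8) \<subseteq> {s. Re s > 3/4}"
    "hecke_L a (Complex \<sigma> t) \<noteq> 0"
    "\<And>z. z \<in> cball (Complex \<sigma> t) (1/8) \<Longrightarrow> norm (hecke_L a z) \<le> hecke_const * \<bar>of_int a\<bar> * (\<bar>t\<bar> + 3)"
    "\<And>z. z \<in> ball (Complex \<sigma> t) (1/8/2) \<Longrightarrow> hecke_L a z = 0 \<Longrightarrow> Re z \<le> Re (Complex \<sigma> t)"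
    if "a \<noteq> 0" "1 < \<sigma>" "\<sigma> \<le> 2" for a \<sigma> t
  proof -
    show "cball (Complex \<sigma> t) (1/8) \<subseteq> {s. Re s > 3/4}"
      using norm_le_of_dist_Complex(2)[of \<sigma> t] that(2,3) by fastforce
    show "hecke_L a (Complex \<sigma> t) \<noteq> 0" using hecke_L_nonzero_gt_1 that by simp
    show "norm (hecke_L a z) \<le> hecke_const * \<bar>of_int a\<bar> * (\<bar>t\<bar> + 3)" if "z \<in> cball (Complex \<sigma> t) (1/8)" for z
      using hecke_L_le_simple[OF \<open>a \<noteq> 0\<close>] norm_le_of_dist_Complex[of \<sigma> t z] that \<open>1 < \<sigma>\<close> \<open>\<sigma> \<le> 2\<close> by simp
    show "Re z \<le> Re (Complex \<sigma> t)" if "hecke_L a z = 0" for z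
      using hecke_L_nonzero_gt_1[OF \<open>a \<noteq> 0\<close>, of z] that \<open>1 < \<sigma>\<close> by (cases "Re z > 1") auto
  qed
  show ?thesis
  proof (rule that[of "32 * C + 4"])
    show "32 * C + 4 \<ge> 1" using C(1) by simp
    fix a :: int and \<sigma> t :: real assume a: "a \<noteq> 0" and \<sigma>: "1 < \<sigma>" "\<sigma> \<le> 2"
    define E where "E = 4 / (1/8) * (ln (hecke_const * \<bar>of_int a\<bar> * (\<bar>t\<bar> + 3) / norm (hecke_L a (Complex \<sigma> t))) + 1)"
    have E: "E \<le> 32 * C * log_height a t + 32 * ln (1 / (\<sigma> - 1))" using C(2)[OF a \<sigma>, of t] by (simp add: E_def)
    have ld: "Re (deriv (hecke_L a) (Complex \<sigma> t) / hecke_L a (Complex \<sigma> t)) = - Re (hecke_Lambda a (Complex \<sigma> t))"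
      using hecke_L_logderiv_gt_1[OF a, of "Complex \<sigma> t"] \<sigma> by simp
    have lg1: "log_height a t \<ge> 1" by (rule log_height_ge_1)
    have "Re (deriv (hecke_L a) (Complex \<sigma> t) / hecke_L a (Complex \<sigma> t)) \<ge> - E"
      unfolding E_def
      by (rule landau_re_logderiv[OF open_halfplane_34 hyp(1)[OF a \<sigma>] _ hecke_L_holomorphic[OF a] hyp(2)[OF a \<sigma>] hyp(3)[OF a \<sigma>] hyp(4)[OF a \<sigma>]]) auto
    then show "Re (hecke_Lambda a (Complex \<sigma> t)) \<le> (32 * C + 4) * log_height a t + 32 * ln (1 / (\<sigma> - 1))"
      using E ld lg1 by (simp add: distrib_right)
    fix \<beta> assume \<beta>: "hecke_L a (Complex \<beta> t) = 0" "\<beta> \<le> 1" "\<sigma> - \<beta> < 1/16"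
    define d where "d = \<sigma> - \<beta>"
    have d: "d > 0" "d < 1/16" using \<beta> \<sigma> by (auto simp: d_def)
    have cd: "Complex \<sigma> t - Complex \<beta> t = of_real d" by (simp add: complex_eq_iff d_def)
    have "Complex \<beta> t \<in> ball (Complex \<sigma> t) (1/8/2)" using d by (simp add: dist_norm cd)
    then have "Re (deriv (hecke_L a) (Complex \<sigma> t) / hecke_L a (Complex \<sigma> t))
       \<ge> Re (Complex \<sigma> t - Complex \<beta> t) * (1 / (norm (Complex \<sigma> t - Complex \<beta> t))\<^sup>2 - 1 / (1/8)\<^sup>2) - E"
      unfolding E_def
      by (intro landau_re_logderiv_zero[OF open_halfplane_34 hyp(1)[OF a \<sigma>] _ hecke_L_holomorphic[OF a] hyp(2)[OF a \<sigma>] hyp(3)[OF a \<sigma>] hyp(4)[OF a \<sigma>] _ \<beta>(1)]) auto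
    moreover have "Re (Complex \<sigma> t - Complex \<beta> t) = d" "norm (Complex \<sigma> t - Complex \<beta> t) = d"
      using d unfolding cd by auto
    ultimately have "Re (deriv (hecke_L a) (Complex \<sigma> t) / hecke_L a (Complex \<sigma> t)) \<ge> d * (1 / d\<^sup>2 - 1 / (1/8)\<^sup>2) - E"
      by (simp only:)
    moreover have "d * (1 / d\<^sup>2 - 1 / (1/8)\<^sup>2) = 1 / d - 64 * d" using d by (simp add: power2_eq_square field_simps)
    ultimately have "Re (hecke_Lambda a (Complex \<sigma> t)) \<le> E - 1 / d + 64 * d" unfolding ld by linarith
    also have "\<dots> \<le> 32 * C * log_height a t + 32 * ln (1 / (\<sigma> - 1)) - 1 / d + 4 * log_height a t" using E d lg1 by linarith
    finally show "Re (hecke_Lambda a (Complex \<sigma> t)) \<le> (32 * C + 4) * log_height a t + 32 * ln (1 / (\<sigma> - 1)) - 1 / (\<sigma> - \<beta>)"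
      by (simp add: d_def algebra_simps)
  qed
qed

lemma ln_le_2_sqrt: "x > 0 \<Longrightarrow> ln x \<le> 2 * sqrt x"
  using ln_le_minus_one[of "sqrt x"] by (simp add: ln_sqrt)

lemma log_height_double: "log_height (2 * a) (2 * t) \<le> 2 * log_height a t"
proof -
  have "\<bar>real_of_int (2 * a)\<bar> + \<bar>2 * t\<bar> + 4 \<le> 2 * (\<bar>of_int a\<bar> + \<bar>t\<bar> + 4)" by simp
  also have "\<dots> \<le> (\<bar>of_int a\<bar> + \<bar>t\<bar> + 4) * (\<bar>of_int a\<bar> + \<bar>t\<bar> + 4)" by (intro mult_right_mono) auto
  finally have "log_height (2 * a) (2 * t) \<le> ln ((\<bar>of_int a\<bar> + \<bar>t\<bar> + 4) * (\<bar>of_int a\<bar> + \<bar>t\<bar> + 4))"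
    unfolding log_height_def by (subst ln_le_cancel_iff) (auto intro: mult_pos_pos)
  also have "\<dots> = 2 * log_height a t" unfolding log_height_def by (subst ln_mult) auto
  finally show ?thesis .
qed

text \<open>As \<open>\<chi>^2\<close> is nontrivial, the \<open>3-4-1\<close> argument is uniform in \<open>t\<close> and there is no exceptional zero.\<close>
theorem hecke_L_zero_free:
  obtains c where "0 < c" "c \<le> 1/16" "\<And>a s. a \<noteq> 0 \<Longrightarrow> Re s > 1 - c / log_height a (Im s) \<Longrightarrow> hecke_L a s \<noteq> 0"
proof -
  obtain K where K1: "K \<ge> 1" "\<And>\<sigma>. 1 < \<sigma> \<Longrightarrow> \<sigma> \<le> 2 \<Longrightarrow> eis_zeta \<sigma> \<le> K / (\<sigma> - 1)"
    and K2: "\<And>\<sigma>. 1 < \<sigma> \<Longrightarrow> \<sigma> \<le> 2 \<Longrightarrow> eis_Lambda \<sigma> \<le> 1 / (\<sigma> - 1) + K"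
    by (rule near_1_bounds, rule that)
  note K = K1(1) K2
  obtain C where C: "C \<ge> 1"
    "\<And>a \<sigma> t. a \<noteq> 0 \<Longrightarrow> 1 < \<sigma> \<Longrightarrow> \<sigma> \<le> 2 \<Longrightarrow> Re (hecke_Lambda a (Complex \<sigma> t)) \<le> C * log_height a t + 32 * ln (1 / (\<sigma> - 1))"
    "\<And>a \<sigma> t \<beta>. a \<noteq> 0 \<Longrightarrow> 1 < \<sigma> \<Longrightarrow> \<sigma> \<le> 2 \<Longrightarrow> hecke_L a (Complex \<beta> t) = 0 \<Longrightarrow> \<beta> \<le> 1 \<Longrightarrow> \<sigma> - \<beta> < 1/16 \<Longrightarrow>
       Re (hecke_Lambda a (Complex \<sigma> t)) \<le> C * log_height a t + 32 * ln (1 / (\<sigma> - 1)) - 1 / (\<sigma> - \<beta>)"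
    by (rule Re_hecke_Lambda_bounds, rule that)
  \<comment> \<open>D collects the lower-order terms: 3 K from the pole estimate, (4 + 2) C from the
    heights t and 2 t, and 320 from 4 * 32 + 32 = 160 copies of Q, each at most 2 l /
    \<open>sqrt \<eta>\<close>. Their sum is at most D l / \<open>sqrt \<eta>\<close>, and \<eta> is
    chosen so that this equals half of l / \<eta>.\<close>
  define D where "D = 3 * K + 6 * C + 320"
  define \<eta> where "\<eta> = 1 / (2 * D)\<^sup>2"
  have D: "D \<ge> 320" using K(1) C(1) by (simp add: D_def)
  have sq: "sqrt \<eta> = 1 / (2 * D)" unfolding \<eta>_def by (rule real_sqrt_unique) (use D in \<open>auto simp: power_divide\<close>)
  have \<eta>: "\<eta> > 0" using D by (simp add: \<eta>_def)
  have "640\<^sup>2 \<le> (2 * D)\<^sup>2" using D by (intro power_mono) auto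
  then have \<eta>le: "\<eta> \<le> 1 / 640\<^sup>2" unfolding \<eta>_def using D by (intro divide_left_mono) auto
  show ?thesis
  proof (rule that[of "\<eta> / 8"])
    show "0 < \<eta> / 8" using \<eta> by simp
    show "\<eta> / 8 \<le> 1/16" using \<eta>le by simp
    fix a :: int and s :: complex assume a: "a \<noteq> 0" and s: "Re s > 1 - \<eta> / 8 / log_height a (Im s)"
    define t where "t = Im s"
    define \<beta> where "\<beta> = Re s"
    define l where "l = log_height a t"
    have l1: "l \<ge> 1" using log_height_ge_1 by (simp add: l_def)
    define \<sigma> where "\<sigma> = 1 + \<eta> / l"
    have el: "0 < \<eta> / l" "\<eta> / l \<le> \<eta>" using \<eta> l1 by (auto simp: divide_le_eq mult_le_cancel_left1)
    have \<sigma>: "1 < \<sigma>" "\<sigma> \<le> 2" using el \<eta>le by (auto simp: \<sigma>_def)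
    show "hecke_L a s \<noteq> 0"
    proof
      assume z: "hecke_L a s = 0"
      then have \<beta>1: "\<beta> \<le> 1" using hecke_L_nonzero_gt_1[OF a, of s] by (cases "Re s > 1") (auto simp: \<beta>_def)
      have sz: "hecke_L a (Complex \<beta> t) = 0" using z by (simp add: \<beta>_def t_def)
      have d: "\<sigma> - \<beta> < 9/8 * (\<eta> / l)" using s by (simp add: \<sigma>_def \<beta>_def l_def t_def)
      have d0: "\<sigma> - \<beta> > 0" using \<sigma> \<beta>1 by simp
      have d16: "\<sigma> - \<beta> < 1/16" using d el \<eta>le by simp
      define Q where "Q = ln (1 / (\<sigma> - 1))"
      have Q: "Q \<le> 2 * (l / sqrt \<eta>)"
      proof -
        have "Q = ln (l / \<eta>)" using l1 \<eta> by (simp add: Q_def \<sigma>_def)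
        also have "\<dots> \<le> 2 * sqrt (l / \<eta>)" using l1 \<eta> by (intro ln_le_2_sqrt) auto
        also have "sqrt l \<le> l" using l1 by (simp add: real_le_lsqrt power2_eq_square mult_le_cancel_left1)
        then have "2 * sqrt (l / \<eta>) \<le> 2 * (l / sqrt \<eta>)" using \<eta> by (simp add: real_sqrt_divide divide_right_mono)
        finally show ?thesis .
      qed
      have 1: "eis_Lambda \<sigma> \<le> l / \<eta> + K" using K(2)[OF \<sigma>] by (simp add: \<sigma>_def)
      have 2: "Re (hecke_Lambda a (Complex \<sigma> t)) \<le> C * l + 32 * Q - 1 / (\<sigma> - \<beta>)"
        using C(3)[OF a \<sigma> sz \<beta>1 d16] by (simp add: l_def Q_def)
      have "Re (hecke_Lambda (2 * a) (Complex \<sigma> (2 * t))) \<le> C * log_height (2 * a) (2 * t) + 32 * Q"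
        using C(2)[of "2 * a" \<sigma> "2 * t"] a \<sigma> by (simp add: Q_def)
      also have "\<dots> \<le> C * (2 * l) + 32 * Q" using log_height_double[of a t] C(1) by (simp add: l_def)
      finally have 3: "Re (hecke_Lambda (2 * a) (Complex \<sigma> (2 * t))) \<le> C * (2 * l) + 32 * Q" .
      have "4 / (\<sigma> - \<beta>) \<le> 3 * (l / \<eta>) + 3 * K + 6 * (C * l) + 160 * Q"
        using three_four_one[OF \<sigma>(1), of a t] 1 2 3 by simp
      also have "\<dots> \<le> 3 * (l / \<eta>) + 3 * K * (l / sqrt \<eta>) + 6 * C * (l / sqrt \<eta>) + 320 * (l / sqrt \<eta>)"
      proof -
        have "sqrt \<eta> \<le> 1" unfolding sq using D by simp
        then have "l \<le> l / sqrt \<eta>" using l1 \<eta> by (simp add: field_simps mult_le_cancel_left2)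
        then have "K * 1 \<le> K * (l / sqrt \<eta>)" "C * l \<le> C * (l / sqrt \<eta>)"
          using K(1) C(1) l1 by (intro mult_left_mono; linarith)+
        then show ?thesis using Q by simp
      qed
      also have "\<dots> = 3 * (l / \<eta>) + (l / \<eta>) * (D * sqrt \<eta>)"
      proof -
        have "l / sqrt \<eta> = (l / \<eta>) * sqrt \<eta>" using \<eta> by (simp add: real_div_sqrt field_simps)
        then show ?thesis by (simp add: D_def algebra_simps)
      qed
      also have "D * sqrt \<eta> = 1 / 2" unfolding sq using D by simp
      \<comment> \<open>The contradiction is 32/9 > 7/2: a zero as close as assumed has \<sigma> -
        \<beta> < 9/8 * (\<eta> / l), which makes the left side exceed 32/9 times l /
        \<eta>.\<close>
      finally have "4 / (\<sigma> - \<beta>) \<le> 7/2 * (l / \<eta>)" by simp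
      moreover have "4 / (9/8 * (\<eta> / l)) < 4 / (\<sigma> - \<beta>)" using d d0 el(1) by (intro divide_strict_left_mono mult_pos_pos) auto
      moreover have "4 / (9/8 * (\<eta> / l)) = 32/9 * (l / \<eta>)" by simp
      moreover have "l / \<eta> > 0" using l1 \<eta> by simp
      ultimately show False by linarith
    qed
  qed
qed

text \<open>To the right of 1 + \<delta> / 4 the Dirichlet series suffices. Otherwise the disc of
  radius 5/4 \<delta> about 1 + \<delta> / 4 + i t reaches exactly to the edge 1 - \<delta> of the
  zero-free region, and s is at distance at most \<delta> / 2, within the inner half of the disc;
  the step from c to c / 4 makes room for this. Heights are measured at T + 1 because the disc may
  rise above T. One factor of the logarithm comes from 1 / R, the other from ln |L|.\<close>

theorem hecke_L_logderiv_bound: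
  obtains c C where "0 < c" "c \<le> 1/16" "C \<ge> 1"
    "\<And>a T s. a \<noteq> 0 \<Longrightarrow> T \<ge> 0 \<Longrightarrow> \<bar>Im s\<bar> \<le> T + 1 \<Longrightarrow> Re s > 1 - c / log_height a (T + 1) \<Longrightarrow> hecke_L a s \<noteq> 0"
    "\<And>a T s. a \<noteq> 0 \<Longrightarrow> T \<ge> 0 \<Longrightarrow> \<bar>Im s\<bar> \<le> T \<Longrightarrow> Re s \<ge> 1 - c / 4 / log_height a (T + 1) \<Longrightarrow> Re s \<le> 2 \<Longrightarrow>
       norm (deriv (hecke_L a) s / hecke_L a s) \<le> C * (log_height a (T + 1))\<^sup>2"
proof -
  obtain c where c: "0 < c" "c \<le> 1/16" "\<And>a s. a \<noteq> 0 \<Longrightarrow> Re s > 1 - c / log_height a (Im s) \<Longrightarrow> hecke_L a s \<noteq> 0"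
    by (rule hecke_L_zero_free, rule that)
  obtain K where K1: "K \<ge> 1" "\<And>\<sigma>. 1 < \<sigma> \<Longrightarrow> \<sigma> \<le> 2 \<Longrightarrow> eis_zeta \<sigma> \<le> K / (\<sigma> - 1)"
    and K2: "\<And>\<sigma>. 1 < \<sigma> \<Longrightarrow> \<sigma> \<le> 2 \<Longrightarrow> eis_Lambda \<sigma> \<le> 1 / (\<sigma> - 1) + K"
    by (rule near_1_bounds, rule that)
  note K = K1(1) K2
  obtain C where C: "C \<ge> 1" "\<And>a \<sigma> t. a \<noteq> 0 \<Longrightarrow> 1 < \<sigma> \<Longrightarrow> \<sigma> \<le> 2 \<Longrightarrow>
     ln (hecke_const * \<bar>of_int a\<bar> * (\<bar>t\<bar> + 3) / norm (hecke_L a (Complex \<sigma> t))) + 1 \<le> C * log_height a t + ln (1 / (\<sigma> - 1))"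
    by (rule hecke_L_lower_ln, rule that)
  define C' where "C' = max (4 / c + K) (48 / (5 * c) * (C + 4 / c))"
  have nz: "hecke_L a s \<noteq> 0" if a: "a \<noteq> 0" and T: "T \<ge> 0" and s: "\<bar>Im s\<bar> \<le> T + 1" "Re s > 1 - c / log_height a (T + 1)" for a T s
  proof (rule c(3)[OF a])
    have "log_height a (Im s) \<le> log_height a (T + 1)" unfolding log_height_def using s T by (subst ln_le_cancel_iff) auto
    then have "c / log_height a (T + 1) \<le> c / log_height a (Im s)"
      using c(1) log_height_ge_1[of a "Im s"] log_height_ge_1[of a "T+1"] by (intro divide_left_mono) auto
    then show "Re s > 1 - c / log_height a (Im s)" using s by linarith
  qed
  show ?thesis
  proof (rule that[of c C'])
    show "0 < c" "c \<le> 1/16" by fact+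
    have "4 / c \<ge> 0" using c by simp
    moreover have "4 / c + K \<le> C'" by (simp add: C'_def)
    ultimately show "C' \<ge> 1" using K(1) by linarith
    show "hecke_L a s \<noteq> 0" if "a \<noteq> 0" "T \<ge> 0" "\<bar>Im s\<bar> \<le> T + 1" "Re s > 1 - c / log_height a (T + 1)" for a T s
      using nz[OF that] .
    fix a :: int and T :: real and s :: complex
    assume a: "a \<noteq> 0" and T: "T \<ge> 0" and s: "\<bar>Im s\<bar> \<le> T" "Re s \<ge> 1 - c / 4 / log_height a (T + 1)" "Re s \<le> 2"
    define l where "l = log_height a (T + 1)"
    have l1: "l \<ge> 1" using log_height_ge_1 by (simp add: l_def)
    define \<delta> where "\<delta> = c / l"
    have "\<delta> \<le> c" using c l1 by (simp add: \<delta>_def divide_le_eq mult_le_cancel_left1)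
    then have \<delta>: "0 < \<delta>" "\<delta> \<le> 1/16" using c l1 by (auto simp: \<delta>_def)
    have ll: "l \<le> l\<^sup>2" using l1 by (simp add: power2_eq_square mult_le_cancel_left1)
    have l2: "1 \<le> l\<^sup>2" using l1 ll by linarith
    show "norm (deriv (hecke_L a) s / hecke_L a s) \<le> C' * (log_height a (T + 1))\<^sup>2"
    proof (cases "Re s > 1 + \<delta> / 4")
      case True
      then have s1: "Re s > 1" using \<delta> by simp
      have "norm (deriv (hecke_L a) s / hecke_L a s) \<le> eis_Lambda (Re s)"
        using hecke_L_logderiv_gt_1[OF a s1] norm_hecke_Lambda_le[OF s1, of a] by simp
      also have "\<dots> \<le> 1 / (Re s - 1) + K" using K(2)[OF s1 s(3)] .
      also have "1 / (Re s - 1) \<le> 1 / (\<delta> / 4)" using True \<delta> by (intro divide_left_mono) auto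
      also have "1 / (\<delta> / 4) = 4 / c * l" using c l1 by (simp add: \<delta>_def)
      also have "4 / c * l + K \<le> 4 / c * l\<^sup>2 + K * l\<^sup>2"
        using c K(1) l1 ll l2 by (intro add_mono mult_left_mono) (auto simp: mult_le_cancel_left1)
      also have "\<dots> = (4 / c + K) * l\<^sup>2" by (simp add: distrib_right)
      also have "\<dots> \<le> C' * l\<^sup>2" by (intro mult_right_mono) (auto simp: C'_def)
      finally show ?thesis by (simp add: l_def)
    next
      case False
      define t where "t = Im s"
      define \<sigma> where "\<sigma> = 1 + \<delta> / 4"
      have \<sigma>: "1 < \<sigma>" "\<sigma> \<le> 2" using \<delta> by (auto simp: \<sigma>_def)
      define R where "R = 5 / 4 * \<delta>"
      have R: "R > 0" "R \<le> 1/8" using \<delta> by (auto simp: R_def)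
      have inb: "\<bar>Im z\<bar> \<le> T + 1" "Re z > 1 - \<delta>" if z: "z \<in> ball (Complex \<sigma> t) R" for z
      proof -
        have "\<bar>\<sigma> - Re z\<bar> < R" "\<bar>t - Im z\<bar> < R"
          using z abs_Re_le_cmod[of "Complex \<sigma> t - z"] abs_Im_le_cmod[of "Complex \<sigma> t - z"] by (auto simp: dist_norm)
        then show "\<bar>Im z\<bar> \<le> T + 1" "Re z > 1 - \<delta>" using s(1) R unfolding t_def R_def \<sigma>_def by linarith+
      qed
      have "norm (deriv (hecke_L a) s / hecke_L a s)
         \<le> 12 / R * (ln (hecke_const * \<bar>of_int a\<bar> * (\<bar>t\<bar> + 3) / norm (hecke_L a (Complex \<sigma> t))) + 1)"
      proof (rule logderiv_bound_nonvanishing)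
        show "hecke_L a holomorphic_on ball (Complex \<sigma> t) R"
          using hecke_L_holomorphic[OF a] by (rule holomorphic_on_subset) (use inb(2) \<delta> in fastforce)
        show "hecke_L a z \<noteq> 0" if "z \<in> ball (Complex \<sigma> t) R" for z
          using nz[OF a T inb(1)[OF that]] inb(2)[OF that] by (simp add: \<delta>_def l_def)
        show "norm (hecke_L a z) \<le> hecke_const * \<bar>of_int a\<bar> * (\<bar>t\<bar> + 3)" if "z \<in> ball (Complex \<sigma> t) R" for z
          using hecke_L_le_simple[OF a] norm_le_of_dist_Complex[of \<sigma> t z] that \<sigma> R by simp
        have "dist (Complex \<sigma> t) s = \<bar>\<sigma> - Re s\<bar>"
          by (simp add: dist_norm cmod_def t_def)
        also have "\<dots> \<le> R / 2" using False s(2) \<delta> by (simp add: \<sigma>_def R_def \<delta>_def l_def abs_le_iff)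
        finally show "dist (Complex \<sigma> t) s \<le> R / 2" .
      qed (use R in auto)
      also have "\<dots> \<le> 12 / R * (C * log_height a t + ln (1 / (\<sigma> - 1)))"
        using C(2)[OF a \<sigma>, of t] R by (intro mult_left_mono) auto
      also have "\<dots> \<le> 12 / R * ((C + 4 / c) * l)"
      proof (intro mult_left_mono)
        have "log_height a t \<le> l" unfolding l_def log_height_def using s(1) T by (subst ln_le_cancel_iff) (auto simp: t_def)
        then have "C * log_height a t \<le> C * l" using C(1) by simp
        moreover have "1 / (\<sigma> - 1) = 4 / c * l" using c l1 by (simp add: \<sigma>_def \<delta>_def)
        moreover have "ln (4 / c * l) \<le> 4 / c * l" using c l1 ln_le_minus_one[of "4 / c * l"] by simp
        ultimately show "C * log_height a t + ln (1 / (\<sigma> - 1)) \<le> (C + 4 / c) * l" by (simp add: distrib_right)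
      qed (use R in auto)
      also have "\<dots> = (48 / (5 * c) * (C + 4 / c)) * l\<^sup>2"
        using c l1 by (simp add: R_def \<delta>_def power2_eq_square)
      also have "\<dots> \<le> C' * l\<^sup>2" by (intro mult_right_mono) (auto simp: C'_def)
      finally show ?thesis by (simp add: l_def)
    qed
  qed
qed

section \<open>Shifting the contour\<close>

definition prime_power_norm :: "complex set \<times> nat \<Rightarrow> real" where
  "prime_power_norm = (\<lambda>(P,k). sq_norm (prime_gen P) ^ k)"

definition Lambda_coeff :: "int \<Rightarrow> complex set \<times> nat \<Rightarrow> complex" where
  "Lambda_coeff a = (\<lambda>(P,k). of_real (ln (sq_norm (prime_gen P))) * hecke_ang a (prime_gen P) ^ k)"

lemma prime_power_norm_ge_1: assumes "j \<in> prime_powers" shows "prime_power_norm j \<ge> 1"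
proof -
  obtain P k where Pk: "j = (P,k)" by force
  then have "sq_norm (prime_gen P) \<ge> 2" using assms sq_norm_prime_gen_ge_2 by (auto simp: prime_powers_def)
  then show ?thesis by (simp add: Pk prime_power_norm_def one_le_power)
qed

lemma Lambda_term_eq: assumes "j \<in> prime_powers" shows "Lambda_term a s j = Lambda_coeff a j * neg_cpow (prime_power_norm j) s"
proof -
  obtain P k where Pk: "j = (P,k)" by force
  then have "sq_norm (prime_gen P) > 0" using assms sq_norm_prime_gen_ge_2[of P] by (force simp: prime_powers_def)
  then show ?thesis by (simp add: Pk Lambda_term_def Lambda_coeff_def prime_power_norm_def neg_cpow_power power_mult_distrib)
qed

lemma norm_Lambda_coeff: assumes "j \<in> prime_powers" shows "norm (Lambda_coeff a j) = ln (sq_norm (prime_gen (fst j)))"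
proof -
  obtain P k where Pk: "j = (P,k)" by force
  then have P: "P \<in> eis_nonzero_primes" using assms by (auto simp: prime_powers_def)
  show ?thesis using sq_norm_prime_gen_ge_2[OF P] cmod_hecke_ang[OF prime_gen(3)[OF P]] by (simp add: Pk Lambda_coeff_def norm_mult norm_power)
qed

lemma Lambda_abs_eq: "j \<in> prime_powers \<Longrightarrow> Lambda_abs \<sigma> j = norm (Lambda_coeff a j) * prime_power_norm j powr (- \<sigma>)"
  by (subst norm_Lambda_coeff) (auto simp: Lambda_abs_def prime_power_norm_def case_prod_beta)

definition prime_powers_upto :: "real \<Rightarrow> (complex set \<times> nat) set" where
  "prime_powers_upto x = {j\<in>prime_powers. prime_power_norm j \<le> x}"

lemma finite_prime_powers_upto: "finite (prime_powers_upto x)"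
proof (rule finite_subset)
  show "prime_powers_upto x \<subseteq> {P\<in>eis_nonzero_primes. eis_norm P \<le> x} \<times> {..nat \<lceil>x\<rceil>}"
  proof
    fix j assume j: "j \<in> prime_powers_upto x"
    obtain P k where Pk: "j = (P,k)" by force
    with j have P: "P \<in> eis_nonzero_primes" "k \<ge> 1" "sq_norm (prime_gen P) ^ k \<le> x" by (auto simp: prime_powers_upto_def prime_powers_def prime_power_norm_def)
    have N: "sq_norm (prime_gen P) \<ge> 2" using sq_norm_prime_gen_ge_2[OF P(1)] .
    have "sq_norm (prime_gen P) ^ 1 \<le> sq_norm (prime_gen P) ^ k" using N P(2) by (intro power_increasing) auto
    then have 1: "eis_norm P \<le> x" using P by (simp add: eis_norm_prime_gen sq_norm_def)
    have "real k \<le> 2 ^ k" by (metis less_imp_le of_nat_less_two_power)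
    also have "\<dots> \<le> sq_norm (prime_gen P) ^ k" using N by (intro power_mono) auto
    finally have "k \<le> nat \<lceil>x\<rceil>" using P(3) by linarith
    then show "j \<in> {P\<in>eis_nonzero_primes. eis_norm P \<le> x} \<times> {..nat \<lceil>x\<rceil>}" using 1 P(1) Pk by simp
  qed
qed (use finite_primes_bounded in auto)

text \<open>The weight ln (x / N) is the one that the kernel x^s / s^2 produces.\<close>

definition Psi :: "int \<Rightarrow> real \<Rightarrow> complex" where
  "Psi a x = (\<Sum>j\<in>prime_powers_upto x. Lambda_coeff a j * of_real (ln x - ln (prime_power_norm j)))"

lemma Psi_has_sum:
  assumes "x > 1"
  shows "((\<lambda>j. Lambda_coeff a j * of_real (max 0 (ln x - ln (prime_power_norm j)))) has_sum Psi a x) prime_powers"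
proof -
  have "((\<lambda>j. Lambda_coeff a j * of_real (max 0 (ln x - ln (prime_power_norm j)))) has_sum Psi a x) (prime_powers_upto x)"
  proof (rule has_sum_finiteI[OF finite_prime_powers_upto])
    show "Psi a x = (\<Sum>j\<in>prime_powers_upto x. Lambda_coeff a j * of_real (max 0 (ln x - ln (prime_power_norm j))))"
      unfolding Psi_def
    proof (rule sum.cong[OF refl])
      fix j assume "j \<in> prime_powers_upto x"
      then have "ln (prime_power_norm j) \<le> ln x" using prime_power_norm_ge_1[of j] assms by (subst ln_le_cancel_iff) (auto simp: prime_powers_upto_def)
      then show "Lambda_coeff a j * of_real (ln x - ln (prime_power_norm j)) = Lambda_coeff a j * of_real (max 0 (ln x - ln (prime_power_norm j)))"
        by (simp add: max_def)
    qed
  qed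
  then show ?thesis
  proof (rule has_sum_cong_neutral[THEN iffD1, rotated -1])
    fix j assume "j \<in> prime_powers - prime_powers_upto x"
    then have "ln x \<le> ln (prime_power_norm j)" using prime_power_norm_ge_1[of j] assms by (subst ln_le_cancel_iff) (auto simp: prime_powers_upto_def)
    then show "Lambda_coeff a j * of_real (max 0 (ln x - ln (prime_power_norm j))) = 0" by (simp add: max_absorb1)
  qed (auto simp: prime_powers_upto_def)
qed

lemma closed_segment_Re_eq:
  assumes "s \<in> closed_segment a b" "Re a = Re b" shows "Re s = Re a"
proof -
  obtain u where "s = (1 - u) *\<^sub>R a + u *\<^sub>R b" using assms(1) by (auto simp: closed_segment_def)
  then show ?thesis using assms(2) by (simp add: left_diff_distrib)
qed

lemma closed_segment_Im_eq:
  assumes "s \<in> closed_segment a b" "Im a = Im b" shows "Im s = Im a"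
proof -
  obtain u where "s = (1 - u) *\<^sub>R a + u *\<^sub>R b" using assms(1) by (auto simp: closed_segment_def)
  then show ?thesis using assms(2) by (simp add: left_diff_distrib)
qed

text \<open>Uniform convergence on the segment permits termwise integration. For a term of norm N,
  \<open>perron_truncated\<close> is applied to L = ln (x / N); its error is proportional to
  x^\<sigma> N^(-\<sigma>) / T, and these errors add up to the \<Lambda>-series at \<sigma>.\<close>

lemma perron_Psi:
  fixes \<sigma> T x :: real
  assumes \<sigma>: "\<sigma> > 1" and T: "T > 0" and x: "x > 1"
  defines "\<gamma> \<equiv> linepath (Complex \<sigma> (-T)) (Complex \<sigma> T)"
  shows "norm (contour_integral \<gamma> (\<lambda>s. hecke_Lambda a s * (exp (s * of_real (ln x)) / s\<^sup>2)) - 2 * pi * \<i> * Psi a x)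
     \<le> 2 * pi * exp (\<sigma> * ln x) / T * eis_Lambda \<sigma>"
proof -
  define L where "L = ln x"
  define g where "g s = exp (s * of_real L) / s\<^sup>2" for s :: complex
  have Res: "Re s = \<sigma>" if "s \<in> path_image \<gamma>" for s
    using closed_segment_Re_eq[of s "Complex \<sigma> (-T)" "Complex \<sigma> T"] that by (simp add: \<gamma>_def)
  have gcont: "continuous_on (path_image \<gamma>) g"
    unfolding g_def using Res \<sigma> by (intro continuous_intros) force+
  have gle: "norm (g s) \<le> exp (\<sigma> * L)" if "s \<in> path_image \<gamma>" for s
  proof -
    have "1 \<le> norm s" using Res[OF that] \<sigma> complex_Re_le_cmod[of s] by simp
    then have "1 \<le> (norm s)\<^sup>2" by simp
    moreover have "norm (g s) = exp (\<sigma> * L) / (norm s)\<^sup>2" using Res[OF that] by (simp add: g_def norm_divide norm_power)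
    ultimately show ?thesis by (simp add: divide_le_eq mult_le_cancel_left1)
  qed
  have mcont: "continuous_on A (\<lambda>s. Lambda_term a s j)" if "j \<in> prime_powers" for j A
    unfolding Lambda_term_eq[OF that] neg_cpow_def by (intro continuous_intros)
  define f where "f X s = (\<Sum>j\<in>X. Lambda_term a s j * g s)" for X s
  have ul: "uniform_limit (path_image \<gamma>) f (\<lambda>s. hecke_Lambda a s * g s) (finite_subsets_at_top prime_powers)"
    unfolding f_def
  proof (rule Weierstrass_m_test_general')
    show "(\<lambda>j. Lambda_abs \<sigma> j * exp (\<sigma> * L)) summable_on prime_powers"
      using Lambda_abs_summable[OF \<sigma>] by (rule summable_on_cmult_left)
    show "((\<lambda>j. Lambda_term a s j * g s) has_sum hecke_Lambda a s * g s) prime_powers" if "s \<in> path_image \<gamma>" for s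
      using Res[OF that] \<sigma> by (intro has_sum_cmult_left hecke_Lambda_has_sum) auto
    show "norm (Lambda_term a s j * g s) \<le> Lambda_abs \<sigma> j * exp (\<sigma> * L)" if "j \<in> prime_powers" "s \<in> path_image \<gamma>" for j s
      unfolding norm_mult using norm_Lambda_term[OF that(1), of a s] Res[OF that(2)] gle[OF that(2)] Lambda_abs_nonneg[OF that(1)]
      by (intro mult_mono) auto
  qed
  have fint: "(\<lambda>s. Lambda_term a s j * g s) contour_integrable_on \<gamma>" if "j \<in> prime_powers" for j
    unfolding \<gamma>_def using gcont mcont[OF that]
    by (intro contour_integrable_continuous_linepath continuous_intros) (auto simp: \<gamma>_def)
  define I where "I j = contour_integral \<gamma> (\<lambda>s. Lambda_term a s j * g s)" for j
  have "((\<lambda>X. contour_integral \<gamma> (f X)) \<longlongrightarrow> contour_integral \<gamma> (\<lambda>s. hecke_Lambda a s * g s)) (finite_subsets_at_top prime_powers)"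
  proof (rule contour_integral_uniform_limit(2)[OF _ ul])
    show "\<forall>\<^sub>F X in finite_subsets_at_top prime_powers. f X contour_integrable_on \<gamma>"
      unfolding f_def by (rule eventually_finite_subsets_at_top_weakI) (auto intro!: contour_integrable_sum fint)
    show "norm (vector_derivative \<gamma> (at t)) \<le> norm (Complex \<sigma> T - Complex \<sigma> (-T))" for t
      by (simp add: \<gamma>_def)
  qed (auto simp: \<gamma>_def)
  moreover have "\<forall>\<^sub>F X in finite_subsets_at_top prime_powers. contour_integral \<gamma> (f X) = (\<Sum>j\<in>X. I j)"
    unfolding f_def I_def
    by (rule eventually_finite_subsets_at_top_weakI) (auto intro!: contour_integral_sum fint)
  ultimately have hs: "(I has_sum contour_integral \<gamma> (\<lambda>s. hecke_Lambda a s * g s)) prime_powers"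
    unfolding has_sum_def by (rule Lim_transform_eventually)
  have hs2: "((\<lambda>j. I j - 2 * pi * \<i> * (Lambda_coeff a j * of_real (max 0 (L - ln (prime_power_norm j)))))
      has_sum (contour_integral \<gamma> (\<lambda>s. hecke_Lambda a s * g s) - 2 * pi * \<i> * Psi a x)) prime_powers"
    using has_sum_add[OF hs has_sum_cmult_right[OF Psi_has_sum[OF x, of a], of "- (2 * pi * \<i>)"]] by (simp add: L_def)
  have hs3: "((\<lambda>j. 2 * pi * exp (\<sigma> * L) / T * Lambda_abs \<sigma> j) has_sum 2 * pi * exp (\<sigma> * L) / T * eis_Lambda \<sigma>) prime_powers"
    by (intro has_sum_cmult_right eis_Lambda_has_sum \<sigma>)
  have "norm (I j - 2 * pi * \<i> * (Lambda_coeff a j * of_real (max 0 (L - ln (prime_power_norm j))))) \<le> 2 * pi * exp (\<sigma> * L) / T * Lambda_abs \<sigma> j"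
    if j: "j \<in> prime_powers" for j
  proof -
    define l where "l = ln (prime_power_norm j)"
    have q: "prime_power_norm j > 0" using prime_power_norm_ge_1[OF j] by simp
    have e: "neg_cpow (prime_power_norm j) s * exp (s * of_real L) = exp (s * of_real (L - l))" for s
      by (simp add: neg_cpow_def l_def exp_add[symmetric] algebra_simps)
    have eq: "(\<lambda>s. Lambda_term a s j * g s) = (\<lambda>s. Lambda_coeff a j * (exp (s * of_real (L - l)) / s\<^sup>2))"
      unfolding g_def Lambda_term_eq[OF j] e[symmetric] by (simp add: mult.assoc)
    have "(\<lambda>s. exp (s * of_real (L - l)) / s\<^sup>2) contour_integrable_on \<gamma>"
      unfolding \<gamma>_def
      by (rule contour_integrable_continuous_linepath)
         (use Res \<sigma> in \<open>force simp: \<gamma>_def intro!: continuous_intros\<close>)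
    then have "I j = Lambda_coeff a j * contour_integral \<gamma> (\<lambda>s. exp (s * of_real (L - l)) / s\<^sup>2)"
      unfolding I_def eq by (rule contour_integral_lmul)
    then have "I j - 2 * pi * \<i> * (Lambda_coeff a j * of_real (max 0 (L - l)))
       = Lambda_coeff a j * (contour_integral \<gamma> (\<lambda>s. exp (s * of_real (L - l)) / s\<^sup>2) - 2 * pi * \<i> * of_real (max 0 (L - l)))"
      by (simp add: algebra_simps)
    also have "norm \<dots> \<le> norm (Lambda_coeff a j) * (2 * pi * exp (\<sigma> * (L - l)) / T)"
      unfolding norm_mult[of "Lambda_coeff a j"] \<gamma>_def using \<sigma> T by (intro mult_left_mono perron_truncated) auto
    also have "exp (\<sigma> * (L - l)) = exp (\<sigma> * L) * prime_power_norm j powr (- \<sigma>)"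
      using q by (simp add: powr_def l_def right_diff_distrib exp_diff exp_minus divide_inverse)
    also have "norm (Lambda_coeff a j) * (2 * pi * (exp (\<sigma> * L) * prime_power_norm j powr (- \<sigma>)) / T) = 2 * pi * exp (\<sigma> * L) / T * Lambda_abs \<sigma> j"
      by (simp add: Lambda_abs_eq[OF j, of \<sigma> a])
    finally show ?thesis by (simp add: l_def)
  qed
  from norm_infsum_le[OF hs2 hs3 this] show ?thesis by (simp add: g_def L_def)
qed

lemma rectangle_shift_bound:
  fixes F :: "complex \<Rightarrow> complex"
  assumes S: "convex S" "open S" "F holomorphic_on S"
    and s1: "\<sigma>1 < \<sigma>" and T: "T > 0"
    and sub: "\<And>s. \<sigma>1 \<le> Re s \<Longrightarrow> Re s \<le> \<sigma> \<Longrightarrow> \<bar>Im s\<bar> \<le> T \<Longrightarrow> s \<in> S"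
    and H: "H \<ge> 0" "\<And>s. \<sigma>1 \<le> Re s \<Longrightarrow> Re s \<le> \<sigma> \<Longrightarrow> \<bar>Im s\<bar> = T \<Longrightarrow> norm (F s) \<le> H"
    and V: "V \<ge> 0" "\<And>s. Re s = \<sigma>1 \<Longrightarrow> \<bar>Im s\<bar> \<le> T \<Longrightarrow> norm (F s) \<le> V"
  shows "norm (contour_integral (linepath (Complex \<sigma> (-T)) (Complex \<sigma> T)) F) \<le> 2 * H * (\<sigma> - \<sigma>1) + V * (2 * T)"
proof -
  let ?a = "Complex \<sigma> (-T)" and ?b = "Complex \<sigma>1 (-T)" and ?c = "Complex \<sigma>1 T" and ?d = "Complex \<sigma> T"
  let ?R = "cbox ?b ?d"
  have R: "s \<in> ?R \<longleftrightarrow> \<sigma>1 \<le> Re s \<and> Re s \<le> \<sigma> \<and> \<bar>Im s\<bar> \<le> T" for s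
    by (auto simp: in_cbox_complex_iff abs_le_iff)
  have RS: "?R \<subseteq> S" using sub R by blast
  have corners: "?a \<in> ?R" "?b \<in> ?R" "?c \<in> ?R" "?d \<in> ?R" using s1 T unfolding R by auto
  have seg: "closed_segment p q \<subseteq> S" if "p \<in> ?R" "q \<in> ?R" for p q
    using closed_segment_subset[OF that convex_box(1)] RS by blast
  have cont: "continuous_on S F" using S(3) by (rule holomorphic_on_imp_continuous_on)
  have int: "F contour_integrable_on linepath p q" if "p \<in> ?R" "q \<in> ?R" for p q
    using continuous_on_subset[OF cont seg[OF that]] by (rule contour_integrable_continuous_linepath)
  have "contour_integral (linepath ?a ?d) F = contour_integral (linepath ?a ?b +++ linepath ?b ?c +++ linepath ?c ?d) F"
    by (rule convex_contour_integral_path_independent[OF S])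
       (use seg corners in \<open>auto simp: path_image_join\<close>)
  also have "\<dots> = contour_integral (linepath ?a ?b) F + (contour_integral (linepath ?b ?c) F + contour_integral (linepath ?c ?d) F)"
    using int corners by (simp add: contour_integrable_join)
  also have "norm \<dots> \<le> H * (\<sigma> - \<sigma>1) + (V * (2 * T) + H * (\<sigma> - \<sigma>1))"
  proof (intro norm_triangle_le add_mono)
    have "norm (contour_integral (linepath ?a ?b) F) \<le> H * norm (?b - ?a)"
    proof (rule contour_integral_bound_linepath[OF int H(1)])
      fix s assume s: "s \<in> closed_segment ?a ?b"
      then have "s \<in> ?R" using closed_segment_subset[OF corners(1,2) convex_box(1)] by blast
      moreover have "Im s = -T" using closed_segment_Im_eq[OF s] by simp
      ultimately show "norm (F s) \<le> H" using H(2) R T by simp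
    qed (use corners in auto)
    also have "norm (?b - ?a) = \<sigma> - \<sigma>1" using s1 by (simp add: cmod_def)
    finally show "norm (contour_integral (linepath ?a ?b) F) \<le> H * (\<sigma> - \<sigma>1)" .
    have "norm (contour_integral (linepath ?c ?d) F) \<le> H * norm (?d - ?c)"
    proof (rule contour_integral_bound_linepath[OF int H(1)])
      fix s assume s: "s \<in> closed_segment ?c ?d"
      then have "s \<in> ?R" using closed_segment_subset[OF corners(3,4) convex_box(1)] by blast
      moreover have "Im s = T" using closed_segment_Im_eq[OF s] by simp
      ultimately show "norm (F s) \<le> H" using H(2) R T by simp
    qed (use corners in auto)
    also have "norm (?d - ?c) = \<sigma> - \<sigma>1" using s1 by (simp add: cmod_def)
    finally show "norm (contour_integral (linepath ?c ?d) F) \<le> H * (\<sigma> - \<sigma>1)" .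
    have "norm (contour_integral (linepath ?b ?c) F) \<le> V * norm (?c - ?b)"
    proof (rule contour_integral_bound_linepath[OF int V(1)])
      fix s assume s: "s \<in> closed_segment ?b ?c"
      then have "s \<in> ?R" using closed_segment_subset[OF corners(2,3) convex_box(1)] by blast
      moreover have "Re s = \<sigma>1" using closed_segment_Re_eq[OF s] by simp
      ultimately show "norm (F s) \<le> V" using V(2) R by simp
    qed (use corners in auto)
    also have "norm (?c - ?b) = 2 * T"
      using T unfolding cmod_def by (intro real_sqrt_unique) (auto simp: power_mult_distrib)
    finally show "norm (contour_integral (linepath ?b ?c) F) \<le> V * (2 * T)" .
  qed
  finally show ?thesis by simp
qed

lemma ln2_le_ln_Suc_abs: "a \<noteq> 0 \<Longrightarrow> ln 2 \<le> ln (1 + \<bar>real_of_int a\<bar>)"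
  by (subst ln_le_cancel_iff) linarith+

lemma eis_Lambda_nonneg: "eis_Lambda \<sigma> \<ge> 0"
  unfolding eis_Lambda_def by (intro infsum_nonneg Lambda_abs_nonneg)

lemma Psi_bound:
  obtains c C where "0 < c" "c \<le> 1/512" "C \<ge> 0"
    "\<And>a x. a \<noteq> 0 \<Longrightarrow> ln x \<ge> 1 \<Longrightarrow> x > 1 \<Longrightarrow>
      norm (Psi a x) \<le> C * x * ((ln (1 + \<bar>of_int a\<bar>))\<^sup>2 + ln x) * exp (- (c * (ln x / (ln (1 + \<bar>of_int a\<bar>) + sqrt (ln x)))))"
proof -
  obtain c C where c: "0 < c" "c \<le> 1/16" and C: "C \<ge> 1"
    and nz: "\<And>a T s. a \<noteq> 0 \<Longrightarrow> T \<ge> 0 \<Longrightarrow> \<bar>Im s\<bar> \<le> T + 1 \<Longrightarrow> Re s > 1 - c / log_height a (T + 1) \<Longrightarrow> hecke_L a s \<noteq> 0"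
    and ld: "\<And>a T s. a \<noteq> 0 \<Longrightarrow> T \<ge> 0 \<Longrightarrow> \<bar>Im s\<bar> \<le> T \<Longrightarrow> Re s \<ge> 1 - c / 4 / log_height a (T + 1) \<Longrightarrow> Re s \<le> 2 \<Longrightarrow>
       norm (deriv (hecke_L a) s / hecke_L a s) \<le> C * (log_height a (T + 1))\<^sup>2"
    by (rule hecke_L_logderiv_bound, rule that)
  obtain K where K1: "K \<ge> 1" "\<And>\<sigma>. 1 < \<sigma> \<Longrightarrow> \<sigma> \<le> 2 \<Longrightarrow> eis_zeta \<sigma> \<le> K / (\<sigma> - 1)"
    and K2: "\<And>\<sigma>. 1 < \<sigma> \<Longrightarrow> \<sigma> \<le> 2 \<Longrightarrow> eis_Lambda \<sigma> \<le> 1 / (\<sigma> - 1) + K"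
    by (rule near_1_bounds, rule that)
  \<comment> \<open>1/32 = 1/4 * 1/4 * 1/2: the new line lies c / 4 / l to the left of 1, l is at
    most 4 (A + \<open>sqrt L\<close>), and half of the resulting saving pays for the length T of
    the left edge.\<close>
  define c1 where "c1 = c / 32"
  \<comment> \<open>640 = 20 * 32, where 20 = 4 * 3 + 2 * 4 comes from the edges through
    \<open>H\<close> and \<open>V\<close> and 32 from \<open>Asq\<close>; 24 (1 + K) covers the
    truncation error.\<close>
  define CC where "CC = 640 * C + 24 * (1 + K)"
  show ?thesis
  proof (rule that[of c1 CC])
    show "0 < c1" "c1 \<le> 1/512" using c by (auto simp: c1_def)
    show "CC \<ge> 0" using C K1 by (simp add: CC_def)
    fix a :: int and x :: real assume a: "a \<noteq> 0" and L1: "ln x \<ge> 1" and x: "x > 1"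
    define L where "L = ln x"
    define A where "A = ln (1 + \<bar>real_of_int a\<bar>)"
    define y where "y = L / (A + sqrt L)"
    define T where "T = exp (c1 * y)"
    define E where "E = exp (- (c1 * y))"
    define l where "l = log_height a (T + 1)"
    \<comment> \<open>With this abscissa x^\<sigma> = e x, while \<open>eis_Lambda \<sigma>\<close>
      is at most L + K.\<close>
    define \<sigma> where "\<sigma> = 1 + 1 / L"
    define \<sigma>1 where "\<sigma>1 = 1 - c / 4 / l"
    have L: "L \<ge> 1" using L1 by (simp add: L_def)
    have A: "A \<ge> ln 2" using ln2_le_ln_Suc_abs[OF a] by (simp add: A_def)
    then have A0: "A > 0" using ln_gt_zero[of 2] by linarith
    have sL: "sqrt L \<ge> 1" using L by simp
    have AL: "A + sqrt L > 0" using A0 sL by linarith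
    have y0: "y \<ge> 0" using L A0 sL by (simp add: y_def)
    have ysq: "y \<le> sqrt L"
    proof -
      have "y \<le> L / sqrt L" unfolding y_def using L A0 sL AL by (intro divide_left_mono mult_pos_pos) auto
      then show ?thesis using L by (simp add: real_div_sqrt)
    qed
    have c1: "0 < c1" "c1 \<le> 1" using c by (auto simp: c1_def)
    have T1: "T \<ge> 1" using c1 y0 by (simp add: T_def)
    have TE: "1 / T = E" by (simp add: T_def E_def exp_minus divide_inverse)
    have l1: "l \<ge> 1" using log_height_ge_1 by (simp add: l_def)
    \<comment> \<open>By the choice of T, ln T = c1 y is at most \<open>sqrt L\<close>, so the width
      of the zero-free region at height T is governed by the same denominator as y. The constant ln
      6 is at most 3 A because A \<ge> ln 2.\<close>
    have l4: "l \<le> 4 * (A + sqrt L)"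
    proof -
      have "\<bar>of_int a\<bar> + \<bar>T + 1\<bar> + 4 \<le> 6 * (1 + \<bar>of_int a\<bar>) * T"
      proof -
        have "\<bar>of_int a\<bar> * 1 \<le> \<bar>of_int a\<bar> * T" using T1 by (intro mult_left_mono) auto
        then have "\<bar>of_int a\<bar> \<le> 6 * (\<bar>of_int a\<bar> * T)" using T1 by simp
        then show ?thesis using T1 by (simp add: algebra_simps)
      qed
      then have "l \<le> ln (6 * (1 + \<bar>of_int a\<bar>) * T)" unfolding l_def log_height_def using T1 by (subst ln_le_cancel_iff) (auto intro!: mult_pos_pos)
      also have "\<dots> = ln 6 + A + c1 * y"
      proof -
        have "ln (6 * m * T) = ln 6 + ln m + ln T" if "m > 0" for m :: real
          using that T1 by (simp add: ln_mult)
        from this[of "1 + \<bar>of_int a\<bar>"] show ?thesis by (simp add: A_def T_def)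
      qed
      finally have "l \<le> ln 6 + A + c1 * y" .
      moreover have "ln 6 \<le> 3 * A"
      proof -
        have "ln 6 \<le> ln (2 ^ 3 :: real)" by (subst ln_le_cancel_iff) auto
        moreover have "ln (2 ^ 3 :: real) = 3 * ln 2" using ln_realpow[of 2 3] by simp
        ultimately show ?thesis using A by linarith
      qed
      moreover have "c1 * y \<le> 1 * sqrt L" using c1 ysq y0 by (intro mult_mono) auto
      moreover have "r \<le> p + q + u \<Longrightarrow> p \<le> 3 * q \<Longrightarrow> u \<le> 1 * z \<Longrightarrow> 1 \<le> z \<Longrightarrow> r \<le> 4 * (q + z)" for p q r u z :: real
        by simp
      ultimately show ?thesis using sL by blast
    qed
    have Asq: "l\<^sup>2 \<le> 32 * (A\<^sup>2 + L)"
    proof -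
      have "l\<^sup>2 \<le> (4 * (A + sqrt L))\<^sup>2" using l4 l1 by (intro power_mono) auto
      also have "\<dots> = 16 * (A\<^sup>2 + 2 * A * sqrt L + (sqrt L)\<^sup>2)" by (simp add: power2_eq_square algebra_simps)
      also have "\<dots> \<le> 16 * (2 * (A\<^sup>2 + (sqrt L)\<^sup>2))"
        using zero_le_power2[of "A - sqrt L"] by (simp add: power2_eq_square algebra_simps)
      finally show ?thesis using L by simp
    qed
    have \<sigma>: "1 < \<sigma>" "\<sigma> \<le> 2" using L by (auto simp: \<sigma>_def)
    have cl: "0 < c / l" "c / l \<le> 1/16"
    proof -
      show "0 < c / l" using c l1 by simp
      have "c / l \<le> c / 1" using c l1 by (intro divide_left_mono) auto
      then have "c / l \<le> c" by simp
      then show "c / l \<le> 1/16" using c(2) by (rule order_trans)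
    qed
    have cl4: "c / 4 / l = (c / l) / 4" by simp
    have \<sigma>1: "\<sigma>1 < 1" "\<sigma>1 \<ge> 1/2" "\<sigma>1 > 1 - c / l"
    proof -
      have "1 - d / 4 < 1 \<and> 1 - d / 4 \<ge> 1/2 \<and> 1 - d / 4 > 1 - d" if "0 < d" "d \<le> 1/16" for d :: real
        using that by simp
      from this[OF cl] show "\<sigma>1 < 1" "\<sigma>1 \<ge> 1/2" "\<sigma>1 > 1 - c / l" unfolding \<sigma>1_def cl4 by blast+
    qed
    define g where "g s = exp (s * of_real L) / s\<^sup>2" for s :: complex
    define F where "F s = deriv (hecke_L a) s / hecke_L a s * g s" for s
    let ?p = "linepath (Complex \<sigma> (-T)) (Complex \<sigma> T)"
    \<comment> \<open>An open convex neighbourhood of the rectangle within the zero-free region,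
      which is known up to height T + 1.\<close>
    define S where "S = {s. Re s > 1 - c / l} \<inter> ({s. Im s > - (T + 1)} \<inter> {s. Im s < T + 1})"
    have Scon: "convex S" unfolding S_def
      by (intro convex_Int convex_halfspace_Re_gt convex_halfspace_Im_gt convex_halfspace_Im_lt)
    have Sop: "open S" unfolding S_def
      by (intro open_Int open_halfspace_Re_gt open_halfspace_Im_gt open_halfspace_Im_lt)
    have S34: "S \<subseteq> {s. Re s > 3/4}" using cl by (auto simp: S_def)
    have Shol: "F holomorphic_on S"
    proof -
      have "hecke_L a s \<noteq> 0" "s \<noteq> 0" if "s \<in> S" for s
      proof -
        show "hecke_L a s \<noteq> 0" by (rule nz[OF a, of T]) (use that T1 in \<open>auto simp: S_def l_def abs_le_iff\<close>)
        show "s \<noteq> 0" using that S34 by auto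
      qed
      moreover have "hecke_L a holomorphic_on S" "deriv (hecke_L a) holomorphic_on S"
        using hecke_L_holomorphic[OF a] holomorphic_deriv[OF hecke_L_holomorphic[OF a] open_halfplane_34] S34
        by (auto intro: holomorphic_on_subset)
      ultimately show ?thesis unfolding F_def[abs_def] g_def using Sop by (intro holomorphic_intros) auto
    qed
    have ldT: "norm (deriv (hecke_L a) s / hecke_L a s) \<le> C * l\<^sup>2" if "\<sigma>1 \<le> Re s" "Re s \<le> \<sigma>" "\<bar>Im s\<bar> \<le> T" for s
      using ld[OF a, of T s] T1 that \<sigma> by (simp add: l_def \<sigma>1_def)
    \<comment> \<open>On the horizontal edges |s| \<ge> T, which saves T^2; on the left edge |s|
      \<ge> 1/2, which costs the factor 4 in V.\<close>
    define H where "H = C * l\<^sup>2 * (exp (\<sigma> * L) / T\<^sup>2)"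
    define V where "V = C * l\<^sup>2 * (exp (\<sigma>1 * L) * 4)"
    have "norm (contour_integral ?p F) \<le> 2 * H * (\<sigma> - \<sigma>1) + V * (2 * T)"
    proof (rule rectangle_shift_bound[OF Scon Sop Shol])
      show "\<sigma>1 < \<sigma>" "T > 0" using \<sigma> \<sigma>1 T1 by auto
      show "s \<in> S" if "\<sigma>1 \<le> Re s" "Re s \<le> \<sigma>" "\<bar>Im s\<bar> \<le> T" for s
        using that \<sigma>1(3) by (auto simp: S_def abs_le_iff)
      show "H \<ge> 0" "V \<ge> 0" using C by (auto simp: H_def V_def)
      show "norm (F s) \<le> H" if s: "\<sigma>1 \<le> Re s" "Re s \<le> \<sigma>" "\<bar>Im s\<bar> = T" for s
      proof -
        have "T\<^sup>2 \<le> (norm s)\<^sup>2" using s(3) abs_Im_le_cmod[of s] T1 by (intro power_mono) auto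
        then have "norm (g s) \<le> exp (\<sigma> * L) / T\<^sup>2"
          unfolding g_def norm_divide norm_power using s L T1 by (intro frac_le) auto
        then show ?thesis unfolding F_def H_def norm_mult using ldT[of s] s C by (intro mult_mono) auto
      qed
      show "norm (F s) \<le> V" if s: "Re s = \<sigma>1" "\<bar>Im s\<bar> \<le> T" for s
      proof -
        have "(1/2)\<^sup>2 \<le> (norm s)\<^sup>2" using s(1) complex_Re_le_cmod[of s] \<sigma>1 by (intro power_mono) auto
        then have "norm (g s) \<le> exp (\<sigma>1 * L) / (1/2)\<^sup>2"
          unfolding g_def norm_divide norm_power using s by (intro frac_le) auto
        then have "norm (g s) \<le> exp (\<sigma>1 * L) * 4" by (simp add: power2_eq_square)
        then show ?thesis unfolding F_def V_def norm_mult using ldT[of s] s \<sigma> \<sigma>1 C by (intro mult_mono) auto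
      qed
    qed
    also have "2 * H * (\<sigma> - \<sigma>1) \<le> 2 * H * 2"
      using C \<sigma> \<sigma>1 by (intro mult_left_mono) (auto simp: H_def)
    finally have IF: "norm (contour_integral ?p F) \<le> 4 * H + 2 * (V * T)" by simp
    have eqI: "contour_integral ?p (\<lambda>s. hecke_Lambda a s * g s)
        = - contour_integral ?p F"
    proof -
      have "contour_integral ?p (\<lambda>s. hecke_Lambda a s * g s)
        = contour_integral ?p (\<lambda>s. - F s)"
      proof (rule contour_integral_eq)
        fix s assume "s \<in> path_image ?p"
        then have "Re s = \<sigma>" using closed_segment_Re_eq[of s] by fastforce
        then show "hecke_Lambda a s * g s = - F s" using hecke_L_logderiv_gt_1[OF a, of s] \<sigma> by (simp add: F_def)
      qed
      then show ?thesis by (simp add: contour_integral_neg)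
    qed
    have eL: "exp L = x" using x by (simp add: L_def)
    have e\<sigma>: "exp (\<sigma> * L) \<le> 3 * x"
    proof -
      have "\<sigma> * L = L + 1" using L by (simp add: \<sigma>_def distrib_right)
      then have "exp (\<sigma> * L) = exp 1 * x" by (simp add: exp_add eL)
      also have "\<dots> \<le> 3 * x" using e_less_272 x by (intro mult_right_mono) linarith+
      finally show ?thesis .
    qed
    have e\<sigma>1: "exp (\<sigma>1 * L) * T \<le> x * E"
    proof -
      have "y / 4 \<le> L / l"
      proof -
        have "L / (4 * (A + sqrt L)) \<le> L / l" using l4 l1 L AL by (intro divide_left_mono mult_pos_pos) auto
        then show ?thesis unfolding y_def divide_divide_eq_left by (simp only: mult.commute)
      qed
      then have "c * (y / 4) \<le> c * (L / l)" using c by (intro mult_left_mono) auto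
      then have "\<sigma>1 * L + c1 * y \<le> L - c1 * y" by (simp add: \<sigma>1_def c1_def algebra_simps)
      then have "exp (\<sigma>1 * L + c1 * y) \<le> exp (L - c1 * y)" by simp
      then show ?thesis by (simp add: exp_add exp_diff T_def E_def eL exp_minus divide_inverse)
    qed
    have E: "0 < E" "E \<le> 1" using c1 y0 by (auto simp: E_def)
    have H: "H \<le> 3 * C * l\<^sup>2 * (x * E)"
    proof -
      have "exp (\<sigma> * L) / T\<^sup>2 = exp (\<sigma> * L) * (E * E)" by (simp add: TE[symmetric] power2_eq_square)
      also have "\<dots> \<le> (3 * x) * (E * 1)" using e\<sigma> E x by (intro mult_mono) auto
      finally have "H \<le> C * l\<^sup>2 * (3 * x * (E * 1))" unfolding H_def using C by (intro mult_left_mono) auto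
      then show ?thesis by (simp add: mult_ac)
    qed
    have V: "V * T \<le> 4 * C * l\<^sup>2 * (x * E)"
    proof -
      have "V * T = 4 * C * l\<^sup>2 * (exp (\<sigma>1 * L) * T)" by (simp add: V_def)
      also have "\<dots> \<le> 4 * C * l\<^sup>2 * (x * E)" using e\<sigma>1 C by (intro mult_left_mono) auto
      finally show ?thesis .
    qed
    have "norm (- contour_integral ?p F - 2 * pi * \<i> * Psi a x)
       \<le> 2 * pi * exp (\<sigma> * L) / T * eis_Lambda \<sigma>"
      using perron_Psi[OF \<sigma>(1), of T x a] T1 x unfolding eqI[symmetric] g_def L_def by simp
    also have "\<dots> \<le> 8 * (3 * x) * E * (L + K)"
    proof -
      have "eis_Lambda \<sigma> \<le> L + K" using K2[OF \<sigma>] L by (simp add: \<sigma>_def)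
      moreover have "2 * pi * exp (\<sigma> * L) * E \<le> 8 * (3 * x) * E"
        using e\<sigma> E pi_less_4 x by (intro mult_right_mono mult_mono) auto
      moreover have "2 * pi * exp (\<sigma> * L) / T = 2 * pi * exp (\<sigma> * L) * E" by (simp add: TE[symmetric])
      moreover have "8 * (3 * x) * E \<ge> 0" using E x by simp
      ultimately show ?thesis using eis_Lambda_nonneg[of \<sigma>] by (metis mult_mono)
    qed
    finally have P: "norm (- contour_integral ?p F - 2 * pi * \<i> * Psi a x) \<le> 24 * (L + K) * (x * E)"
      by (simp add: mult_ac)
    have "norm (Psi a x) \<le> 2 * pi * norm (Psi a x)"
      using pi_gt3 by (simp add: mult_le_cancel_right1)
    also have "\<dots> = norm (2 * pi * \<i> * Psi a x)" by (simp add: norm_mult)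
    also have "\<dots> \<le> norm (- contour_integral ?p F - 2 * pi * \<i> * Psi a x)
       + norm (contour_integral ?p F)"
      using norm_triangle_ineq4[of "- contour_integral ?p F - 2 * pi * \<i> * Psi a x"
         "- contour_integral ?p F"] by (simp add: norm_mult)
    also have "\<dots> \<le> 24 * (L + K) * (x * E) + (4 * (3 * C * l\<^sup>2 * (x * E)) + 2 * (4 * C * l\<^sup>2 * (x * E)))"
      using P IF H V by linarith
    also have "\<dots> = (20 * C * l\<^sup>2 + 24 * (L + K)) * (x * E)" by (simp add: algebra_simps)
    also have "\<dots> \<le> (CC * (A\<^sup>2 + L)) * (x * E)"
    proof (intro mult_right_mono)
      have "20 * C * l\<^sup>2 \<le> 20 * C * (32 * (A\<^sup>2 + L))" using Asq C by (intro mult_left_mono) auto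
      moreover have "L + K \<le> (1 + K) * (A\<^sup>2 + L)"
      proof -
        have "K * 1 \<le> K * L" using K1 L by (intro mult_left_mono) auto
        then have "L + K \<le> (1 + K) * L" by (simp add: algebra_simps)
        also have "\<dots> \<le> (1 + K) * (A\<^sup>2 + L)" using K1 by (intro mult_left_mono) auto
        finally show ?thesis .
      qed
      ultimately show "20 * C * l\<^sup>2 + 24 * (L + K) \<le> CC * (A\<^sup>2 + L)" by (simp add: CC_def algebra_simps)
    qed (use x E in auto)
    finally have "norm (Psi a x) \<le> CC * x * (A\<^sup>2 + L) * E" by (simp add: mult_ac)
    then show "norm (Psi a x) \<le> CC * x * ((ln (1 + \<bar>of_int a\<bar>))\<^sup>2 + ln x)
        * exp (- (c1 * (ln x / (ln (1 + \<bar>of_int a\<bar>) + sqrt (ln x)))))"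
      by (simp add: E_def y_def A_def L_def)
  qed
qed

section \<open>From prime powers to primes\<close>

definition prime_sum :: "int \<Rightarrow> real \<Rightarrow> complex" where
  "prime_sum a x = (\<Sum>P\<in>{P\<in>eis_nonzero_primes. eis_norm P \<le> x}.
     hecke_chi6 a P * of_real (ln (eis_norm P) * ln (x / eis_norm P)))"

text \<open>Higher prime powers: \<open>ln u \<le> 2 u powr (3/4)\<close>, and \<open>(P, k)\<close> is compared with \<open>(P, k div 2)\<close>.\<close>
lemma Psi_minus_prime_sum:
  assumes x: "x > 1"
  shows "norm (Psi a x - prime_sum a x) \<le> 4 * eis_Lambda (3/2) * x powr (3/4)"
proof -
  define t where "t j = Lambda_coeff a j * of_real (ln x - ln (prime_power_norm j))" for j
  define F1 where "F1 = {j\<in>prime_powers_upto x. snd j = 1}"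
  define F2 where "F2 = {j\<in>prime_powers_upto x. snd j \<ge> 2}"
  \<comment> \<open>Halving the exponent is two-to-one at most; once the parity is fixed it is
    injective.\<close>
  define F where "F r = {j\<in>F2. snd j mod 2 = r}" for r :: nat
  define h where "h = (\<lambda>j :: complex set \<times> nat. (fst j, snd j div 2))"
  have fin: "finite F1" "finite F2" "finite (F r)" for r using finite_prime_powers_upto[of x] by (auto simp: F1_def F2_def F_def)
  have "prime_powers_upto x = F1 \<union> F2" by (force simp: F1_def F2_def prime_powers_upto_def prime_powers_def)
  moreover have "F1 \<inter> F2 = {}" by (auto simp: F1_def F2_def)
  ultimately have "Psi a x = (\<Sum>j\<in>F1. t j) + (\<Sum>j\<in>F2. t j)"
    using fin by (simp add: Psi_def t_def sum.union_disjoint)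
  also have "(\<Sum>j\<in>F1. t j) = prime_sum a x"
    unfolding prime_sum_def
  proof (rule sum.reindex_bij_witness[of _ "\<lambda>P. (P, 1)" fst])
    fix j assume "j \<in> F1"
    then obtain P where P: "j = (P, 1)" "P \<in> eis_nonzero_primes" "sq_norm (prime_gen P) \<le> x"
      by (cases j) (auto simp: F1_def prime_powers_upto_def prime_powers_def prime_power_norm_def)
    then show "(fst j, 1) = j" "fst j \<in> {P\<in>eis_nonzero_primes. eis_norm P \<le> x}"
      by (auto simp: eis_norm_prime_gen sq_norm_def)
    have "sq_norm (prime_gen P) > 0" using sq_norm_prime_gen_ge_2[OF P(2)] by simp
    then show "hecke_chi6 a (fst j) * of_real (ln (eis_norm (fst j)) * ln (x / eis_norm (fst j))) = t j"
      using P x by (simp add: t_def Lambda_coeff_def prime_power_norm_def hecke_prime_gen eis_norm_prime_gen sq_norm_def[symmetric] ln_div)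
  next
    fix P assume "P \<in> {P\<in>eis_nonzero_primes. eis_norm P \<le> x}"
    then show "fst (P, 1) = P" "(P, 1) \<in> F1"
      by (auto simp: F1_def prime_powers_upto_def prime_powers_def prime_power_norm_def eis_norm_prime_gen sq_norm_def)
  qed
  finally have "Psi a x - prime_sum a x = (\<Sum>j\<in>F2. t j)" by simp
  also have "norm \<dots> \<le> (\<Sum>j\<in>F2. 2 * x powr (3/4) * Lambda_abs (3/2) (h j))"
  proof (rule sum_norm_le)
    fix j assume j: "j \<in> F2"
    then obtain P k where Pk: "j = (P,k)" "P \<in> eis_nonzero_primes" "k \<ge> 2" "sq_norm (prime_gen P) ^ k \<le> x"
      by (cases j) (auto simp: F2_def prime_powers_upto_def prime_powers_def prime_power_norm_def)
    define N where "N = sq_norm (prime_gen P)"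
    have N: "N \<ge> 2" using sq_norm_prime_gen_ge_2[OF Pk(2)] by (simp add: N_def)
    have q: "N ^ k \<ge> 1" "N ^ k > 0" using N by (auto intro: one_le_power)
    define u where "u = x / N ^ k"
    have u: "u \<ge> 1" "u > 0" using Pk(4) q x by (auto simp: u_def N_def)
    have "ln u = 4/3 * ln (u powr (3/4))" using u by (simp add: ln_powr)
    also have "\<dots> \<le> 4/3 * (u powr (3/4) - 1)" using u by (intro mult_left_mono ln_le_minus_one) auto
    also have "\<dots> \<le> 2 * u powr (3/4)"
    proof -
      have *: "4/3 * (w - 1) \<le> 2 * w" if "w \<ge> 0" for w :: real using that by simp
      show ?thesis by (rule *[OF powr_ge_zero])
    qed
    finally have lu: "ln u \<le> 2 * u powr (3/4)" .
    have up: "u powr (3/4) = x powr (3/4) * (N ^ k) powr (- (3/4))"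
      using x q by (simp add: u_def powr_divide powr_minus_divide)
    \<comment> \<open>Rounding k / 2 down can only enlarge a negative power. The exponent 3/4
      becomes 3/2 > 1, where the \<Lambda>-series converges, and k \<ge> 2 keeps the halved exponent
      positive.\<close>
    have "(N ^ k) powr (- (3/4)) \<le> ((N ^ (k div 2)) ^ 2) powr (- (3/4))"
    proof (rule powr_mono2')
      have "(N ^ (k div 2)) ^ 2 = N ^ (k div 2 * 2)" by (simp add: power_mult)
      also have "\<dots> \<le> N ^ k" using N by (intro power_increasing) auto
      finally show "(N ^ (k div 2)) ^ 2 \<le> N ^ k" .
    qed (use N in auto)
    also have "((N ^ (k div 2)) ^ 2) powr (- (3/4)) = (N ^ (k div 2)) powr (- (3/2))"
    proof -
      have "N ^ (k div 2) > 0" using N by simp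
      then have "(N ^ (k div 2)) ^ 2 = (N ^ (k div 2)) powr 2" by simp
      then show ?thesis by (simp add: powr_powr)
    qed
    finally have "x powr (3/4) * (N ^ k) powr (- (3/4)) \<le> x powr (3/4) * (N ^ (k div 2)) powr (- (3/2))"
      by (intro mult_left_mono) auto
    then have lnu: "ln u \<le> 2 * (x powr (3/4) * (N ^ (k div 2)) powr (- (3/2)))"
      using lu up by linarith
    have jPP: "j \<in> prime_powers" using j by (simp add: F2_def prime_powers_upto_def)
    have "norm (t j) = ln N * ln u"
    proof -
      have "ln x - ln (prime_power_norm j) = ln u" using x q N by (simp add: u_def ln_div Pk prime_power_norm_def N_def[symmetric])
      moreover have "ln u \<ge> 0" using u by simp
      ultimately show ?thesis using norm_Lambda_coeff[OF jPP, of a] by (simp add: t_def norm_mult Pk N_def)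
    qed
    also have "\<dots> \<le> ln N * (2 * (x powr (3/4) * (N ^ (k div 2)) powr (- (3/2))))"
      using lnu N by (intro mult_left_mono) auto
    also have "\<dots> = 2 * x powr (3/4) * Lambda_abs (3/2) (h j)" by (simp add: h_def Lambda_abs_def Pk N_def)
    finally show "norm (t j) \<le> 2 * x powr (3/4) * Lambda_abs (3/2) (h j)" .
  qed
  also have "\<dots> = 2 * x powr (3/4) * (\<Sum>j\<in>F2. Lambda_abs (3/2) (h j))" by (simp add: sum_distrib_left)
  also have "\<dots> \<le> 2 * x powr (3/4) * (2 * eis_Lambda (3/2))"
  proof (rule mult_left_mono)
    have le: "(\<Sum>j\<in>F r. Lambda_abs (3/2) (h j)) \<le> eis_Lambda (3/2)" for r
    proof -
      have inj: "inj_on h (F r)"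
      proof (rule inj_onI)
        fix i j assume "i \<in> F r" "j \<in> F r" "h i = h j"
        then have "fst i = fst j" "snd i div 2 = snd j div 2" "snd i mod 2 = snd j mod 2" by (auto simp: F_def h_def)
        then show "i = j" by (metis div_mult_mod_eq prod_eqI)
      qed
      have sub: "h ` F r \<subseteq> prime_powers" by (force simp: F_def F2_def prime_powers_upto_def prime_powers_def h_def)
      have "(\<Sum>j\<in>F r. Lambda_abs (3/2) (h j)) = (\<Sum>j\<in>h ` F r. Lambda_abs (3/2) j)" using inj by (simp add: sum.reindex)
      also have "\<dots> \<le> eis_Lambda (3/2)"
        by (rule finite_sum_le_has_sum[OF eis_Lambda_has_sum]) (use fin sub Lambda_abs_nonneg in auto)
      finally show ?thesis .
    qed
    have "F2 = F 0 \<union> F 1" by (auto simp: F_def)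
    moreover have "F 0 \<inter> F 1 = {}" by (auto simp: F_def)
    ultimately have "(\<Sum>j\<in>F2. Lambda_abs (3/2) (h j)) = (\<Sum>j\<in>F 0. Lambda_abs (3/2) (h j)) + (\<Sum>j\<in>F 1. Lambda_abs (3/2) (h j))"
      using fin by (simp add: sum.union_disjoint)
    then show "(\<Sum>j\<in>F2. Lambda_abs (3/2) (h j)) \<le> 2 * eis_Lambda (3/2)" using le[of 0] le[of 1] by simp
  qed simp
  finally show ?thesis by (simp add: mult_ac)
qed

text \<open>Half of the exponential is spent. If L \<le> A^2, the factor A^2 + L is at most 2 A^2 by
  itself. Otherwise \<open>sqrt L\<close> exceeds A, so y is at least half of \<open>sqrt L\<close>,
  and exp (- v) \<le> 2 / v^2 with v proportional to \<open>sqrt L\<close> cancels L. Constants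
  become multiples of A^3 through A \<ge> ln 2.\<close>

lemma log_power_absorb:
  fixes A L c :: real
  assumes A: "A \<ge> ln 2" and L: "L > 0" and c: "c > 0"
  shows "(A\<^sup>2 + L) * exp (- (c * (L / (A + sqrt L)))) \<le> (2 / ln 2 + 64 / (c\<^sup>2 * ln 2 ^ 3)) * A ^ 3 * exp (- (c / 2 * (L / (A + sqrt L))))"
proof -
  define y where "y = L / (A + sqrt L)"
  define D where "D = 2 / ln 2 + 64 / (c\<^sup>2 * ln 2 ^ 3)"
  have l2: "ln (2::real) > 0" by simp
  have A0: "A > 0" using A l2 by linarith
  have y0: "y \<ge> 0" using A0 L by (simp add: y_def)
  have "(A\<^sup>2 + L) * exp (- (c / 2 * y)) \<le> D * A ^ 3"
  proof (cases "L \<le> A\<^sup>2")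
    case True
    have "(A\<^sup>2 + L) * exp (- (c / 2 * y)) \<le> (2 * A\<^sup>2) * 1" using True c y0 by (intro mult_mono) auto
    also have "\<dots> \<le> 2 / ln 2 * A ^ 3"
    proof -
      have "2 * A\<^sup>2 * ln 2 \<le> 2 * A\<^sup>2 * A" using A by (intro mult_left_mono) auto
      then show ?thesis using l2 by (simp add: field_simps power2_eq_square power3_eq_cube)
    qed
    also have "\<dots> \<le> D * A ^ 3" using A0 l2 c by (intro mult_right_mono) (auto simp: D_def)
    finally show ?thesis .
  next
    case False
    define z where "z = sqrt L"
    have z: "z > 0" "z\<^sup>2 = L" using L by (auto simp: z_def)
    have "A \<le> z" unfolding z_def using False A0 by (intro real_le_rsqrt) auto
    then have "L / (2 * z) \<le> y" unfolding y_def z_def[symmetric] using A0 z L by (intro divide_left_mono mult_pos_pos) auto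
    then have yz: "z / 2 \<le> y" using z by (simp add: power2_eq_square[of z] flip: z(2))
    define v where "v = c * z / 4"
    have v: "v > 0" using c z by (simp add: v_def)
    have "v\<^sup>2 / 2 \<le> exp v" using exp_lower_Taylor_quadratic[of v] v by simp
    then have ev: "exp (- v) \<le> 2 / v\<^sup>2" using v by (simp add: exp_minus field_simps)
    have "c * (z / 2) \<le> c * y" using yz c by (intro mult_left_mono) auto
    then have "v \<le> c / 2 * y" by (simp add: v_def)
    then have "exp (- (c / 2 * y)) \<le> exp (- v)" by simp
    then have "exp (- (c / 2 * y)) \<le> 2 / v\<^sup>2" using ev by linarith
    then have "(A\<^sup>2 + L) * exp (- (c / 2 * y)) \<le> (2 * L) * (2 / v\<^sup>2)"
      using False L by (intro mult_mono) auto
    also have "\<dots> = 64 / c\<^sup>2" using c z by (simp add: v_def power_mult_distrib power_divide field_simps flip: z(2))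
    also have "\<dots> \<le> 64 / (c\<^sup>2 * ln 2 ^ 3) * A ^ 3"
    proof -
      have "ln 2 ^ 3 \<le> A ^ 3" using A by (intro power_mono) auto
      then have "64 / c\<^sup>2 * 1 \<le> 64 / c\<^sup>2 * (A ^ 3 / ln 2 ^ 3)" using l2 by (intro mult_left_mono) auto
      then show ?thesis by simp
    qed
    also have "\<dots> \<le> D * A ^ 3" using A0 l2 by (intro mult_right_mono) (auto simp: D_def)
    finally show ?thesis .
  qed
  then have "(A\<^sup>2 + L) * exp (- (c / 2 * y)) * exp (- (c / 2 * y)) \<le> D * A ^ 3 * exp (- (c / 2 * y))"
    by (rule mult_right_mono) simp
  moreover have "exp (- (c / 2 * y)) * exp (- (c / 2 * y)) = exp (- (c * y))" by (simp flip: exp_add)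
  ultimately have "(A\<^sup>2 + L) * exp (- (c * y)) \<le> D * A ^ 3 * exp (- (c / 2 * y))"
    by (simp only: mult.assoc)
  then show ?thesis unfolding y_def D_def .
qed

theorem theorem3p7:
  shows "\<exists>c::real. c > 0 \<and> (\<exists>C::real. \<forall>a::int. \<forall>x::real. a \<noteq> 0 \<longrightarrow> x > 1 \<longrightarrow>
    cmod (\<Sum>P\<in>{P\<in>eis_nonzero_primes. eis_norm P \<le> x}.
       hecke_chi6 a P * of_real (ln (eis_norm P) * ln (x / eis_norm P)))
    \<le> C * x * exp (- c * ln x / (ln (1 + \<bar>real_of_int a\<bar>) + sqrt (ln x)))
        * (ln (1 + \<bar>real_of_int a\<bar>)) ^ 3)"
proof -
  obtain c C where c: "0 < c" "c \<le> 1/512" and C: "C \<ge> 0"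
    and Psi: "\<And>a x. a \<noteq> 0 \<Longrightarrow> ln x \<ge> 1 \<Longrightarrow> x > 1 \<Longrightarrow>
      norm (Psi a x) \<le> C * x * ((ln (1 + \<bar>of_int a\<bar>))\<^sup>2 + ln x) * exp (- (c * (ln x / (ln (1 + \<bar>of_int a\<bar>) + sqrt (ln x)))))"
    by (rule Psi_bound, rule that)
  define D where "D = 2 / ln 2 + 64 / (c\<^sup>2 * ln 2 ^ 3)"
  define G where "G = 4 * eis_Lambda (3/2)"
  \<comment> \<open>For ln x < 1 one has x < e < 3, so the sum has boundedly many terms, each of
    modulus at most 2 * 2 = 4.\<close>
  define n3 where "n3 = real (card {P\<in>eis_nonzero_primes. eis_norm P \<le> 3}) * 4"
  define CC where "CC = C * D + (G + exp 1 * n3) / ln 2 ^ 3"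
  have l2: "ln (2::real) > 0" by simp
  have l2': "ln (2::real) \<ge> 1/2"
  proof -
    have "ln (exp 1) \<le> ln (2 ^ 2 :: real)" using e_less_272 by (subst ln_le_cancel_iff) auto
    moreover have "ln (2 ^ 2 :: real) = 2 * ln 2" using ln_realpow[of 2 2] by simp
    ultimately show ?thesis by simp
  qed
  have D: "D \<ge> 0" using c l2 by (simp add: D_def)
  have G: "G \<ge> 0" using eis_Lambda_nonneg by (simp add: G_def)
  have n3: "n3 \<ge> 0" by (simp add: n3_def)
  have main: "norm (prime_sum a x) \<le> CC * x * exp (- (c / 2 * (ln x / (ln (1 + \<bar>of_int a\<bar>) + sqrt (ln x))))) * ln (1 + \<bar>of_int a\<bar>) ^ 3"
    if a: "a \<noteq> 0" and x: "x > 1" for a :: int and x :: real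
  proof -
    define L where "L = ln x"
    define A where "A = ln (1 + \<bar>real_of_int a\<bar>)"
    define y where "y = L / (A + sqrt L)"
    define E where "E = exp (- (c / 2 * y))"
    have L: "L > 0" using x by (simp add: L_def)
    have A: "A \<ge> ln 2" using ln2_le_ln_Suc_abs[OF a] by (simp add: A_def)
    have A0: "A > 0" using A l2 by linarith
    have A3: "1 \<le> A ^ 3 / ln 2 ^ 3" using A l2 by (simp add: power_mono)
    have E0: "E > 0" by (simp add: E_def)
    \<comment> \<open>The denominator of y is at least ln 2 \<ge> 1/2, and c \<le> 1/512 then keeps
      the claimed saving below x^(1/4). Hence the contribution x^(3/4) of higher prime powers stays
      below x E.\<close>
    have yL: "c / 2 * y \<le> L / 4"
    proof -
      have "y \<le> L / (1/2)" unfolding y_def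
        using A l2' L A0 by (intro divide_left_mono mult_pos_pos) (auto intro: add_pos_pos simp: add_increasing2)
      then have "c / 2 * y \<le> (1/512) / 2 * (2 * L)" using c L A0 by (intro mult_mono) (auto simp: y_def)
      then show ?thesis using L by simp
    qed
    have eL: "exp L = x" using x by (simp add: L_def)
    have "norm (prime_sum a x) \<le> CC * x * E * A ^ 3"
    proof (cases "L \<ge> 1")
      case True
      have "norm (Psi a x) \<le> C * x * ((A\<^sup>2 + L) * exp (- (c * y)))"
        using Psi[OF a _ x] True by (simp add: A_def L_def y_def mult.assoc)
      also have "\<dots> \<le> C * x * (D * A ^ 3 * E)"
        using log_power_absorb[OF A L c(1)] C x by (intro mult_left_mono) (auto simp: D_def E_def y_def)
      finally have 1: "norm (Psi a x) \<le> C * D * (x * E * A ^ 3)" by (simp add: mult_ac)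
      have "x powr (3/4) = exp (3/4 * L)" using x by (simp add: powr_def L_def)
      also have "\<dots> \<le> exp (L - c / 2 * y)" using yL by simp
      also have "\<dots> = x * E" by (simp add: E_def eL[symmetric] exp_add[symmetric])
      also have "\<dots> * 1 \<le> x * E * (A ^ 3 / ln 2 ^ 3)" using A3 x E0 by (intro mult_left_mono) auto
      finally have "x powr (3/4) \<le> x * E * A ^ 3 / ln 2 ^ 3" by simp
      then have "G * x powr (3/4) \<le> G * (x * E * A ^ 3 / ln 2 ^ 3)" using G by (rule mult_left_mono)
      then have 2: "norm (Psi a x - prime_sum a x) \<le> G / ln 2 ^ 3 * (x * E * A ^ 3)"
        using Psi_minus_prime_sum[OF x, of a] by (simp add: G_def)
      have "norm (prime_sum a x) \<le> norm (Psi a x) + norm (Psi a x - prime_sum a x)"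
        using norm_triangle_ineq4[of "Psi a x" "Psi a x - prime_sum a x"] by simp
      also have "\<dots> \<le> (C * D + G / ln 2 ^ 3) * (x * E * A ^ 3)" using 1 2 by (simp add: distrib_right)
      also have "\<dots> \<le> CC * (x * E * A ^ 3)"
        using x E0 A0 n3 l2 by (intro mult_right_mono) (auto simp: CC_def divide_right_mono)
      finally show ?thesis by (simp add: mult_ac)
    next
      case False
      have "x < exp 1" using False eL by (metis exp_less_cancel_iff not_le)
      then have x3: "x < 3" using e_less_272 by linarith
      have "norm (prime_sum a x) \<le> (\<Sum>P\<in>{P\<in>eis_nonzero_primes. eis_norm P \<le> x}. 4)"
        unfolding prime_sum_def
      proof (rule sum_norm_le)
        fix P assume P: "P \<in> {P\<in>eis_nonzero_primes. eis_norm P \<le> x}"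
        then have N: "eis_norm P \<ge> 2" "eis_norm P \<le> x" using sq_norm_prime_gen_ge_2[of P] by (auto simp: eis_norm_prime_gen sq_norm_def)
        have h: "norm (hecke_chi6 a P) \<le> 1" using P cmod_hecke_ang_le[of a "prime_gen P"] by (simp add: hecke_prime_gen)
        have "0 \<le> ln (eis_norm P)" "ln (eis_norm P) \<le> 2" using N x3 ln_le_minus_one[of "eis_norm P"] by auto
        moreover have "0 \<le> ln (x / eis_norm P)" using N by simp
        moreover have "ln (x / eis_norm P) \<le> 2"
        proof -
          have "x / eis_norm P \<le> 3 / 1" using N x3 by (intro frac_le) auto
          moreover have "x / eis_norm P > 0" using N x by simp
          ultimately show ?thesis using ln_le_minus_one[of "x / eis_norm P"] by linarith
        qed
        ultimately have "\<bar>ln (eis_norm P) * ln (x / eis_norm P)\<bar> \<le> 2 * 2"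
          unfolding abs_mult by (intro mult_mono) auto
        then have "norm (hecke_chi6 a P) * \<bar>ln (eis_norm P) * ln (x / eis_norm P)\<bar> \<le> 1 * (2 * 2)"
          using h by (intro mult_mono) auto
        then show "norm (hecke_chi6 a P * of_real (ln (eis_norm P) * ln (x / eis_norm P))) \<le> 4"
          by (simp only: norm_mult norm_of_real)
      qed
      also have "\<dots> = real (card {P\<in>eis_nonzero_primes. eis_norm P \<le> x}) * 4" by simp
      also have "\<dots> \<le> n3" unfolding n3_def using x3 finite_primes_bounded[of 3]
        by (intro mult_right_mono of_nat_mono card_mono) auto
      also have "\<dots> \<le> n3 * (exp 1 * (x * E))"
      proof -
        have "1 \<le> exp (1 + (L - c / 2 * y))" using yL L by simp
        also have "\<dots> = exp 1 * (x * E)" by (simp add: E_def eL[symmetric] exp_add[symmetric])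
        finally show ?thesis using n3 by (simp add: mult_le_cancel_left1)
      qed
      also have "\<dots> = n3 * (exp 1 * (x * E)) * 1" by simp
      also have "\<dots> \<le> n3 * (exp 1 * (x * E)) * (A ^ 3 / ln 2 ^ 3)"
        using A3 n3 x E0 by (intro mult_left_mono) auto
      also have "\<dots> = exp 1 * n3 / ln 2 ^ 3 * (x * E * A ^ 3)" by simp
      also have "\<dots> \<le> CC * (x * E * A ^ 3)"
        using x E0 A0 C D G l2 by (intro mult_right_mono) (auto simp: CC_def add_divide_distrib)
      finally show ?thesis by (simp add: mult_ac)
    qed
    then show ?thesis by (simp add: A_def L_def y_def E_def)
  qed
  show ?thesis
  proof (intro exI conjI allI impI)
    \<comment> \<open>The other half of c went into \<open>log_power_absorb\<close>.\<close>
    show "c / 2 > 0" using c by simp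
    fix a :: int and x :: real assume "a \<noteq> 0" "x > 1"
    from main[OF this] show "cmod (\<Sum>P\<in>{P\<in>eis_nonzero_primes. eis_norm P \<le> x}.
       hecke_chi6 a P * of_real (ln (eis_norm P) * ln (x / eis_norm P)))
    \<le> CC * x * exp (- (c / 2) * ln x / (ln (1 + \<bar>real_of_int a\<bar>) + sqrt (ln x)))
        * (ln (1 + \<bar>real_of_int a\<bar>)) ^ 3"
      by (simp add: prime_sum_def)
  qed
qed

end
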